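(* Let $d \ge 4$, let $1 \le p < \frac{2d}{d+2}$, and let $f \in L^1(\mathbb{R}^d) \cap L^p(\mathbb{R}^d)$. Suppose that the periodizations $g_\rho$ of $f$ belong to $L^2([0,1]^d)$ for almost every $\rho \in SO(d)$ and that $$G^2 := \int_{SO(d)} \|g_\rho\|_{L^2([0,1]^d)}^2 \, d\rho < \infty .$$ Then $f \in L^2(\mathbb{R}^d)$ and $$\|f\|_2 \le C\,(G + \|f\|_p),$$ where $C$ depends only on $d$ and $p$. The same conclusion holds if $G^2$ is replaced by $\int_{SO(d)} \|g_\rho - \hat g_\rho(0)\|_{L^2([0,1]^d)}^2 \, d\rho$.
   Context: For $f \in L^1(\mathbb{R}^d)$ and a rotation $\rho \in SO(d)$, the periodization of $f$ with respect to the rotated integer lattice is the $\mathbb{Z}^d$-periodic function $$g_\rho(x) = \sum_{\nu \in \mathbb{Z}^d} f(\rho(x-\nu)), \qquad x \in \mathbb{R}^d,$$ regarded as a function on $[0,1]^d$. The series converges absolutely for a.e. $x$, and $g_\rho \in L^1([0,1]^d)$. For $m \in \mathbb{Z}^d$, the Fourier coefficient is $\hat g_\rho(m) = \int_{[0,1]^d} g_\rho(x) e^{-2\pi i m\cdot x}\,dx$. In particular $\hat g_\rho(0) = \int_{\mathbb{R}^d} f$, and $g_\rho - \hat g_\rho(0)$ means $g_\rho$ minus this constant. Here $d\rho$ denotes the normalized Haar (probability) measure on $SO(d)$. *)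

theory Defs
  imports "HOL-Probability.Probability"
begin

definition SO :: "(real^'n^'n) set" where
  "SO = {\<rho>. orthogonal_matrix \<rho> \<and> det \<rho> = 1}"

definition haar_SO :: "(real^'n^'n) measure \<Rightarrow> bool" where
  "haar_SO \<mu> \<longleftrightarrow> prob_space \<mu> \<and> sets \<mu> = sets (restrict_space borel (SO :: (real^'n^'n) set)) \<and>
     (\<forall>\<rho>\<in>SO. \<forall>A\<in>sets \<mu>. emeasure \<mu> ((\<lambda>\<sigma>. \<rho> ** \<sigma>) -` A \<inter> SO) = emeasure \<mu> A)"

definition int_lattice :: "(real^'n) set" where
  "int_lattice = {\<nu>. \<forall>i. \<nu> $ i \<in> \<int>}"

definition unit_cube :: "(real^'n) set" where
  "unit_cube = cbox 0 One"

definition periodization :: "(real^'n \<Rightarrow> complex) \<Rightarrow> real^'n^'n \<Rightarrow> real^'n \<Rightarrow> complex" where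
  "periodization f \<rho> x = (\<Sum>\<^sub>\<infinity>\<nu>\<in>int_lattice. f (\<rho> *v (x - \<nu>)))"

definition memLp :: "real \<Rightarrow> (real^'n \<Rightarrow> complex) \<Rightarrow> bool" where
  "memLp p f \<longleftrightarrow> f \<in> borel_measurable lborel \<and> integrable lborel (\<lambda>x. norm (f x) powr p)"

definition Lp_norm :: "real \<Rightarrow> (real^'n \<Rightarrow> complex) \<Rightarrow> real" where
  "Lp_norm p f = (\<integral>x. norm (f x) powr p \<partial>lborel) powr (1 / p)"

definition memL2_cube :: "(real^'n \<Rightarrow> complex) \<Rightarrow> bool" where
  "memL2_cube g \<longleftrightarrow> g \<in> borel_measurable (restrict_space lborel unit_cube) \<and>
     set_integrable lborel unit_cube (\<lambda>x. (norm (g x))\<^sup>2)"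

definition L2_cube_sq :: "(real^'n \<Rightarrow> complex) \<Rightarrow> real" where
  "L2_cube_sq g = (\<integral>x\<in>unit_cube. (norm (g x))\<^sup>2 \<partial>lborel)"

definition fourier0 :: "(real^'n \<Rightarrow> complex) \<Rightarrow> complex" where
  "fourier0 g = (\<integral>x\<in>unit_cube. g x \<partial>lborel)"

end

(* Write F = |f^|^2 for the squared Fourier transform and S(t) for its Haar mean over the sphere of
   radius sqrt t.  Unfolding the periodization gives g_rho^(m) = f^(rho m), so Bessel's inequality and
   averaging over rho bound the sum of r_d(k) S(k) over k > 0 by G^2, where r_d(k) counts the lattice
   points with |m|^2 = k.  For k = 4 mod 8 one has r_d(k) >= c k^(d/2-1), because an odd u satisfies
   #{odd x in Z^4 : |x|^2 = 4u} = 16 sigma(u); this is where d >= 4 is used.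

   On the other hand, with damping exp(-pi eps t), the integral of F is a multiple of the integral of
   t^(d/2-1) S(t).  By Poisson summation in t (in the form of an inequality for Fejer kernels) it
   exceeds the samples at k = 4 mod 8 by at most the terms
   I_l = int F(xi) exp(-pi (eps - i l/4) |xi|^2) d xi, l > 0.
   The corresponding Gaussian operator has norm O(l^(-d/2)) from L^1 to L^infinity and at most 1 on
   L^2, so interpolation gives |I_l| <= C l^(-kappa) ||f||_p^2, and kappa > 1 can be chosen exactly
   because p < 2d/(d+2).  Letting eps tend to 0 yields the bound on ||f||_2. *)
theory Submission
  imports Defs "HOL-Real_Asymp.Real_Asymp"
begin

section \<open>Sums of four odd squares\<close>

text \<open>Some restriction on k is forced: in dimension 4 there are only 24 lattice points with
  |m|^2 = 2^j, so r_4(k) >= c k fails in general. The spacing 8 of the progression fixes the dual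
  frequencies l/8, hence the phases exp(i pi l t / 4). The mean S is continuous, but f has no decay
  that would make it smooth. Fejer kernels are finite trigonometric sums, so expanding them raises
  no question of convergence, and being nonnegative they form an approximate identity at the sample
  points. Interpolating at theta = 2/p - 1 between the two operator bounds gives decay l^(-d
  theta/2), and d theta/2 > 1 is the condition p < 2d/(d+2). The interpolation is carried out on
  dyadic level sets of |f|, with exponents slightly off theta on either side so that the double sum
  over levels converges. Square integrability of f^ is part of the conclusion. The damping keeps
  every integral finite, all bounds are uniform in it, and the L2 norm is recovered only in the
  limit. Subtracting a constant from g_rho changes no coefficient with m different from 0, so one
  estimate serves both versions.\<close>

definition odd_quads :: "int \<Rightarrow> (int \<times> int \<times> int \<times> int) set" where
  "odd_quads n = {(a, b, c, d). odd a \<and> odd b \<and> odd c \<and> odd d \<and> a\<^sup>2 + b\<^sup>2 + c\<^sup>2 + d\<^sup>2 = n}"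

text \<open>Triples as in the involution proof of the two-square theorem, cut down to odd entries. A
  triple records a divisor \<open>d\<close> of (n - x^2)/4 with its codivisor \<open>e\<close>, so
  sums over this set are sums over divisors.\<close>

definition zagier :: "int \<Rightarrow> (int \<times> int \<times> int) set" where
  "zagier n = {(x, d, e). odd x \<and> odd d \<and> odd e \<and> d > 0 \<and> e > 0 \<and> x\<^sup>2 + 4 * d * e = n}"

lemma abs_le_of_square_le:
  fixes x n :: int assumes "x\<^sup>2 \<le> n" shows "\<bar>x\<bar> \<le> n"
proof -
  have "\<bar>x\<bar> \<le> x\<^sup>2" using self_le_power[of "\<bar>x\<bar>" 2] by (cases "x = 0") auto
  then show ?thesis using assms by linarith
qed

lemma finite_odd_quads: "finite (odd_quads n)"
proof (rule finite_subset)
  show "odd_quads n \<subseteq> {-n..n} \<times> {-n..n} \<times> {-n..n} \<times> {-n..n}"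
  proof
    fix q assume "q \<in> odd_quads n"
    then obtain a b c d where q: "q = (a,b,c,d)" "a\<^sup>2 + b\<^sup>2 + c\<^sup>2 + d\<^sup>2 = n"
      by (auto simp: odd_quads_def)
    have "a\<^sup>2 \<ge> 0" "b\<^sup>2 \<ge> 0" "c\<^sup>2 \<ge> 0" "d\<^sup>2 \<ge> 0" by auto
    then have "\<bar>a\<bar> \<le> n" "\<bar>b\<bar> \<le> n" "\<bar>c\<bar> \<le> n" "\<bar>d\<bar> \<le> n"
      using q(2) by (auto intro!: abs_le_of_square_le)
    then show "q \<in> {-n..n} \<times> {-n..n} \<times> {-n..n} \<times> {-n..n}" using q(1) by auto
  qed
qed simp

lemma zagier_bounds:
  assumes "(x, d, e) \<in> zagier n"
  shows "\<bar>x\<bar> \<le> n" "d \<le> n" "e \<le> n" "x\<^sup>2 < n" "d > 0" "e > 0"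
proof -
  have z: "d > 0" "e > 0" "x\<^sup>2 + 4 * d * e = n" using assms by (auto simp: zagier_def)
  have "d * e \<ge> d * 1" using z by (intro mult_left_mono) auto
  moreover have "d * e \<ge> 1 * e" using z by (intro mult_right_mono) auto
  moreover have "x\<^sup>2 \<ge> 0" by simp
  moreover have "4 * d * e = 4 * (d * e)" by simp
  ultimately show "d \<le> n" "e \<le> n" "x\<^sup>2 < n" using z by linarith+
  then show "\<bar>x\<bar> \<le> n" by (intro abs_le_of_square_le) auto
qed (use assms in \<open>auto simp: zagier_def\<close>)

lemma finite_zagier: "finite (zagier n)"
proof (rule finite_subset)
  show "zagier n \<subseteq> {-n..n} \<times> {0..n} \<times> {0..n}"
  proof
    fix t assume t: "t \<in> zagier n"
    obtain x d e where "t = (x, d, e)" by (cases t)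
    then show "t \<in> {-n..n} \<times> {0..n} \<times> {0..n}"
      using zagier_bounds[of x d e n] t by auto
  qed
qed simp

lemma sum_involution:
  fixes F :: "'a \<Rightarrow> 'b::comm_monoid_add"
  assumes "\<And>x. x \<in> A \<Longrightarrow> h x \<in> A" "\<And>x. x \<in> A \<Longrightarrow> h (h x) = x"
  shows "(\<Sum>x\<in>A. F (h x)) = sum F A"
  by (rule sum.reindex_bij_witness[where i = h and j = h]) (use assms in auto)

text \<open>Flipping signs reduces the sum to the triples with \<open>e > x + d\<close>. There the involution \<open>(x, d, e) \<mapsto> (-x - 2d, d, e - x - d)\<close>
  negates \<open>(d + e) (e - x) (d + x)\<close>, which is the symmetrized summand up to a term odd in \<open>x\<close>.\<close>
lemma sum_zagier_zero:
  "(\<Sum>(x, d, e)\<in>zagier n. d * (d * e - x\<^sup>2)) = 0"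
proof -
  define Z where "Z = zagier n"
  define A where "A = {t \<in> Z. case t of (x, d, e) \<Rightarrow> e > x + d}"
  have fin: "finite Z" unfolding Z_def by (rule finite_zagier)
  have finA: "finite A" using fin by (simp add: A_def)
  \<comment> \<open>By parity: \<open>e\<close> is odd and \<open>x + d\<close> is even. So the
    halves e > x + d and e < x + d exhaust the set.\<close>
  have ne: "e \<noteq> x + d" if "(x, d, e) \<in> Z" for x d e
    using that by (auto simp: Z_def zagier_def)
  \<comment> \<open>The map (x, d, e) -> (-x, e, d) exchanges the two halves.\<close>
  have split: "(\<Sum>t\<in>Z. F t) = (\<Sum>(x, d, e)\<in>A. F (x, d, e) + F (-x, e, d))" for F :: "int \<times> int \<times> int \<Rightarrow> int"
  proof -
    have "(\<Sum>t\<in>Z. F t) = (\<Sum>t\<in>A. F t) + (\<Sum>t\<in>Z - A. F t)"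
      using fin by (metis (no_types, lifting) A_def Collect_subset add.commute mem_Collect_eq subsetI sum.subset_diff)
    also have "(\<Sum>t\<in>Z - A. F t) = (\<Sum>(x, d, e)\<in>A. F (-x, e, d))"
      by (rule sum.reindex_bij_witness[where i = "\<lambda>(x, d, e). (-x, e, d)" and j = "\<lambda>(x, d, e). (-x, e, d)"])
        (use ne in \<open>fastforce simp: A_def Z_def zagier_def algebra_simps\<close>)+
    finally show ?thesis by (simp add: sum.distrib case_prod_unfold)
  qed
  define \<phi> where "\<phi> = (\<lambda>(x, d, e). (-x - 2 * d, d, e - x - d) :: int \<times> int \<times> int)"
  \<comment> \<open>The symmetrized summand (d + e)(de - x^2) equals K + x (d^2 - e^2). Under
    \<open>\<phi>\<close> the first two factors of \<open>K\<close> are exchanged and the third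
    changes sign.\<close>
  define K where "K = (\<lambda>(x, d, e). (d + e) * (e - x) * (d + x) :: int)"
  have "(\<Sum>t\<in>A. K (\<phi> t)) = sum K A"
  proof (rule sum_involution)
    show "\<phi> t \<in> A" if "t \<in> A" for t
      using that by (auto simp: A_def Z_def zagier_def \<phi>_def power2_eq_square algebra_simps)
    show "\<phi> (\<phi> t) = t" if "t \<in> A" for t
      by (auto simp: \<phi>_def split: prod.splits)
  qed
  moreover have "(\<Sum>t\<in>A. K (\<phi> t)) = - sum K A"
    unfolding sum_negf[symmetric]
  proof (rule sum.cong)
    fix t assume "t \<in> A"
    obtain x d e where "t = (x, d, e)" by (cases t)
    then show "K (\<phi> t) = - K t" by (simp add: K_def \<phi>_def algebra_simps)
  qed simp
  ultimately have K0: "sum K A = 0" by simp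
  \<comment> \<open>The reflection x -> -x kills this sum over the whole set; splitting it over
    \<open>A\<close> shows that the term left beside \<open>K\<close> sums to zero.\<close>
  have "(\<Sum>(x, d, e)\<in>Z. (-x) * d\<^sup>2) = (\<Sum>(x, d, e)\<in>Z. x * d\<^sup>2)"
    by (rule sum.reindex_bij_witness[where i = "\<lambda>(x, d, e). (-x, d, e)" and j = "\<lambda>(x, d, e). (-x, d, e)"])
      (auto simp: Z_def zagier_def)
  then have "(\<Sum>(x, d, e)\<in>Z. x * d\<^sup>2) = 0" by (simp add: case_prod_unfold sum_negf)
  then have O0: "(\<Sum>(x, d, e)\<in>A. x * d\<^sup>2 - x * e\<^sup>2) = 0"
    by (subst (asm) split) (simp add: case_prod_unfold)
  have "(\<Sum>(x, d, e)\<in>Z. d * (d * e - x\<^sup>2)) = (\<Sum>(x, d, e)\<in>A. d * (d * e - x\<^sup>2) + e * (e * d - x\<^sup>2))"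
    by (subst split) (simp add: case_prod_unfold)
  also have "\<dots> = (\<Sum>(x, d, e)\<in>A. K (x, d, e) + (x * d\<^sup>2 - x * e\<^sup>2))"
    by (rule sum.cong) (auto simp: K_def algebra_simps power2_eq_square)
  also have "\<dots> = sum K A + (\<Sum>(x, d, e)\<in>A. x * d\<^sup>2 - x * e\<^sup>2)"
    by (simp add: sum.distrib case_prod_unfold)
  finally show ?thesis using K0 O0 by (simp add: Z_def)
qed

section \<open>Linear recursions for four odd squares and for divisor sums\<close>

definition odd_roots :: "int \<Rightarrow> int set" where
  "odd_roots n = {x. odd x \<and> x\<^sup>2 < n}"

definition odd_quints :: "int \<Rightarrow> (int \<times> int \<times> int \<times> int \<times> int) set" where
  "odd_quints n = {(x, q). odd x \<and> q \<in> odd_quads (n - x\<^sup>2)}"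

lemma finite_odd_roots: "finite (odd_roots n)"
proof (rule finite_subset)
  show "odd_roots n \<subseteq> {-n..n}"
  proof
    fix x assume "x \<in> odd_roots n"
    then have "x\<^sup>2 \<le> n" by (auto simp: odd_roots_def)
    then show "x \<in> {-n..n}" using abs_le_of_square_le[of x n] by auto
  qed
qed simp

lemma odd_quads_pos: assumes "q \<in> odd_quads n" shows "n > 0"
proof -
  obtain a b c d where q: "odd a" "a\<^sup>2 + b\<^sup>2 + c\<^sup>2 + d\<^sup>2 = n"
    using assms by (auto simp: odd_quads_def)
  have "a \<noteq> 0" using q by auto
  then have "a\<^sup>2 > 0" by simp
  moreover have "b\<^sup>2 \<ge> 0" "c\<^sup>2 \<ge> 0" "d\<^sup>2 \<ge> 0" by auto
  ultimately show ?thesis using q(2) by linarith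
qed

lemma odd_quints_Sigma: "odd_quints n = (SIGMA x:odd_roots n. odd_quads (n - x\<^sup>2))"
  using odd_quads_pos by (force simp: odd_quints_def odd_roots_def)

text \<open>The five coordinates of a sum of five odd squares play the same role, so
  \<open>n\<close> summed over all representations is five times the sum of x^2. Grouping by the
  first coordinate gives a linear relation between the four-square counts.\<close>

lemma sum_odd_quints_zero:
  "(\<Sum>x\<in>odd_roots n. (n - 5 * x\<^sup>2) * int (card (odd_quads (n - x\<^sup>2)))) = 0"
proof -
  let ?Q = "odd_quints n"
  have "(\<Sum>(x,a,b,c,d)\<in>?Q. a\<^sup>2) = (\<Sum>(x,a,b,c,d)\<in>?Q. x\<^sup>2)"
    by (rule sum.reindex_bij_witness[where i = "\<lambda>(x,a,b,c,d). (a,x,b,c,d)" and j = "\<lambda>(x,a,b,c,d). (a,x,b,c,d)"])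
      (auto simp: odd_quints_def odd_quads_def)
  moreover have "(\<Sum>(x,a,b,c,d)\<in>?Q. b\<^sup>2) = (\<Sum>(x,a,b,c,d)\<in>?Q. x\<^sup>2)"
    by (rule sum.reindex_bij_witness[where i = "\<lambda>(x,a,b,c,d). (b,a,x,c,d)" and j = "\<lambda>(x,a,b,c,d). (b,a,x,c,d)"])
      (auto simp: odd_quints_def odd_quads_def)
  moreover have "(\<Sum>(x,a,b,c,d)\<in>?Q. c\<^sup>2) = (\<Sum>(x,a,b,c,d)\<in>?Q. x\<^sup>2)"
    by (rule sum.reindex_bij_witness[where i = "\<lambda>(x,a,b,c,d). (c,a,b,x,d)" and j = "\<lambda>(x,a,b,c,d). (c,a,b,x,d)"])
      (auto simp: odd_quints_def odd_quads_def)
  moreover have "(\<Sum>(x,a,b,c,d)\<in>?Q. d\<^sup>2) = (\<Sum>(x,a,b,c,d)\<in>?Q. x\<^sup>2)"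
    by (rule sum.reindex_bij_witness[where i = "\<lambda>(x,a,b,c,d). (d,a,b,c,x)" and j = "\<lambda>(x,a,b,c,d). (d,a,b,c,x)"])
      (auto simp: odd_quints_def odd_quads_def)
  moreover have "(\<Sum>(x,a,b,c,d)\<in>?Q. n) = (\<Sum>(x,a,b,c,d)\<in>?Q. x\<^sup>2 + a\<^sup>2 + b\<^sup>2 + c\<^sup>2 + d\<^sup>2)"
    by (rule sum.cong) (auto simp: odd_quints_def odd_quads_def)
  ultimately have "(\<Sum>(x,q)\<in>?Q. n - 5 * x\<^sup>2) = 0"
    by (simp add: sum.distrib case_prod_unfold sum_subtractf flip: sum_distrib_left)
  moreover have "(\<Sum>(x,q)\<in>?Q. n - 5 * x\<^sup>2) = (\<Sum>x\<in>odd_roots n. (n - 5 * x\<^sup>2) * int (card (odd_quads (n - x\<^sup>2))))"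
    unfolding odd_quints_Sigma
    by (subst sum.Sigma[symmetric]) (auto simp: finite_odd_roots finite_odd_quads mult.commute)
  ultimately show ?thesis by simp
qed

definition sigma_sum :: "int \<Rightarrow> int" where
  "sigma_sum u = (\<Sum>d | d > 0 \<and> d dvd u. d)"

lemma odd_square_mod8: fixes x :: int assumes "odd x" shows "x\<^sup>2 mod 8 = 1"
proof -
  from assms obtain k where k: "x = 2 * k + 1" by (elim oddE)
  have "even (k * (k + 1))" by simp
  then obtain m where m: "k * (k + 1) = 2 * m" by (elim evenE)
  have "x\<^sup>2 = 8 * m + 1" using m unfolding k power2_eq_square by (simp add: algebra_simps)
  then show ?thesis by simp
qed

lemma diff_odd_square:
  assumes "n mod 8 = (5::int)" "odd x"
  obtains u where "odd u" "n - x\<^sup>2 = 4 * u"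
proof -
  have "(n - x\<^sup>2) mod 8 = 4" using odd_square_mod8[OF assms(2)] assms(1) by presburger
  then have "\<exists>u. odd u \<and> n - x\<^sup>2 = 4 * u" by presburger
  then obtain u where "odd u" "n - x\<^sup>2 = 4 * u" by blast
  then show ?thesis by (rule that)
qed

text \<open>With n - x^2 = 4de the weight n - 5x^2 becomes 4(de - x^2), so the vanishing involution
  sum gives the divisor sums the same relation as the counts. The congruence makes (n - x^2)/4 odd,
  as the triples require.\<close>

lemma sum_sigma_zero:
  assumes n: "n mod 8 = (5::int)"
  shows "(\<Sum>x\<in>odd_roots n. (n - 5 * x\<^sup>2) * sigma_sum ((n - x\<^sup>2) div 4)) = 0"
proof -
  let ?D = "\<lambda>x. {d. d > 0 \<and> d dvd (n - x\<^sup>2) div 4}"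
  have finD: "finite (?D x)" if x: "x \<in> odd_roots n" for x
  proof -
    obtain u where u: "odd u" "n - x\<^sup>2 = 4 * u"
      using diff_odd_square[OF n] x by (auto simp: odd_roots_def)
    have "u \<noteq> 0" using u by auto
    then have "finite {d. d dvd u}" by simp
    then show ?thesis using u(2) by (auto elim: rev_finite_subset)
  qed
  have "(\<Sum>x\<in>odd_roots n. (n - 5 * x\<^sup>2) * sigma_sum ((n - x\<^sup>2) div 4)) =
     (\<Sum>(x,d)\<in>(SIGMA x:odd_roots n. ?D x). (n - 5 * x\<^sup>2) * d)"
    unfolding sigma_sum_def sum_distrib_left
    by (rule sum.Sigma) (use finD finite_odd_roots in auto)
  also have "\<dots> = (\<Sum>(x,d,e)\<in>zagier n. 4 * (d * (d * e - x\<^sup>2)))"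
  proof (rule sum.reindex_bij_witness[where j = "\<lambda>(x,d). (x,d,(n - x\<^sup>2) div 4 div d)" and i = "\<lambda>(x,d,e). (x,d)"], goal_cases)
    case (2 a)
    then obtain x d where a: "a = (x, d)" "odd x" "x\<^sup>2 < n" "d > 0" "d dvd (n - x\<^sup>2) div 4"
      by (auto simp: odd_roots_def)
    obtain u where u: "odd u" "n - x\<^sup>2 = 4 * u" using diff_odd_square[OF n] a by auto
    with a obtain e where e: "u = d * e" by auto
    have "u > 0" using u a by auto
    then have "e > 0" using e a by (simp add: zero_less_mult_iff)
    then show ?case using a u e by (auto simp: zagier_def)
  next
    case (3 b)
    then show ?case by (auto simp: zagier_def)
  next
    case (4 b)
    then obtain x d e where b: "b = (x,d,e)" "(x,d,e) \<in> zagier n" by (cases b) auto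
    have "x\<^sup>2 < n" using zagier_bounds[OF b(2)] by auto
    then show ?case using b by (auto simp: zagier_def odd_roots_def)
  next
    case (5 a)
    then obtain x d where a: "a = (x, d)" "odd x" "x\<^sup>2 < n" "d > 0" "d dvd (n - x\<^sup>2) div 4"
      by (auto simp: odd_roots_def)
    obtain u where u: "odd u" "n - x\<^sup>2 = 4 * u" using diff_odd_square[OF n] a by auto
    with a obtain e where e: "u = d * e" by auto
    have "n = x\<^sup>2 + 4 * d * e" using u e by simp
    then show ?case using a u e by (auto simp: algebra_simps)
  qed auto
  also have "\<dots> = 4 * (\<Sum>(x,d,e)\<in>zagier n. d * (d * e - x\<^sup>2))"
    by (simp add: sum_distrib_left case_prod_unfold)
  finally show ?thesis using sum_zagier_zero by simp
qed

lemma card_odd_quads_4: "card (odd_quads 4) = 16"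
proof -
  have "odd_quads 4 = {-1,1} \<times> {-1,1} \<times> {-1,1} \<times> {-1,1}"
  proof (intro equalityI subsetI)
    fix q :: "int \<times> int \<times> int \<times> int" assume "q \<in> odd_quads 4"
    then obtain a b c d where q: "q = (a,b,c,d)" "odd a" "odd b" "odd c" "odd d" "a\<^sup>2 + b\<^sup>2 + c\<^sup>2 + d\<^sup>2 = 4"
      by (auto simp: odd_quads_def)
    have ge: "x\<^sup>2 \<ge> 1" if "odd x" for x :: int
    proof -
      have "x \<noteq> 0" using that by auto
      then have "x\<^sup>2 > 0" by simp
      then show ?thesis by linarith
    qed
    have "a\<^sup>2 = 1" "b\<^sup>2 = 1" "c\<^sup>2 = 1" "d\<^sup>2 = 1" using ge[OF q(2)] ge[OF q(3)] ge[OF q(4)] ge[OF q(5)] q(6) by linarith+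
    then show "q \<in> {-1,1} \<times> {-1,1} \<times> {-1,1} \<times> {-1,1}" 
      unfolding q(1) power2_eq_1_iff by (simp only: mem_Times_iff fst_conv snd_conv insert_iff empty_iff) blast
  next
    fix q :: "int \<times> int \<times> int \<times> int" assume "q \<in> {-1,1} \<times> {-1,1} \<times> {-1,1} \<times> {-1,1}"
    then obtain a b c d where q: "q = (a,b,c,d)" "a \<in> {-1,1}" "b \<in> {-1,1}" "c \<in> {-1,1}" "d \<in> {-1,1}"
      by (cases q) blast
    have one: "odd x" "x\<^sup>2 = 1" if "x \<in> {-1,1}" for x :: int using that by auto
    show "q \<in> odd_quads 4" unfolding q(1) odd_quads_def using one[OF q(2)] one[OF q(3)] one[OF q(4)] one[OF q(5)] by simp
  qed
  then show ?thesis by (simp add: card_cartesian_product)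
qed

text \<open>Both sides satisfy the same linear recursion, with indices \<open>(n - x\<^sup>2) div 4\<close> for odd \<open>x\<close> and \<open>n = 4u + 1\<close>;
  for \<open>u \<noteq> 1\<close> the coefficient \<open>n - 5\<close> at \<open>x = \<plusminus>1\<close> is nonzero.\<close>
theorem card_odd_quads:
  assumes "odd u" "u > 0"
  shows "int (card (odd_quads (4 * u))) = 16 * sigma_sum u"
  using assms
proof (induction "nat u" arbitrary: u rule: less_induct)
  case less
  show ?case
  proof (cases "u = 1")
    case True
    have "{d::int. d > 0 \<and> d dvd 1} = {1}" by auto
    then show ?thesis using True card_odd_quads_4 by (simp add: sigma_sum_def)
  next
    case False
    define n where "n = 4 * u + 1"
    \<comment> \<open>The discrepancy between the two sides; subtracting the two relations shows
      that its weighted sum vanishes.\<close>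
    define D where "D = (\<lambda>x. int (card (odd_quads (n - x\<^sup>2))) - 16 * sigma_sum ((n - x\<^sup>2) div 4))"
    have n: "n mod 8 = 5" unfolding n_def using less.prems by presburger
    have "(\<Sum>x\<in>odd_roots n. (n - 5 * x\<^sup>2) * D x) = 0"
      using sum_odd_quints_zero[of n] sum_sigma_zero[OF n]
      by (simp add: D_def right_diff_distrib sum_subtractf mult.left_commute[of _ 16] flip: sum_distrib_left)
    \<comment> \<open>For |x| > 1 the index (n - x^2)/4 is below \<open>u\<close> and the induction
      hypothesis applies; x = 1 and x = -1 give \<open>u\<close> itself.\<close>
    moreover have "(\<Sum>x\<in>odd_roots n. (n - 5 * x\<^sup>2) * D x) = (\<Sum>x\<in>{-1,1}. (n - 5 * x\<^sup>2) * D x)"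
    proof (rule sum.mono_neutral_right)
      show "{-1,1} \<subseteq> odd_roots n" using less.prems by (auto simp: odd_roots_def n_def)
      show "\<forall>x\<in>odd_roots n - {-1, 1}. (n - 5 * x\<^sup>2) * D x = 0"
      proof
        fix x assume x: "x \<in> odd_roots n - {-1, 1}"
        obtain v where v: "odd v" "n - x\<^sup>2 = 4 * v" using diff_odd_square[OF n] x by (auto simp: odd_roots_def)
        have "v > 0" using x v by (auto simp: odd_roots_def)
        have "odd x" using x by (auto simp: odd_roots_def)
        then have "x \<noteq> 0" by auto
        have "\<bar>x\<bar> \<noteq> 1" using x by auto
        then have "\<bar>x\<bar> > 1" using \<open>x \<noteq> 0\<close> by linarith
        then have "x\<^sup>2 > 1" using one_less_power[of "\<bar>x\<bar>" 2] by simp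
        then have "v < u" using v(2) n_def by linarith
        have "int (card (odd_quads (4 * v))) = 16 * sigma_sum v"
          using less.hyps[of v] \<open>v < u\<close> \<open>v > 0\<close> v(1) by auto
        then show "(n - 5 * x\<^sup>2) * D x = 0" by (simp add: D_def v(2))
      qed
    qed (rule finite_odd_roots)
    ultimately have "2 * ((n - 5) * D 1) = 0" by (simp add: D_def)
    moreover have "n \<noteq> 5" using False n_def by auto
    ultimately have "D 1 = 0" by simp
    then show ?thesis by (simp add: D_def n_def)
  qed
qed

corollary card_odd_quads_ge:
  assumes "odd u" "u > 0"
  shows "int (card (odd_quads (4 * u))) \<ge> 16 * u"
proof -
  have "finite {d. d dvd u}" using assms by simp
  then have "finite {d. d > 0 \<and> d dvd u}" by (auto elim: rev_finite_subset)
  then have "u \<le> sigma_sum u"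
    unfolding sigma_sum_def using assms by (intro member_le_sum) auto
  then show ?thesis using card_odd_quads[OF assms] by simp
qed

section \<open>Gaussian kernels\<close>

text \<open>This is exp(-pi (a - i b) |x|^2), with modulus and phase kept apart so that absolute
  values reduce to a real Gaussian.\<close>

definition gauss :: "real \<Rightarrow> real \<Rightarrow> 'a::euclidean_space \<Rightarrow> complex" where
  "gauss a b x = exp (- pi * a * (norm x)\<^sup>2) * cis (pi * b * (norm x)\<^sup>2)"

lemma cis_measurable [measurable]: "cis \<in> borel_measurable borel"
  by (intro borel_measurable_continuous_onI continuous_on_cis continuous_intros)

lemma cnj_measurable [measurable]: "cnj \<in> borel_measurable borel"
  by (intro borel_measurable_continuous_onI continuous_on_cnj continuous_intros)

lemma gauss_measurable [measurable]: "gauss a b \<in> borel_measurable borel"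
  unfolding gauss_def[abs_def] by measurable

lemma norm_gauss: "norm (gauss a b x) = exp (- pi * a * (norm x)\<^sup>2)"
  by (simp add: gauss_def norm_mult)

abbreviation L1_norm :: "('a::euclidean_space \<Rightarrow> complex) \<Rightarrow> real" where
  "L1_norm f \<equiv> \<integral>x. norm (f x) \<partial>lborel"

lemma lborel_translation:
  fixes f :: "'a::euclidean_space \<Rightarrow> 'b::{banach, second_countable_topology}"
  assumes "f \<in> borel_measurable borel"
  shows "integrable lborel (\<lambda>x. f (c + x)) \<longleftrightarrow> integrable lborel f"
    and "(\<integral>x. f (c + x) \<partial>lborel) = (\<integral>x. f x \<partial>lborel)"
proof -
  have *: "distr lborel borel ((+) c) = (lborel :: 'a measure)" by (rule lborel_distr_plus)
  show "integrable lborel (\<lambda>x. f (c + x)) \<longleftrightarrow> integrable lborel f"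
    by (subst (2) *[symmetric], subst integrable_distr_eq) (use assms in auto)
  show "(\<integral>x. f (c + x) \<partial>lborel) = (\<integral>x. f x \<partial>lborel)"
    by (subst (2) *[symmetric], subst integral_distr) (use assms in auto)
qed

text \<open>A rescaling of the characteristic function of the standard normal law.\<close>

lemma gauss_ft_1:
  fixes y a :: real assumes a: "a > 0"
  shows "integrable lborel (\<lambda>u. complex_of_real (exp (- pi * a * u\<^sup>2)) * cis (2 * pi * (u * y)))"
    and "(\<integral>u. complex_of_real (exp (- pi * a * u\<^sup>2)) * cis (2 * pi * (u * y)) \<partial>lborel) = 1 / sqrt a * exp (- pi * y\<^sup>2 / a)"
proof -
  \<comment> \<open>The scales are chosen so that t (c u) = 2 pi u y and (c u)^2 / 2 = pi a
    u^2.\<close>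
  define t where "t = sqrt (2 * pi / a) * y"
  define c where "c = sqrt (2 * pi * a)"
  have c: "c > 0" "c \<noteq> 0" using a by (auto simp: c_def)
  let ?h = "\<lambda>x. std_normal_density x *\<^sub>R iexp (t * x)"
  have int: "integrable lborel ?h"
  proof (rule Bochner_Integration.integrable_bound)
    show "integrable lborel std_normal_density" by (rule integrable_normal_density) simp
  qed auto
  have "char std_normal_distribution t = (\<integral>x. ?h x \<partial>lborel)"
    unfolding char_def by (subst integral_density) (auto simp: normal_density_nonneg)
  then have val: "(\<integral>x. ?h x \<partial>lborel) = exp (- (t\<^sup>2) / 2)"
    by (simp add: char_std_normal_distribution)
  have eq: "?h (0 + c * u) = (1 / sqrt (2 * pi)) *\<^sub>R (exp (- pi * a * u\<^sup>2) * cis (2 * pi * (u * y)))" for u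
  proof -
    have "t * (c * u) = 2 * pi * (u * y)"
    proof -
      have "sqrt (2 * pi / a) * sqrt (2 * pi * a) = 2 * pi"
        using a real_sqrt_abs[of "2 * pi"] by (simp add: real_sqrt_mult[symmetric] power2_eq_square)
      then show ?thesis unfolding t_def c_def by (simp add: mult.commute mult.left_commute)
    qed
    moreover have "(c * u)\<^sup>2 / 2 = pi * a * u\<^sup>2"
      using a by (simp add: c_def power_mult_distrib)
    ultimately have "iexp (t * (c * u)) = cis (2 * pi * (u * y))" "std_normal_density (c * u) = 1 / sqrt (2 * pi) * exp (- pi * a * u\<^sup>2)"
      by (simp_all only: cis_conv_exp std_normal_density_def minus_divide_left[symmetric] mult_minus_left)
    then show ?thesis by (simp add: scaleR_conv_of_real)
  qed
  have "integrable lborel (\<lambda>u. ?h (0 + c * u))" by (rule lborel_integrable_real_affine[OF int c(2)])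
  then have "integrable lborel (\<lambda>u. (1 / sqrt (2 * pi)) *\<^sub>R (exp (- pi * a * u\<^sup>2) * cis (2 * pi * (u * y))))"
    unfolding eq .
  then have "integrable lborel (\<lambda>u. sqrt (2 * pi) *\<^sub>R ((1 / sqrt (2 * pi)) *\<^sub>R (exp (- pi * a * u\<^sup>2) * cis (2 * pi * (u * y)))))"
    by (rule integrable_scaleR_right)
  then show "integrable lborel (\<lambda>u. complex_of_real (exp (- pi * a * u\<^sup>2)) * cis (2 * pi * (u * y)))" by simp
  have "exp (- (t\<^sup>2) / 2) = \<bar>c\<bar> *\<^sub>R (\<integral>u. ?h (0 + c * u) \<partial>lborel)"
    unfolding val[symmetric] by (rule lborel_integral_real_affine[OF c(2)])
  also have "\<dots> = c *\<^sub>R (1 / sqrt (2 * pi)) *\<^sub>R (\<integral>u. complex_of_real (exp (- pi * a * u\<^sup>2)) * cis (2 * pi * (u * y)) \<partial>lborel)"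
    unfolding eq using c by simp
  also have "c *\<^sub>R (1 / sqrt (2 * pi)) *\<^sub>R (\<integral>u. complex_of_real (exp (- pi * a * u\<^sup>2)) * cis (2 * pi * (u * y)) \<partial>lborel)
     = sqrt a * (\<integral>u. complex_of_real (exp (- pi * a * u\<^sup>2)) * cis (2 * pi * (u * y)) \<partial>lborel)" (is "_ = _ * ?I")
    using a by (simp add: c_def real_sqrt_mult scaleR_conv_of_real)
  finally have "?I = exp (- (t\<^sup>2) / 2) / sqrt a" using a by (simp add: field_simps)
  moreover have "t\<^sup>2 / 2 = pi * y\<^sup>2 / a" using a by (simp add: t_def power_mult_distrib)
  ultimately show "?I = 1 / sqrt a * exp (- pi * y\<^sup>2 / a)"
    by (simp add: field_simps)
qed

lemma power2_norm_sum_Basis: "(norm (x::'a::euclidean_space))\<^sup>2 = (\<Sum>b\<in>Basis. (x \<bullet> b)\<^sup>2)"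
  unfolding power2_norm_eq_inner by (subst euclidean_inner) (simp add: power2_eq_square)

lemma cis_sum: "finite A \<Longrightarrow> cis (sum f A) = (\<Prod>x\<in>A. cis (f x))"
  by (induction A rule: finite_induct) (auto simp: cis_mult[symmetric])

lemma lborel_integral_prod:
  fixes g :: "'a::euclidean_space \<Rightarrow> real \<Rightarrow> complex"
  assumes g: "\<And>b. b \<in> Basis \<Longrightarrow> integrable lborel (g b)"
  shows "integrable lborel (\<lambda>x. \<Prod>b\<in>Basis. g b (x \<bullet> b))"
    and "(\<integral>x. (\<Prod>b\<in>Basis. g b (x \<bullet> b)) \<partial>lborel) = (\<Prod>b\<in>Basis. \<integral>u. g b u \<partial>lborel)"
proof -
  interpret product_sigma_finite "\<lambda>b::'a. lborel :: real measure"
    by standard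
  let ?T = "\<lambda>f::'a \<Rightarrow> real. \<Sum>b\<in>Basis. f b *\<^sub>R b"
  have T: "?T \<in> borel_measurable (\<Pi>\<^sub>M b\<in>Basis. lborel)" by measurable
  have inn: "?T f \<bullet> b = f b" if "b \<in> Basis" for f b
    using that by (simp add: inner_sum_left inner_Basis if_distrib if_distribR cong: if_cong)
  have eq: "(\<Prod>b\<in>Basis. g b (?T f \<bullet> b)) = (\<Prod>b\<in>Basis. g b (f b))" for f
    by (intro prod.cong) (simp_all only: inn)
  have [measurable]: "b \<in> Basis \<Longrightarrow> g b \<in> borel_measurable borel" for b using g[of b] by auto
  have m: "(\<lambda>x. \<Prod>b\<in>Basis. g b (x \<bullet> b)) \<in> borel_measurable borel" by measurable
  show "integrable lborel (\<lambda>x. \<Prod>b\<in>Basis. g b (x \<bullet> b))"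
    by (subst lborel_eq, subst integrable_distr_eq[OF T m], unfold eq) (rule product_integrable_prod, use g in auto)
  show "(\<integral>x. (\<Prod>b\<in>Basis. g b (x \<bullet> b)) \<partial>lborel) = (\<Prod>b\<in>Basis. \<integral>u. g b u \<partial>lborel)"
    by (subst lborel_eq, subst integral_distr[OF T m], unfold eq) (rule product_integral_prod, use g in auto)
qed

lemma gauss_ft:
  fixes y :: "'a::euclidean_space" assumes a: "a > 0"
  shows "integrable lborel (\<lambda>x::'a. gauss a 0 x * cis (2 * pi * (x \<bullet> y)))"
    and "(\<integral>x. gauss a 0 x * cis (2 * pi * (x \<bullet> y)) \<partial>lborel) =
       a powr (- real DIM('a) / 2) * exp (- pi * (norm y)\<^sup>2 / a)"
proof -
  let ?g = "\<lambda>b u. complex_of_real (exp (- pi * a * u\<^sup>2)) * cis (2 * pi * (u * (y \<bullet> b)))"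
  have eq: "gauss a 0 x * cis (2 * pi * (x \<bullet> y)) = (\<Prod>b\<in>Basis. ?g b (x \<bullet> b))" for x :: 'a
    unfolding gauss_def power2_norm_sum_Basis euclidean_inner[of x y]
    by (simp add: sum_distrib_left cis_sum exp_sum prod.distrib flip: of_real_prod)
  note prod = lborel_integral_prod[of ?g, OF gauss_ft_1(1)[OF a]]
  show "integrable lborel (\<lambda>x::'a. gauss a 0 x * cis (2 * pi * (x \<bullet> y)))"
    unfolding eq by (rule prod(1))
  have "(\<integral>x. gauss a 0 x * cis (2 * pi * (x \<bullet> y)) \<partial>lborel) = (\<Prod>b\<in>(Basis::'a set). \<integral>u. ?g b u \<partial>lborel)"
    unfolding eq by (rule prod(2))
  also have "\<dots> = (\<Prod>b\<in>(Basis::'a set). complex_of_real (1 / sqrt a * exp (- pi * (y \<bullet> b)\<^sup>2 / a)))"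
    by (intro prod.cong refl) (subst gauss_ft_1(2)[OF a], simp)
  also have "\<dots> = of_real ((1 / sqrt a) ^ DIM('a) * exp (\<Sum>b\<in>Basis. - pi * (y \<bullet> b)\<^sup>2 / a))"
    by (simp only: of_real_prod[symmetric] prod.distrib exp_sum[OF finite_Basis] prod_constant)
  also have "(\<Sum>b\<in>Basis. - pi * (y \<bullet> b)\<^sup>2 / a) = - pi * (norm y)\<^sup>2 / a"
    by (simp only: power2_norm_sum_Basis sum_distrib_left sum_divide_distrib)
  also have "(1 / sqrt a) ^ DIM('a) = a powr (- real DIM('a) / 2)"
  proof -
    have "1 / sqrt a = a powr (- 1/2)" using a by (simp add: powr_minus_divide powr_half_sqrt)
    then show ?thesis using a by (simp add: powr_powr powr_realpow[symmetric])
  qed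
  finally show "(\<integral>x. gauss a 0 x * cis (2 * pi * (x \<bullet> y)) \<partial>lborel) =
       a powr (- real DIM('a) / 2) * exp (- pi * (norm y)\<^sup>2 / a)" by simp
qed


lemma integrable_exp_norm:
  assumes a: "a > 0"
  shows "integrable lborel (\<lambda>x::'a::euclidean_space. exp (- pi * a * (norm x)\<^sup>2))"
    and "(\<integral>x. exp (- pi * a * (norm (x::'a::euclidean_space))\<^sup>2) \<partial>lborel) = a powr (- real DIM('a) / 2)"
proof -
  have g: "gauss a 0 x * cis (2 * pi * (x \<bullet> 0)) = complex_of_real (exp (- pi * a * (norm x)\<^sup>2))" for x :: 'a
    by (simp add: gauss_def)
  show i: "integrable lborel (\<lambda>x::'a. exp (- pi * a * (norm x)\<^sup>2))"
    using gauss_ft(1)[OF a, of "0::'a"] unfolding g complex_of_real_integrable_eq .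
  show "(\<integral>x. exp (- pi * a * (norm (x::'a))\<^sup>2) \<partial>lborel) = a powr (- real DIM('a) / 2)"
  proof -
    have "complex_of_real (\<integral>x. exp (- pi * a * (norm (x::'a))\<^sup>2) \<partial>lborel) = complex_of_real (a powr (- real DIM('a) / 2))"
      using gauss_ft(2)[OF a, of "0::'a"] unfolding g integral_complex_of_real by simp
    then show ?thesis by (simp only: of_real_eq_iff)
  qed
qed

lemma integrable_gauss: "a > 0 \<Longrightarrow> integrable lborel (gauss a b)"
  by (rule Bochner_Integration.integrable_bound[OF integrable_exp_norm(1)]) (auto simp: norm_gauss)

lemma norm_cis_mult [simp]: "norm (z * cis t) = norm z"
  by (simp add: norm_mult)

lemma integrable_gauss_cis:
  assumes "a > 0" shows "integrable lborel (\<lambda>x::'a::euclidean_space. gauss a b x * cis (2 * pi * (x \<bullet> y)))"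
  by (rule Bochner_Integration.integrable_bound[OF integrable_gauss[OF assms, of b]]) auto

text \<open>The convolution kernel of the Fourier multiplier \<open>gauss a b\<close>: an inverse
  transform, so the sign in the exponential is opposite to that of \<open>fourier\<close>
  below.\<close>

definition gauss_kernel :: "real \<Rightarrow> real \<Rightarrow> 'a::euclidean_space \<Rightarrow> complex" where
  "gauss_kernel a b y = (\<integral>x. gauss a b x * cis (2 * pi * (x \<bullet> y)) \<partial>lborel)"

text \<open>No branch of a complex square root is needed: in the square of the modulus, written as a double integral over \<open>(v + w, v)\<close>, the
  integral over \<open>v\<close> is the Fourier transform of a real Gaussian.\<close>
lemma gauss_kernel_bound:
  fixes y :: "'a::euclidean_space"
  assumes a: "a > 0"
  shows "norm (gauss_kernel a b y) \<le> (a\<^sup>2 + b\<^sup>2) powr (- real DIM('a) / 4)"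
proof -
  let ?d = "real DIM('a)"
  define \<phi> where "\<phi> = (\<lambda>x::'a. gauss a b x * cis (2 * pi * (x \<bullet> y)))"
  have [measurable]: "\<phi> \<in> borel_measurable borel" unfolding \<phi>_def by measurable
  have int: "integrable lborel \<phi>" unfolding \<phi>_def by (rule integrable_gauss_cis[OF a])
  have n\<phi>: "norm (\<phi> x) = exp (- pi * a * (norm x)\<^sup>2)" for x by (simp add: \<phi>_def norm_gauss)
  let ?k = "\<lambda>v w. \<phi> (v + w) * cnj (\<phi> v)"
  have fub: "integrable (lborel \<Otimes>\<^sub>M lborel) (\<lambda>(v, w). ?k v w)"
  proof (rule lborel_pair.Fubini_integrable)
    show "(\<lambda>(v, w). ?k v w) \<in> borel_measurable (lborel \<Otimes>\<^sub>M lborel)" by measurable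
    have "(\<integral>w. norm (?k v w) \<partial>lborel) = (\<integral>w. norm (\<phi> w) \<partial>lborel) * norm (\<phi> v)" for v
      unfolding norm_mult complex_mod_cnj
      by (simp add: lborel_translation(2)[where f = "\<lambda>w. norm (\<phi> w)"])
    then show "integrable lborel (\<lambda>v. \<integral>w. norm (case (v, w) of (v, w) \<Rightarrow> ?k v w) \<partial>lborel)"
      using int by simp
    show "AE v in lborel. integrable lborel (\<lambda>w. case (v, w) of (v, w) \<Rightarrow> ?k v w)"
      using int by (simp add: lborel_translation(1))
  qed
  \<comment> \<open>Completing the square at the midpoint: |v+w|^2 + |v|^2 = 2 |v + w/2|^2 + |w|^2 /
    2, while the phase difference |v+w|^2 - |v|^2 = 2 w . (v + w/2) is linear in v. So the
    v-integral is a Gaussian transform at frequency \<open>b *\<^sub>R w\<close>.\<close>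
  have cong: "?k v w = of_real (exp (- pi * a * (norm w)\<^sup>2 / 2)) * cis (2 * pi * (w \<bullet> y)) *
      (gauss (2 * a) 0 (w /\<^sub>R 2 + v) * cis (2 * pi * ((w /\<^sub>R 2 + v) \<bullet> (b *\<^sub>R w))))" for v w
  proof -
    have 1: "exp (- pi * a * (norm (v + w))\<^sup>2) * exp (- pi * a * (norm v)\<^sup>2) =
      exp (- pi * a * (norm w)\<^sup>2 / 2) * exp (- pi * (2 * a) * (norm (w /\<^sub>R 2 + v))\<^sup>2)"
      by (simp add: exp_add[symmetric] power2_norm_eq_inner inner_simps inner_commute field_simps)
    have 2: "cis (pi * b * (norm (v + w))\<^sup>2) * cis (2 * pi * ((v + w) \<bullet> y)) * cnj (cis (pi * b * (norm v)\<^sup>2)) * cnj (cis (2 * pi * (v \<bullet> y)))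
       = cis (2 * pi * (w \<bullet> y)) * cis (2 * pi * ((w /\<^sub>R 2 + v) \<bullet> (b *\<^sub>R w)))"
      unfolding cis_cnj cis_mult
      by (rule arg_cong[where f = cis])
         (simp add: power2_norm_eq_inner inner_simps inner_commute field_simps)
    have "?k v w = of_real (exp (- pi * a * (norm (v + w))\<^sup>2) * exp (- pi * a * (norm v)\<^sup>2)) *
       (cis (pi * b * (norm (v + w))\<^sup>2) * cis (2 * pi * ((v + w) \<bullet> y)) * cnj (cis (pi * b * (norm v)\<^sup>2)) * cnj (cis (2 * pi * (v \<bullet> y))))"
      by (simp add: \<phi>_def gauss_def mult_ac)
    also have "\<dots> = of_real (exp (- pi * a * (norm w)\<^sup>2 / 2) * exp (- pi * (2 * a) * (norm (w /\<^sub>R 2 + v))\<^sup>2)) *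
       (cis (2 * pi * (w \<bullet> y)) * cis (2 * pi * ((w /\<^sub>R 2 + v) \<bullet> (b *\<^sub>R w))))"
      unfolding 1 2 ..
    finally show ?thesis by (simp add: gauss_def mult_ac)
  qed
  \<comment> \<open>The decay rate in \<open>w\<close>: a/2 from the completed square and b^2/(2a)
    from the transform. The final integral brings in 2 a s = a^2 + b^2.\<close>
  define s where "s = a / 2 + b\<^sup>2 / (2 * a)"
  have s: "s > 0" using a by (simp add: s_def add_pos_nonneg)
  have inner: "norm (\<integral>v. ?k v w \<partial>lborel) = (2 * a) powr (- ?d / 2) * exp (- pi * s * (norm w)\<^sup>2)" for w
  proof -
    have "(\<integral>v. ?k v w \<partial>lborel) = of_real (exp (- pi * a * (norm w)\<^sup>2 / 2)) * cis (2 * pi * (w \<bullet> y)) *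
      (\<integral>v. gauss (2 * a) 0 (w /\<^sub>R 2 + v) * cis (2 * pi * ((w /\<^sub>R 2 + v) \<bullet> (b *\<^sub>R w))) \<partial>lborel)"
      unfolding cong by (rule integral_mult_right_zero)
    also have "(\<integral>v. gauss (2 * a) 0 (w /\<^sub>R 2 + v) * cis (2 * pi * ((w /\<^sub>R 2 + v) \<bullet> (b *\<^sub>R w))) \<partial>lborel) =
       (\<integral>v. gauss (2 * a) 0 v * cis (2 * pi * (v \<bullet> (b *\<^sub>R w))) \<partial>lborel)"
      by (rule lborel_translation(2)[where f = "\<lambda>v. gauss (2 * a) 0 v * cis (2 * pi * (v \<bullet> (b *\<^sub>R w)))"]) measurable
    also have "\<dots> = (2 * a) powr (- ?d / 2) * exp (- pi * (norm (b *\<^sub>R w))\<^sup>2 / (2 * a))"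
      by (subst gauss_ft(2)) (use a in auto)
    finally have "norm (\<integral>v. ?k v w \<partial>lborel) = exp (- pi * a * (norm w)\<^sup>2 / 2) * ((2 * a) powr (- ?d / 2) * exp (- pi * (norm (b *\<^sub>R w))\<^sup>2 / (2 * a)))"
      by (simp add: norm_mult)
    also have "\<dots> = (2 * a) powr (- ?d / 2) * exp (- pi * a * (norm w)\<^sup>2 / 2 + - pi * (norm (b *\<^sub>R w))\<^sup>2 / (2 * a))"
      by (simp only: exp_add mult_ac)
    also have "- pi * a * (norm w)\<^sup>2 / 2 + - pi * (norm (b *\<^sub>R w))\<^sup>2 / (2 * a) = - pi * s * (norm w)\<^sup>2"
      by (simp add: s_def power_mult_distrib field_simps)
    finally show ?thesis .
  qed
  have "gauss_kernel a b y * cnj (gauss_kernel a b y) = (\<integral>v. gauss_kernel a b y * cnj (\<phi> v) \<partial>lborel)"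
    unfolding gauss_kernel_def \<phi>_def[symmetric] using int by simp
  also have "\<dots> = (\<integral>v. (\<integral>w. ?k v w \<partial>lborel) \<partial>lborel)"
    by (simp add: gauss_kernel_def \<phi>_def[symmetric] lborel_translation(2)[where f = \<phi>])
  also have "\<dots> = (\<integral>w. (\<integral>v. ?k v w \<partial>lborel) \<partial>lborel)"
    using lborel_pair.Fubini_integral[OF fub] by simp
  finally have "norm (gauss_kernel a b y * cnj (gauss_kernel a b y)) = norm (\<integral>w. (\<integral>v. ?k v w \<partial>lborel) \<partial>lborel)"
    by simp
  also have "\<dots> \<le> (\<integral>w. norm (\<integral>v. ?k v w \<partial>lborel) \<partial>lborel)"
    by (rule integral_norm_bound)
  also have "\<dots> = (2 * a) powr (- ?d / 2) * (\<integral>w. exp (- pi * s * (norm (w::'a))\<^sup>2) \<partial>lborel)"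
    unfolding inner by simp
  also have "\<dots> = (2 * a) powr (- ?d / 2) * s powr (- ?d / 2)"
    by (subst integrable_exp_norm(2)[OF s]) simp
  also have "\<dots> = (2 * a * s) powr (- ?d / 2)"
    using a s by (simp add: powr_mult)
  also have "2 * a * s = a\<^sup>2 + b\<^sup>2" using a by (simp add: s_def field_simps power2_eq_square)
  finally have "(norm (gauss_kernel a b y))\<^sup>2 \<le> (a\<^sup>2 + b\<^sup>2) powr (- ?d / 2)"
    by (simp add: norm_mult power2_eq_square)
  also have "\<dots> = ((a\<^sup>2 + b\<^sup>2) powr (- ?d / 4))\<^sup>2"
    by (simp add: power2_eq_square powr_add[symmetric])
  finally show ?thesis by (rule power2_le_imp_le) simp
qed

section \<open>Continuity of translations in L1\<close>

lemma integrable_translation_diff: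
  fixes f :: "'a::euclidean_space \<Rightarrow> 'b::{banach, second_countable_topology}"
  assumes "integrable lborel f"
  shows "integrable lborel (\<lambda>x. f (u + x) - f x)"
proof -
  have [measurable]: "f \<in> borel_measurable borel" using assms by auto
  show ?thesis using assms lborel_translation(1)[of f u] by auto
qed

text \<open>Translations are isometries of L1, so the functions with this limit form a closed set; a
  three-epsilon argument. It serves two inductive cases below: indicators, approximated by open
  sets, and pointwise limits.\<close>

lemma L1_translation_closure:
  fixes f :: "'a::euclidean_space \<Rightarrow> 'b::{banach, second_countable_topology}" and u :: "nat \<Rightarrow> 'a"
  assumes f: "integrable lborel f"
    and approx: "\<And>e. e > 0 \<Longrightarrow> \<exists>g. integrable lborel g \<and> (\<integral>x. norm (f x - g x) \<partial>lborel) < e \<and>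
      (\<lambda>n. \<integral>x. norm (g (u n + x) - g x) \<partial>lborel) \<longlonglongrightarrow> 0"
  shows "(\<lambda>n. \<integral>x. norm (f (u n + x) - f x) \<partial>lborel) \<longlonglongrightarrow> 0"
proof (rule LIMSEQ_I)
  fix e :: real assume "e > 0"
  then obtain g where g: "integrable lborel g" "(\<integral>x. norm (f x - g x) \<partial>lborel) < e / 3"
    and lim: "(\<lambda>n. \<integral>x. norm (g (u n + x) - g x) \<partial>lborel) \<longlonglongrightarrow> 0"
    using approx[of "e / 3"] by auto
  have [measurable]: "f \<in> borel_measurable borel" "g \<in> borel_measurable borel" using f g by auto
  obtain N where N: "\<And>n. n \<ge> N \<Longrightarrow> (\<integral>x. norm (g (u n + x) - g x) \<partial>lborel) < e / 3"
    using LIMSEQ_D[OF lim, of "e / 3"] \<open>e > 0\<close> by auto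
  show "\<exists>N. \<forall>n\<ge>N. norm ((\<integral>x. norm (f (u n + x) - f x) \<partial>lborel) - 0) < e"
  proof (intro exI allI impI)
    fix n assume "n \<ge> N"
    let ?h = "\<lambda>x. f x - g x"
    have hi: "integrable lborel ?h" using f g by simp
    have ti: "integrable lborel (\<lambda>x. ?h (u n + x))" using hi by (subst lborel_translation(1)) auto
    have "(\<integral>x. norm (f (u n + x) - f x) \<partial>lborel) \<le>
      (\<integral>x. norm (?h (u n + x)) + norm (?h x) + norm (g (u n + x) - g x) \<partial>lborel)"
    proof (rule integral_mono)
      show "integrable lborel (\<lambda>x. norm (f (u n + x) - f x))"
        using integrable_translation_diff[OF f] by simp
      show "integrable lborel (\<lambda>x. norm (?h (u n + x)) + norm (?h x) + norm (g (u n + x) - g x))"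
        using integrable_translation_diff[OF g(1), of "u n"] hi ti by auto
      fix x
      have "f (u n + x) - f x = ?h (u n + x) - ?h x + (g (u n + x) - g x)" by simp
      then show "norm (f (u n + x) - f x) \<le> norm (?h (u n + x)) + norm (?h x) + norm (g (u n + x) - g x)"
        by (metis norm_triangle_ineq4 norm_triangle_le add_right_mono)
    qed
    also have "\<dots> = (\<integral>x. norm (?h (u n + x)) \<partial>lborel) + (\<integral>x. norm (?h x) \<partial>lborel) + (\<integral>x. norm (g (u n + x) - g x) \<partial>lborel)"
      using integrable_translation_diff[OF g(1), of "u n"] hi ti by simp
    also have "(\<integral>x. norm (?h (u n + x)) \<partial>lborel) = (\<integral>x. norm (?h x) \<partial>lborel)"
      by (rule lborel_translation(2)[where f = "\<lambda>x. norm (?h x)"]) measurable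
    finally show "norm ((\<integral>x. norm (f (u n + x) - f x) \<partial>lborel) - 0) < e"
      using g(2) N[OF \<open>n \<ge> N\<close>] by simp
  qed
qed

text \<open>Openness gives convergence at the points of \<open>U\<close> only. That is enough: by
  translation invariance both halves of the symmetric difference have the same measure, so the
  integral is twice the part inside \<open>U\<close>.\<close>

lemma L1_translation_indicator_open:
  fixes U :: "'a::euclidean_space set"
  assumes U: "open U" "emeasure lborel U < \<infinity>" and u: "u \<longlonglongrightarrow> 0"
  shows "(\<lambda>n. \<integral>x. norm (indicator U (u n + x) - indicator U x :: real) \<partial>lborel) \<longlonglongrightarrow> 0"
proof -
  have [measurable]: "U \<in> sets borel" using U by auto
  let ?I = "indicator U :: 'a \<Rightarrow> real"
  have I: "integrable lborel ?I" using U by (intro integrable_real_indicator) auto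
  have It: "integrable lborel (\<lambda>x. ?I (v + x))" for v using I by (subst lborel_translation(1)) auto
  have J: "integrable lborel (\<lambda>x. ?I x * (1 - ?I (v + x)))" for v
    by (rule Bochner_Integration.integrable_bound[OF I]) (auto split: split_indicator)
  have "(\<integral>x. norm (?I (u n + x) - ?I x) \<partial>lborel) = 2 * (\<integral>x. ?I x * (1 - ?I (u n + x)) \<partial>lborel)" for n
  proof -
    have "(\<integral>x. norm (?I (u n + x) - ?I x) \<partial>lborel) = (\<integral>x. ?I (u n + x) - ?I x + 2 * (?I x * (1 - ?I (u n + x))) \<partial>lborel)"
      by (rule Bochner_Integration.integral_cong) (auto split: split_indicator)
    also have "\<dots> = (\<integral>x. ?I (u n + x) \<partial>lborel) - (\<integral>x. ?I x \<partial>lborel) + 2 * (\<integral>x. ?I x * (1 - ?I (u n + x)) \<partial>lborel)"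
      using I It J by simp
    also have "(\<integral>x. ?I (u n + x) \<partial>lborel) = (\<integral>x. ?I x \<partial>lborel)"
      by (rule lborel_translation(2)) measurable
    finally show ?thesis by simp
  qed
  moreover have "(\<lambda>n. \<integral>x. ?I x * (1 - ?I (u n + x)) \<partial>lborel) \<longlonglongrightarrow> (\<integral>x. 0 \<partial>(lborel :: 'a measure))"
  proof (rule integral_dominated_convergence[where w = ?I])
    show "AE x in lborel. (\<lambda>n. ?I x * (1 - ?I (u n + x))) \<longlonglongrightarrow> 0"
    proof (rule AE_I2)
      fix x
      show "(\<lambda>n. ?I x * (1 - ?I (u n + x))) \<longlonglongrightarrow> 0"
      proof (cases "x \<in> U")
        case True
        have "(\<lambda>n. u n + x) \<longlonglongrightarrow> 0 + x" by (intro tendsto_intros u)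
        then have "(\<lambda>n. u n + x) \<longlonglongrightarrow> x" by simp
        then have "\<forall>\<^sub>F n in sequentially. u n + x \<in> U" using topological_tendstoD U True by blast
        then have "\<forall>\<^sub>F n in sequentially. ?I x * (1 - ?I (u n + x)) = 0" by eventually_elim simp
        then show ?thesis by (rule tendsto_eventually)
      qed simp
    qed
  qed (use I in \<open>auto split: split_indicator\<close>)
  ultimately show ?thesis using tendsto_mult_left[of "\<lambda>n. \<integral>x. ?I x * (1 - ?I (u n + x)) \<partial>lborel" 0 sequentially 2] by simp
qed

text \<open>Indicators are reduced to open sets by outer regularity. The result is what makes
  Gaussian averages of an integrable function converge to it.\<close>

lemma L1_translation_continuous:
  fixes f :: "'a::euclidean_space \<Rightarrow> 'b::{banach, second_countable_topology}"
  assumes f: "integrable lborel f" and u: "u \<longlonglongrightarrow> 0"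
  shows "(\<lambda>n. \<integral>x. norm (f (u n + x) - f x) \<partial>lborel) \<longlonglongrightarrow> 0"
  using f
proof (induction rule: integrable_induct)
  case (base A c)
  show ?case
  proof (rule L1_translation_closure)
    show "integrable lborel (\<lambda>x. indicat_real A x *\<^sub>R c)" using base by (intro integrable_scaleR_left integrable_real_indicator) auto
    fix e :: real assume e: "e > 0"
    \<comment> \<open>The summand 1 in the denominator covers the case \<open>c = 0\<close>.\<close>
    define e' where "e' = e / (norm c + 1)"
    have np: "norm c + 1 > 0" by (simp add: add_nonneg_pos)
    have e': "e' > 0" using e np by (simp add: e'_def)
    obtain U where U: "open U" "A \<subseteq> U" "emeasure lborel (U - A) < ennreal e'"
      using outer_regular_lborel[of A e'] base e' by auto
    have meas: "A \<in> sets borel" "U \<in> sets borel" using U base by auto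
    have "emeasure lborel U = emeasure lborel (U - A) + emeasure lborel A"
      using meas U by (subst plus_emeasure) (auto simp: Un_absorb1 intro!: arg_cong[where f = "emeasure lborel"])
    moreover have "emeasure lborel (U - A) < \<infinity>" using U(3) by (rule less_trans) simp
    ultimately have fin: "emeasure lborel U < \<infinity>" using base by (auto simp: ennreal_add_eq_top less_top)
    show "\<exists>g. integrable lborel g \<and> (\<integral>x. norm (indicat_real A x *\<^sub>R c - g x) \<partial>lborel) < e \<and>
      (\<lambda>n. \<integral>x. norm (g (u n + x) - g x) \<partial>lborel) \<longlonglongrightarrow> 0"
    proof (intro exI[of _ "\<lambda>x. indicat_real U x *\<^sub>R c"] conjI)
      show "integrable lborel (\<lambda>x. indicat_real U x *\<^sub>R c)"
        using fin meas by (intro integrable_scaleR_left integrable_real_indicator) auto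
      have "(\<integral>x. norm (indicat_real A x *\<^sub>R c - indicat_real U x *\<^sub>R c) \<partial>lborel) = (\<integral>x. indicator (U - A) x * norm c \<partial>lborel)"
        by (rule Bochner_Integration.integral_cong) (use U(2) in \<open>auto split: split_indicator\<close>)
      also have "\<dots> = measure lborel (U - A) * norm c" by simp
      also have "\<dots> < e"
      proof -
        have "measure lborel (U - A) < e'"
          using U(3) e' by (simp add: measure_def enn2real_less_iff less_top[symmetric])
             (metis U(3) enn2real_less_iff ennreal_less_top less_top order_less_trans)
        then have "measure lborel (U - A) * (norm c + 1) < e" using np by (simp add: e'_def field_simps)
        moreover have "measure lborel (U - A) * norm c \<le> measure lborel (U - A) * (norm c + 1)" by (intro mult_left_mono) auto
        ultimately show ?thesis by linarith
      qed
      finally show "(\<integral>x. norm (indicat_real A x *\<^sub>R c - indicat_real U x *\<^sub>R c) \<partial>lborel) < e" .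
      have "(\<integral>x. norm (indicat_real U (u n + x) *\<^sub>R c - indicat_real U x *\<^sub>R c) \<partial>lborel) =
        (\<integral>x. norm (indicat_real U (u n + x) - indicat_real U x) * norm c \<partial>lborel)" for n
        by (rule Bochner_Integration.integral_cong) (auto simp: scaleR_diff_left[symmetric])
      then have "(\<integral>x. norm (indicat_real U (u n + x) *\<^sub>R c - indicat_real U x *\<^sub>R c) \<partial>lborel) =
        (\<integral>x. norm (indicat_real U (u n + x) - indicat_real U x) \<partial>lborel) * norm c" for n
        by simp
      then show "(\<lambda>n. \<integral>x. norm (indicat_real U (u n + x) *\<^sub>R c - indicat_real U x *\<^sub>R c) \<partial>lborel) \<longlonglongrightarrow> 0"
        using tendsto_mult_right[OF L1_translation_indicator_open[OF U(1) fin u], of "norm c"] by simp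
    qed
  qed
next
  case (add f g)
  have i: "integrable lborel (\<lambda>x. f (u n + x) - f x)" "integrable lborel (\<lambda>x. g (u n + x) - g x)" for n
    using add integrable_translation_diff by auto
  show ?case
  proof (rule tendsto_sandwich[OF _ _ tendsto_const])
    show "\<forall>\<^sub>F n in sequentially. 0 \<le> (\<integral>x. norm (f (u n + x) + g (u n + x) - (f x + g x)) \<partial>lborel)" by simp
    show "\<forall>\<^sub>F n in sequentially. (\<integral>x. norm (f (u n + x) + g (u n + x) - (f x + g x)) \<partial>lborel) \<le>
       (\<integral>x. norm (f (u n + x) - f x) \<partial>lborel) + (\<integral>x. norm (g (u n + x) - g x) \<partial>lborel)"
    proof (rule always_eventually, rule allI)
      fix n
      have "(\<integral>x. norm (f (u n + x) + g (u n + x) - (f x + g x)) \<partial>lborel) = (\<integral>x. norm ((f (u n + x) - f x) + (g (u n + x) - g x)) \<partial>lborel)"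
        by (simp add: algebra_simps)
      also have "\<dots> \<le> (\<integral>x. norm (f (u n + x) - f x) + norm (g (u n + x) - g x) \<partial>lborel)"
        by (rule integral_mono) (use i[of n] in \<open>auto intro: norm_triangle_ineq\<close>)
      also have "\<dots> = (\<integral>x. norm (f (u n + x) - f x) \<partial>lborel) + (\<integral>x. norm (g (u n + x) - g x) \<partial>lborel)"
        using i[of n] by simp
      finally show "(\<integral>x. norm (f (u n + x) + g (u n + x) - (f x + g x)) \<partial>lborel) \<le>
       (\<integral>x. norm (f (u n + x) - f x) \<partial>lborel) + (\<integral>x. norm (g (u n + x) - g x) \<partial>lborel)" .
    qed
    show "(\<lambda>n. (\<integral>x. norm (f (u n + x) - f x) \<partial>lborel) + (\<integral>x. norm (g (u n + x) - g x) \<partial>lborel)) \<longlonglongrightarrow> 0"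
      using tendsto_add[OF add.IH] add by simp
  qed
next
  case (lim f s)
  show ?case
  proof (rule L1_translation_closure[OF lim(4)])
    fix e :: real assume e: "e > 0"
    have [measurable]: "f \<in> borel_measurable borel" "\<And>i. s i \<in> borel_measurable borel" using lim by auto
    have "(\<lambda>i. \<integral>x. norm (f x - s i x) \<partial>lborel) \<longlonglongrightarrow> (\<integral>x. 0 \<partial>(lborel :: 'a measure))"
    proof (rule integral_dominated_convergence[where w = "\<lambda>x. 3 * norm (f x)"])
      show "AE x in lborel. (\<lambda>i. norm (f x - s i x)) \<longlonglongrightarrow> 0"
      proof (rule AE_I2)
        fix x :: 'a
        have "(\<lambda>i. f x - s i x) \<longlonglongrightarrow> f x - f x" using lim(2)[of x] by (intro tendsto_diff tendsto_const) simp
        then have "(\<lambda>i. f x - s i x) \<longlonglongrightarrow> 0" by simp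
        then show "(\<lambda>i. norm (f x - s i x)) \<longlonglongrightarrow> 0" by (rule tendsto_norm_zero)
      qed
      show "AE x in lborel. norm (norm (f x - s i x)) \<le> 3 * norm (f x)" for i
      proof (rule AE_I2)
        fix x
        have "norm (f x - s i x) \<le> norm (f x) + norm (s i x)" by (rule norm_triangle_ineq4)
        moreover have "norm (s i x) \<le> 2 * norm (f x)" using lim(3) by auto
        ultimately show "norm (norm (f x - s i x)) \<le> 3 * norm (f x)" by simp
      qed
      show "integrable lborel (\<lambda>x. 3 * norm (f x))" using lim(4) by auto
    qed auto
    then have "(\<lambda>i. \<integral>x. norm (f x - s i x) \<partial>lborel) \<longlonglongrightarrow> 0" by simp
    then have "\<forall>\<^sub>F i in sequentially. (\<integral>x. norm (f x - s i x) \<partial>lborel) < e" using e by (rule order_tendstoD)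
    then obtain i where "(\<integral>x. norm (f x - s i x) \<partial>lborel) < e" by (auto simp: eventually_sequentially)
    then show "\<exists>g. integrable lborel g \<and> (\<integral>x. norm (f x - g x) \<partial>lborel) < e \<and>
      (\<lambda>n. \<integral>x. norm (g (u n + x) - g x) \<partial>lborel) \<longlonglongrightarrow> 0"
      using lim by (intro exI[of _ "s i"]) simp
  qed
qed

section \<open>Quadratic forms on the Fourier side\<close>

definition fourier :: "('a::euclidean_space \<Rightarrow> complex) \<Rightarrow> 'a \<Rightarrow> complex" where
  "fourier f \<xi> = (\<integral>x. f x * cis (- (2 * pi * (x \<bullet> \<xi>))) \<partial>lborel)"

lemma integrable_mult_cis:
  fixes f :: "'a \<Rightarrow> complex"
  assumes "integrable M f" and [measurable]: "g \<in> borel_measurable M"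
  shows "integrable M (\<lambda>x. f x * cis (g x))"
  by (rule Bochner_Integration.integrable_bound[OF assms(1)]) (use assms in auto)

lemma norm_fourier_le: "norm (fourier f \<xi>) \<le> (L1_norm f)"
  unfolding fourier_def by (rule order.trans[OF integral_norm_bound]) simp

lemma fourier_measurable [measurable]:
  assumes [measurable]: "f \<in> borel_measurable borel"
  shows "fourier f \<in> borel_measurable borel"
  unfolding fourier_def[abs_def] by measurable

lemma continuous_fourier:
  fixes f :: "'a::euclidean_space \<Rightarrow> complex"
  assumes "integrable lborel f"
  shows "continuous_on UNIV (fourier f)"
proof -
  have [measurable]: "f \<in> borel_measurable borel" using assms by auto
  show ?thesis
  proof (rule continuous_at_imp_continuous_on, intro ballI, unfold continuous_at_sequentially, intro allI impI)
    fix \<xi> :: 'a and X :: "nat \<Rightarrow> 'a" assume X: "X \<longlonglongrightarrow> \<xi>"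
    show "(fourier f \<circ> X) \<longlonglongrightarrow> fourier f \<xi>"
      unfolding fourier_def comp_def
    proof (rule integral_dominated_convergence[where w = "\<lambda>x. norm (f x)"])
      show "AE x in lborel. (\<lambda>n. f x * cis (- (2 * pi * (x \<bullet> X n)))) \<longlonglongrightarrow> f x * cis (- (2 * pi * (x \<bullet> \<xi>)))"
        by (intro AE_I2 tendsto_intros tendsto_cis X)
    qed (use assms in auto)
  qed
qed

lemma fourier_sum:
  assumes "\<And>i. i \<in> A \<Longrightarrow> integrable lborel (f i)"
  shows "fourier (\<lambda>x. \<Sum>i\<in>A. f i x) \<xi> = (\<Sum>i\<in>A. fourier (f i) \<xi>)"
  unfolding fourier_def sum_distrib_right
  by (rule Bochner_Integration.integral_sum) (use assms in \<open>auto intro!: integrable_mult_cis\<close>)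

lemma fourier_diff:
  assumes "integrable lborel f" "integrable lborel g"
  shows "fourier (\<lambda>x. f x - g x) \<xi> = fourier f \<xi> - fourier g \<xi>"
  unfolding fourier_def left_diff_distrib
  by (rule Bochner_Integration.integral_diff) (use assms in \<open>auto intro!: integrable_mult_cis\<close>)

text \<open>For functions that are merely integrable this duality stands in for inversion and
  Plancherel: applied with a Gaussian factor in \<open>\<Phi>\<close>, it carries each passage
  between the two sides.\<close>

lemma fourier_multiplication:
  fixes f \<Phi> :: "'a::euclidean_space \<Rightarrow> complex"
  assumes f: "integrable lborel f" and \<Phi>: "integrable lborel \<Phi>"
  shows "(\<integral>\<xi>. fourier f \<xi> * \<Phi> \<xi> \<partial>lborel) = (\<integral>x. f x * fourier \<Phi> x \<partial>lborel)"
proof -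
  have [measurable]: "f \<in> borel_measurable borel" "\<Phi> \<in> borel_measurable borel" using f \<Phi> by auto
  let ?h = "\<lambda>\<xi> x. f x * cis (- (2 * pi * (x \<bullet> \<xi>))) * \<Phi> \<xi>"
  have int: "integrable (lborel \<Otimes>\<^sub>M lborel) (\<lambda>(\<xi>, x). ?h \<xi> x)"
  proof (rule lborel_pair.Fubini_integrable)
    show "(\<lambda>(\<xi>, x). ?h \<xi> x) \<in> borel_measurable (lborel \<Otimes>\<^sub>M lborel)" by measurable
    show "integrable lborel (\<lambda>\<xi>. \<integral>x. norm (case (\<xi>, x) of (\<xi>, x) \<Rightarrow> ?h \<xi> x) \<partial>lborel)"
      using \<Phi> by (simp add: norm_mult)
    show "AE \<xi> in lborel. integrable lborel (\<lambda>x. case (\<xi>, x) of (\<xi>, x) \<Rightarrow> ?h \<xi> x)"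
      unfolding split_conv by (intro AE_I2 integrable_mult_left integrable_mult_cis f) measurable
  qed
  have "(\<integral>\<xi>. fourier f \<xi> * \<Phi> \<xi> \<partial>lborel) = (\<integral>\<xi>. (\<integral>x. ?h \<xi> x \<partial>lborel) \<partial>lborel)"
    unfolding fourier_def by simp
  also have "\<dots> = (\<integral>x. (\<integral>\<xi>. ?h \<xi> x \<partial>lborel) \<partial>lborel)"
    using lborel_pair.Fubini_integral[OF int] by simp
  also have "\<dots> = (\<integral>x. f x * fourier \<Phi> x \<partial>lborel)"
    unfolding fourier_def integral_mult_right_zero[symmetric]
    by (intro Bochner_Integration.integral_cong) (auto simp: inner_commute)
  finally show ?thesis .
qed

text \<open>Sesquilinear so that \<open>f\<close> can be cut into level sets; on the diagonal with
  \<open>b = l / 4\<close> it is the integral I_l of the overview. The bracketing isolates the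
  integrable factor to which the multiplication formula is applied.\<close>

definition bform :: "real \<Rightarrow> real \<Rightarrow> ('a::euclidean_space \<Rightarrow> complex) \<Rightarrow> ('a \<Rightarrow> complex) \<Rightarrow> complex" where
  "bform a b f g = (\<integral>\<xi>. fourier f \<xi> * (cnj (fourier g \<xi>) * gauss a b \<xi>) \<partial>lborel)"

lemma integrable_bounded_gauss:
  fixes h :: "'a::euclidean_space \<Rightarrow> complex"
  assumes a: "a > 0" and [measurable]: "h \<in> borel_measurable borel" and B: "\<And>x. norm (h x) \<le> B"
  shows "integrable lborel (\<lambda>x. h x * gauss a b x)"
proof (rule Bochner_Integration.integrable_bound)
  show "integrable lborel (\<lambda>x. of_real B * gauss a b x)" using integrable_gauss[OF a] by auto
  have "B \<ge> 0" using B[of 0] norm_ge_zero[of "h 0"] by linarith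
  then show "AE x in lborel. norm (h x * gauss a b x) \<le> norm (of_real B * gauss a b x)"
    using B by (auto simp: norm_mult intro!: mult_right_mono)
qed measurable

lemma integrable_fourier_gauss:
  assumes "a > 0" and g: "integrable lborel g"
  shows "integrable lborel (\<lambda>\<xi>. cnj (fourier g \<xi>) * gauss a b \<xi>)"
proof -
  have [measurable]: "g \<in> borel_measurable borel" using g by auto
  show ?thesis
    by (rule integrable_bounded_gauss[OF assms(1), where B = "L1_norm g"])
      (auto simp: norm_fourier_le)
qed

lemma integrable_bform:
  assumes "a > 0" and f: "integrable lborel f" and g: "integrable lborel g"
  shows "integrable lborel (\<lambda>\<xi>. fourier f \<xi> * (cnj (fourier g \<xi>) * gauss a b \<xi>))"
proof -
  have [measurable]: "g \<in> borel_measurable borel" "f \<in> borel_measurable borel" using f g by auto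
  have "integrable lborel (\<lambda>\<xi>. (fourier f \<xi> * cnj (fourier g \<xi>)) * gauss a b \<xi>)"
    by (rule integrable_bounded_gauss[OF assms(1), where B = "(L1_norm f) * (L1_norm g)"])
      (auto simp: norm_mult norm_fourier_le intro!: mult_mono)
  then show ?thesis by (simp add: mult.assoc)
qed

text \<open>The conjugate of \<open>gauss a b\<close> is \<open>gauss a (- b)\<close>. Moving the
  transform off \<open>g\<close> by the multiplication formula leaves a convolution of
  \<open>g\<close> with the kernel, whence the sign of \<open>b\<close>.\<close>

lemma fourier_bform_kernel:
  assumes a: "a > 0" and g: "integrable lborel g"
  shows "fourier (\<lambda>\<xi>. cnj (fourier g \<xi>) * gauss a b \<xi>) x = cnj (\<integral>y. g y * gauss_kernel a (- b) (x - y) \<partial>lborel)"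
proof -
  define \<Psi> where "\<Psi> = (\<lambda>\<xi>. gauss a (- b) \<xi> * cis (2 * pi * (\<xi> \<bullet> x)))"
  have \<Psi>: "integrable lborel \<Psi>" unfolding \<Psi>_def by (rule integrable_gauss_cis[OF a])
  have "fourier (\<lambda>\<xi>. cnj (fourier g \<xi>) * gauss a b \<xi>) x = (\<integral>\<xi>. cnj (fourier g \<xi> * \<Psi> \<xi>) \<partial>lborel)"
    unfolding fourier_def[of "\<lambda>\<xi>. cnj (fourier g \<xi>) * gauss a b \<xi>"]
    by (rule Bochner_Integration.integral_cong) (auto simp: \<Psi>_def gauss_def cis_cnj mult_ac)
  also have "\<dots> = cnj (\<integral>\<xi>. fourier g \<xi> * \<Psi> \<xi> \<partial>lborel)" by (rule Bochner_Integration.integral_cnj)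
  also have "(\<integral>\<xi>. fourier g \<xi> * \<Psi> \<xi> \<partial>lborel) = (\<integral>y. g y * fourier \<Psi> y \<partial>lborel)"
    by (rule fourier_multiplication[OF g \<Psi>])
  also have "\<dots> = (\<integral>y. g y * gauss_kernel a (- b) (x - y) \<partial>lborel)"
  proof (rule Bochner_Integration.integral_cong)
    fix y
    have "fourier \<Psi> y = gauss_kernel a (- b) (x - y)"
      unfolding fourier_def gauss_kernel_def
      by (rule Bochner_Integration.integral_cong)
        (auto simp: \<Psi>_def mult.assoc cis_mult inner_diff_right algebra_simps)
    then show "g y * fourier \<Psi> y = g y * gauss_kernel a (- b) (x - y)" by simp
  qed simp
  finally show ?thesis .
qed

lemma bform_kernel:
  assumes "a > 0" "integrable lborel f" "integrable lborel g"
  shows "bform a b f g = (\<integral>x. f x * cnj (\<integral>y. g y * gauss_kernel a (- b) (x - y) \<partial>lborel) \<partial>lborel)"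
  unfolding bform_def
  by (subst fourier_multiplication) (use assms integrable_fourier_gauss in \<open>auto simp: fourier_bform_kernel\<close>)

lemma gauss_kernel_measurable [measurable]: "gauss_kernel a b \<in> borel_measurable borel"
  unfolding gauss_kernel_def[abs_def] by measurable

text \<open>The L1 endpoint of the interpolation: the kernel is bounded uniformly in space, and its
  decay in \<open>b\<close> becomes the decay in l.\<close>

lemma bform_L1_bound:
  fixes f g :: "'a::euclidean_space \<Rightarrow> complex"
  assumes a: "a > 0" and f: "integrable lborel f" and g: "integrable lborel g"
  shows "norm (bform a b f g) \<le> (a\<^sup>2 + b\<^sup>2) powr (- real DIM('a) / 4) * (L1_norm f) * (L1_norm g)"
proof -
  have [measurable]: "f \<in> borel_measurable borel" "g \<in> borel_measurable borel" using f g by auto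
  let ?c = "(a\<^sup>2 + b\<^sup>2) powr (- real DIM('a) / 4)"
  have inner: "norm (\<integral>y. g y * gauss_kernel a (- b) (x - y) \<partial>lborel) \<le> ?c * (L1_norm g)" for x
  proof -
    have k: "norm (gauss_kernel a (- b) (x - y)) \<le> ?c" for y using gauss_kernel_bound[OF a, of "- b" "x - y"] by simp
    have k': "norm (g y * gauss_kernel a (- b) (x - y)) \<le> ?c * norm (g y)" for y
      using mult_left_mono[OF k[of y] norm_ge_zero[of "g y"]] by (simp add: norm_mult mult.commute)
    have i: "integrable lborel (\<lambda>y. norm (g y * gauss_kernel a (- b) (x - y)))"
    proof (rule Bochner_Integration.integrable_bound)
      show "integrable lborel (\<lambda>y. ?c * norm (g y))" using g by auto
      show "AE y in lborel. norm (norm (g y * gauss_kernel a (- b) (x - y))) \<le> norm (?c * norm (g y))"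
        using k' by (auto intro: order.trans)
    qed measurable
    have "norm (\<integral>y. g y * gauss_kernel a (- b) (x - y) \<partial>lborel) \<le> (\<integral>y. norm (g y * gauss_kernel a (- b) (x - y)) \<partial>lborel)"
      by (rule integral_norm_bound)
    also have "\<dots> \<le> (\<integral>y. ?c * norm (g y) \<partial>lborel)"
      by (rule integral_mono[OF i]) (use g k' in auto)
    finally show ?thesis by simp
  qed
  let ?G = "L1_norm g"
  have outer: "norm (f x * cnj (\<integral>y. g y * gauss_kernel a (- b) (x - y) \<partial>lborel)) \<le> (?c * ?G) * norm (f x)" for x
    using mult_left_mono[OF inner[of x] norm_ge_zero[of "f x"]] by (simp add: norm_mult mult_ac)
  have i: "integrable lborel (\<lambda>x. norm (f x * cnj (\<integral>y. g y * gauss_kernel a (- b) (x - y) \<partial>lborel)))"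
  proof (rule Bochner_Integration.integrable_bound)
    show "integrable lborel (\<lambda>x. (?c * ?G) * norm (f x))" using f by auto
    show "AE x in lborel. norm (norm (f x * cnj (\<integral>y. g y * gauss_kernel a (- b) (x - y) \<partial>lborel))) \<le> norm ((?c * ?G) * norm (f x))"
      using outer by (auto intro: order.trans)
  qed measurable
  have "norm (bform a b f g) \<le> (\<integral>x. norm (f x * cnj (\<integral>y. g y * gauss_kernel a (- b) (x - y) \<partial>lborel)) \<partial>lborel)"
    unfolding bform_kernel[OF assms] by (rule integral_norm_bound)
  also have "\<dots> \<le> (\<integral>x. (?c * ?G) * norm (f x) \<partial>lborel)"
    by (rule integral_mono[OF i]) (use f outer in auto)
  finally show ?thesis by (simp add: mult_ac)
qed

section \<open>The heat kernel and the L2 endpoint\<close>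

lemma gauss_kernel_0:
  fixes y :: "'a::euclidean_space"
  assumes "a > 0"
  shows "gauss_kernel a 0 y = of_real (a powr (- real DIM('a) / 2) * exp (- pi * (norm y)\<^sup>2 / a))"
  unfolding gauss_kernel_def by (subst gauss_ft(2)[OF assms]) simp

text \<open>\<open>gauss_kernel a 0\<close> as a real function: a Gaussian probability density of
  width sqrt a, hence an approximate identity as \<open>a\<close> tends to 0.\<close>

definition gauss_mass :: "real \<Rightarrow> 'a::euclidean_space \<Rightarrow> real" where
  "gauss_mass a y = a powr (- real DIM('a) / 2) * exp (- pi * (norm y)\<^sup>2 / a)"

lemma gauss_mass_nonneg [simp]: "gauss_mass a y \<ge> 0"
  by (simp add: gauss_mass_def)

lemma gauss_mass_measurable [measurable]: "gauss_mass a \<in> borel_measurable borel"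
  unfolding gauss_mass_def[abs_def] by measurable

lemma gauss_mass_integral:
  assumes a: "a > 0"
  shows "integrable lborel (gauss_mass a :: 'a::euclidean_space \<Rightarrow> real)" "integral\<^sup>L lborel (gauss_mass a :: 'a \<Rightarrow> real) = 1"
proof -
  have *: "gauss_mass a y = a powr (- real DIM('a) / 2) * exp (- pi * (1 / a) * (norm y)\<^sup>2)" for y :: 'a
    by (simp add: gauss_mass_def)
  have a1: "1 / a > 0" using a by simp
  show "integrable lborel (gauss_mass a :: 'a \<Rightarrow> real)"
    unfolding *[abs_def] using integrable_exp_norm(1)[OF a1] by auto
  show "integral\<^sup>L lborel (gauss_mass a :: 'a \<Rightarrow> real) = 1"
    unfolding *[abs_def] integral_mult_right_zero integrable_exp_norm(2)[OF a1]
    using a by (simp add: powr_divide powr_minus_divide)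
qed

lemma bform_real:
  assumes "a > 0" "integrable lborel f"
  shows "bform a 0 f f = of_real (\<integral>\<xi>. (norm (fourier f \<xi>))\<^sup>2 * exp (- pi * a * (norm \<xi>)\<^sup>2) \<partial>lborel)"
    and "integrable lborel (\<lambda>\<xi>. (norm (fourier f \<xi>))\<^sup>2 * exp (- pi * a * (norm \<xi>)\<^sup>2))"
proof -
  have *: "fourier f \<xi> * (cnj (fourier f \<xi>) * gauss a 0 \<xi>) = of_real ((norm (fourier f \<xi>))\<^sup>2 * exp (- pi * a * (norm \<xi>)\<^sup>2))" for \<xi>
    by (simp add: gauss_def complex_norm_square mult.assoc[symmetric] of_real_power[symmetric] del: of_real_power)
  show "bform a 0 f f = of_real (\<integral>\<xi>. (norm (fourier f \<xi>))\<^sup>2 * exp (- pi * a * (norm \<xi>)\<^sup>2) \<partial>lborel)"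
    unfolding bform_def * by (rule integral_complex_of_real)
  show "integrable lborel (\<lambda>\<xi>. (norm (fourier f \<xi>))\<^sup>2 * exp (- pi * a * (norm \<xi>)\<^sup>2))"
    using integrable_bform[OF assms(1,2,2), of 0] unfolding * complex_of_real_integrable_eq .
qed

lemma nn_integral_translation:
  fixes f :: "'a::euclidean_space \<Rightarrow> ennreal"
  assumes "f \<in> borel_measurable borel"
  shows "(\<integral>\<^sup>+x. f (c + x) \<partial>lborel) = (\<integral>\<^sup>+x. f x \<partial>lborel)"
proof -
  have *: "distr lborel borel ((+) c) = (lborel :: 'a measure)" by (rule lborel_distr_plus)
  show ?thesis
    by (subst (2) *[symmetric], subst nn_integral_distr) (use assms in auto)
qed

lemma norm_integral_le_nn_integral:
  fixes f :: "'a \<Rightarrow> 'b::{banach, second_countable_topology}"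
  shows "ennreal (norm (integral\<^sup>L M f)) \<le> (\<integral>\<^sup>+x. norm (f x) \<partial>M)"
  by (cases "integrable M f") (auto simp: integral_norm_bound_ennreal not_integrable_integral_eq)

lemma nn_integral_gauss_mass:
  fixes x :: "'a::euclidean_space"
  assumes a: "a > 0"
  shows "(\<integral>\<^sup>+y. ennreal (gauss_mass a (x - y)) \<partial>lborel) = 1"
proof -
  have "(\<integral>\<^sup>+y. ennreal (gauss_mass a (x - y)) \<partial>lborel) = (\<integral>\<^sup>+y. ennreal (gauss_mass a (- x + y)) \<partial>lborel)"
    by (simp add: gauss_mass_def norm_minus_commute)
  also have "\<dots> = (\<integral>\<^sup>+y. ennreal (gauss_mass a (y :: 'a)) \<partial>lborel)"
    by (rule nn_integral_translation) measurable
  also have "\<dots> = 1"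
    by (subst nn_integral_eq_integral) (use gauss_mass_integral[OF a] in auto)
  finally show ?thesis .
qed

text \<open>The real number \<open>bform a 0 f f\<close>. As \<open>a\<close> decreases to 0 it
  increases to the possibly infinite square of the L2 norm of the transform.\<close>

definition energy :: "real \<Rightarrow> ('a::euclidean_space \<Rightarrow> complex) \<Rightarrow> real" where
  "energy a f = (\<integral>\<xi>. (norm (fourier f \<xi>))\<^sup>2 * exp (- pi * a * (norm \<xi>)\<^sup>2) \<partial>lborel)"

lemma energy_nonneg [simp]: "energy a f \<ge> 0"
  unfolding energy_def by (rule Bochner_Integration.integral_nonneg) simp

text \<open>One half of Plancherel, by Schur's test: on the space side the form has a kernel of mass
  1 in each variable, and |f(x) f(y)| <= (|f(x)|^2 + |f(y)|^2) / 2. Extended nonnegative integrals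
  make the exchange of order free.\<close>

lemma energy_le_L2:
  fixes f :: "'a::euclidean_space \<Rightarrow> complex"
  assumes a: "a > 0" and f: "integrable lborel f" and f2: "integrable lborel (\<lambda>x. (norm (f x))\<^sup>2)"
  shows "energy a f \<le> (\<integral>x. (norm (f x))\<^sup>2 \<partial>lborel)"
proof -
  have [measurable]: "f \<in> borel_measurable borel" using f by auto
  let ?n = "\<lambda>x. ennreal ((norm (f x))\<^sup>2)"
  let ?m = "\<lambda>x. ennreal ((norm (f x))\<^sup>2 / 2)"
  have "ennreal (energy a f) = ennreal (norm (bform a 0 f f))"
    unfolding bform_real(1)[OF a f] energy_def[symmetric] by simp
  also have "\<dots> \<le> (\<integral>\<^sup>+x. norm (f x * cnj (\<integral>y. f y * gauss_kernel a 0 (x - y) \<partial>lborel)) \<partial>lborel)"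
    unfolding bform_kernel[OF a f f] minus_zero by (rule norm_integral_le_nn_integral)
  also have "\<dots> = (\<integral>\<^sup>+x. ennreal (norm (f x)) * ennreal (norm (\<integral>y. f y * gauss_kernel a 0 (x - y) \<partial>lborel)) \<partial>lborel)"
    by (simp add: norm_mult ennreal_mult)
  also have "\<dots> \<le> (\<integral>\<^sup>+x. ennreal (norm (f x)) * (\<integral>\<^sup>+y. norm (f y * gauss_kernel a 0 (x - y)) \<partial>lborel) \<partial>lborel)"
    by (intro nn_integral_mono mult_left_mono norm_integral_le_nn_integral) auto
  also have "\<dots> = (\<integral>\<^sup>+x. (\<integral>\<^sup>+y. ennreal (norm (f x)) * ennreal (norm (f y) * gauss_mass a (x - y)) \<partial>lborel) \<partial>lborel)"
    by (simp add: nn_integral_cmult gauss_kernel_0[OF a] gauss_mass_def norm_mult)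
  also have "\<dots> \<le> (\<integral>\<^sup>+x. (\<integral>\<^sup>+y. ?m x * gauss_mass a (x - y) + ?m y * gauss_mass a (x - y) \<partial>lborel) \<partial>lborel)"
  proof (intro nn_integral_mono)
    fix x y
    have "norm (f x) * norm (f y) \<le> (norm (f x))\<^sup>2 / 2 + (norm (f y))\<^sup>2 / 2"
      using sum_squares_bound[of "norm (f x)" "norm (f y)"] by simp
    then have "norm (f x) * (norm (f y) * gauss_mass a (x - y)) \<le> ((norm (f x))\<^sup>2 / 2 + (norm (f y))\<^sup>2 / 2) * gauss_mass a (x - y)"
      unfolding mult.assoc[symmetric] by (rule mult_right_mono) simp
    then have *: "ennreal (norm (f x) * (norm (f y) * gauss_mass a (x - y))) \<le> ennreal ((norm (f x))\<^sup>2 / 2 * gauss_mass a (x - y) + (norm (f y))\<^sup>2 / 2 * gauss_mass a (x - y))"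
      by (intro ennreal_leI) (simp add: distrib_right)
    have "ennreal (norm (f x)) * ennreal (norm (f y) * gauss_mass a (x - y)) = ennreal (norm (f x) * (norm (f y) * gauss_mass a (x - y)))"
      by (rule ennreal_mult[symmetric]) auto
    also note *
    also have "ennreal ((norm (f x))\<^sup>2 / 2 * gauss_mass a (x - y) + (norm (f y))\<^sup>2 / 2 * gauss_mass a (x - y)) = ?m x * gauss_mass a (x - y) + ?m y * gauss_mass a (x - y)"
      by (subst ennreal_plus) (auto simp: ennreal_mult[symmetric])
    finally show "ennreal (norm (f x)) * ennreal (norm (f y) * gauss_mass a (x - y)) \<le> ?m x * gauss_mass a (x - y) + ?m y * gauss_mass a (x - y)" .
  qed
  also have "\<dots> = (\<integral>\<^sup>+x. (\<integral>\<^sup>+y. ?m x * gauss_mass a (x - y) \<partial>lborel) \<partial>lborel) + (\<integral>\<^sup>+x. (\<integral>\<^sup>+y. ?m y * gauss_mass a (x - y) \<partial>lborel) \<partial>lborel)"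
    by (simp add: nn_integral_add)
  also have "(\<integral>\<^sup>+x. (\<integral>\<^sup>+y. ?m y * gauss_mass a (x - y) \<partial>lborel) \<partial>lborel) = (\<integral>\<^sup>+y. (\<integral>\<^sup>+x. ?m y * gauss_mass a (x - y) \<partial>lborel) \<partial>lborel)"
    by (rule lborel_pair.Fubini') measurable
  also have "\<dots> = (\<integral>\<^sup>+y. (\<integral>\<^sup>+x. ?m y * gauss_mass a (y - x) \<partial>lborel) \<partial>lborel)"
    by (simp add: gauss_mass_def norm_minus_commute)
  also have "(\<integral>\<^sup>+x. (\<integral>\<^sup>+y. ?m x * gauss_mass a (x - y) \<partial>lborel) \<partial>lborel) = (\<integral>\<^sup>+x. ?m x \<partial>lborel)"
    by (simp add: nn_integral_cmult nn_integral_gauss_mass[OF a])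
  also have "(\<integral>\<^sup>+x. ?m x \<partial>lborel) + (\<integral>\<^sup>+x. ?m x \<partial>lborel) = (\<integral>\<^sup>+x. ?m x + ?m x \<partial>lborel)"
    by (subst nn_integral_add) auto
  also have "\<dots> = (\<integral>\<^sup>+x. ?n x \<partial>lborel)"
    by (intro nn_integral_cong) (simp flip: ennreal_plus)
  also have "\<dots> = ennreal (\<integral>x. (norm (f x))\<^sup>2 \<partial>lborel)"
    by (rule nn_integral_eq_integral[OF f2]) simp
  finally show ?thesis by (subst (asm) ennreal_le_iff) (auto intro: Bochner_Integration.integral_nonneg)
qed

text \<open>The phase of \<open>gauss a b\<close> has modulus 1, so the bound is uniform in
  \<open>b\<close>; with \<open>energy_le_L2\<close> this is the L2 endpoint. The damping is shared
  evenly between the two factors.\<close>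

lemma bform_Cauchy_Schwarz:
  fixes f g :: "'a::euclidean_space \<Rightarrow> complex"
  assumes a: "a > 0" and f: "integrable lborel f" and g: "integrable lborel g"
  shows "(norm (bform a b f g))\<^sup>2 \<le> energy a f * energy a g"
proof -
  have [measurable]: "f \<in> borel_measurable borel" "g \<in> borel_measurable borel" using f g by auto
  let ?w = "\<lambda>\<xi>::'a. exp (- pi * a * (norm \<xi>)\<^sup>2 / 2)"
  have w2: "?w \<xi> * ?w \<xi> = exp (- pi * a * (norm \<xi>)\<^sup>2)" for \<xi>
    by (simp add: exp_add[symmetric])
  have en: "(\<integral>\<^sup>+\<xi>. (ennreal (norm (fourier h \<xi>) * ?w \<xi>))\<^sup>2 \<partial>lborel) = ennreal (energy a h)"
    if h: "integrable lborel h" for h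
  proof -
    have "(\<integral>\<^sup>+\<xi>. (ennreal (norm (fourier h \<xi>) * ?w \<xi>))\<^sup>2 \<partial>lborel) = (\<integral>\<^sup>+\<xi>. ennreal ((norm (fourier h \<xi>))\<^sup>2 * exp (- pi * a * (norm \<xi>)\<^sup>2)) \<partial>lborel)"
    proof (rule nn_integral_cong)
      fix \<xi> :: 'a
      have "(ennreal (norm (fourier h \<xi>) * ?w \<xi>))\<^sup>2 = ennreal ((norm (fourier h \<xi>) * ?w \<xi>)\<^sup>2)" by (rule ennreal_power) simp
      also have "(norm (fourier h \<xi>) * ?w \<xi>)\<^sup>2 = (norm (fourier h \<xi>))\<^sup>2 * exp (- pi * a * (norm \<xi>)\<^sup>2)"
        unfolding power_mult_distrib w2[symmetric] by (simp only: power2_eq_square)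
      finally show "(ennreal (norm (fourier h \<xi>) * ?w \<xi>))\<^sup>2 = ennreal ((norm (fourier h \<xi>))\<^sup>2 * exp (- pi * a * (norm \<xi>)\<^sup>2))" .
    qed
    also have "\<dots> = ennreal (energy a h)"
      unfolding energy_def by (rule nn_integral_eq_integral[OF bform_real(2)[OF a h]]) simp
    finally show ?thesis .
  qed
  have "ennreal ((norm (bform a b f g))\<^sup>2) = (ennreal (norm (bform a b f g)))\<^sup>2" by (simp add: ennreal_power)
  also have "\<dots> \<le> (\<integral>\<^sup>+\<xi>. norm (fourier f \<xi> * (cnj (fourier g \<xi>) * gauss a b \<xi>)) \<partial>lborel)\<^sup>2"
    unfolding bform_def by (intro power_mono norm_integral_le_nn_integral) simp
  also have "(\<integral>\<^sup>+\<xi>. norm (fourier f \<xi> * (cnj (fourier g \<xi>) * gauss a b \<xi>)) \<partial>lborel) =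
     (\<integral>\<^sup>+\<xi>. ennreal (norm (fourier f \<xi>) * ?w \<xi>) * ennreal (norm (fourier g \<xi>) * ?w \<xi>) \<partial>lborel)"
  proof (rule nn_integral_cong)
    fix \<xi> :: 'a
    have "norm (fourier f \<xi> * (cnj (fourier g \<xi>) * gauss a b \<xi>)) = (norm (fourier f \<xi>) * ?w \<xi>) * (norm (fourier g \<xi>) * ?w \<xi>)"
      unfolding norm_mult norm_gauss w2[symmetric] by (simp add: mult_ac)
    then show "ennreal (norm (fourier f \<xi> * (cnj (fourier g \<xi>) * gauss a b \<xi>))) = ennreal (norm (fourier f \<xi>) * ?w \<xi>) * ennreal (norm (fourier g \<xi>) * ?w \<xi>)"
      by (simp add: ennreal_mult)
  qed
  also have "\<dots>\<^sup>2 \<le> (\<integral>\<^sup>+\<xi>. (ennreal (norm (fourier f \<xi>) * ?w \<xi>))\<^sup>2 \<partial>lborel) * (\<integral>\<^sup>+\<xi>. (ennreal (norm (fourier g \<xi>) * ?w \<xi>))\<^sup>2 \<partial>lborel)"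
    by (rule Cauchy_Schwarz_nn_integral) measurable
  also have "\<dots> = ennreal (energy a f * energy a g)"
    unfolding en[OF f] en[OF g] by (simp add: ennreal_mult)
  finally show ?thesis by (subst (asm) ennreal_le_iff) auto
qed

section \<open>Recovering the L2 norm from damped energies\<close>

lemma nn_integral_gauss_mass_scale:
  fixes h :: "'a::euclidean_space \<Rightarrow> ennreal"
  assumes a: "a > 0" and [measurable]: "h \<in> borel_measurable borel"
  shows "(\<integral>\<^sup>+u. gauss_mass a u * h u \<partial>lborel) = (\<integral>\<^sup>+v. gauss_mass 1 v * h (sqrt a *\<^sub>R v) \<partial>lborel)"
proof -
  have s: "sqrt a \<noteq> 0" using a by simp
  have "(\<integral>\<^sup>+u. gauss_mass a u * h u \<partial>lborel) =
    (\<integral>\<^sup>+v. ennreal (\<bar>sqrt a\<bar> ^ DIM('a)) * (gauss_mass a (sqrt a *\<^sub>R v) * h (sqrt a *\<^sub>R v)) \<partial>lborel)"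
    by (subst lborel_affine[OF s, of 0]) (simp add: nn_integral_density nn_integral_distr)
  also have "\<dots> = (\<integral>\<^sup>+v. gauss_mass 1 v * h (sqrt a *\<^sub>R v) \<partial>lborel)"
  proof (rule nn_integral_cong)
    fix v :: 'a
    have "sqrt a ^ DIM('a) = a powr (real DIM('a) / 2)"
      using a by (simp add: powr_half_sqrt[symmetric] powr_powr powr_realpow[symmetric])
    then have "sqrt a ^ DIM('a) * gauss_mass a (sqrt a *\<^sub>R v) = gauss_mass 1 v"
      using a by (simp add: gauss_mass_def power_mult_distrib mult.assoc[symmetric] powr_add[symmetric])
    then have "ennreal (\<bar>sqrt a\<bar> ^ DIM('a)) * ennreal (gauss_mass a (sqrt a *\<^sub>R v)) = ennreal (gauss_mass 1 v)"
      using a by (simp add: ennreal_mult[symmetric])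
    then show "ennreal (\<bar>sqrt a\<bar> ^ DIM('a)) * (gauss_mass a (sqrt a *\<^sub>R v) * h (sqrt a *\<^sub>R v)) = gauss_mass 1 v * h (sqrt a *\<^sub>R v)"
      by (simp add: mult.assoc[symmetric])
  qed
  finally show ?thesis .
qed

text \<open>The form pairs \<open>g\<close> with \<open>f\<close> smoothed by the heat kernel. As
  \<open>g\<close> is bounded, the error is controlled by the L1 distance between \<open>f\<close>
  and its smoothing, that is, by averages of the translation modulus of \<open>f\<close>.\<close>

lemma bform_tendsto_inner:
  fixes f g :: "'a::euclidean_space \<Rightarrow> complex"
  assumes f: "integrable lborel f" and g: "integrable lborel g" and T: "\<And>x. norm (g x) \<le> T"
    and a: "\<And>n. a n > 0" "a \<longlonglongrightarrow> 0"
  shows "(\<lambda>n. bform (a n) 0 g f) \<longlonglongrightarrow> (\<integral>x. g x * cnj (f x) \<partial>lborel)"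
    (is "_ \<longlonglongrightarrow> ?gf")
proof -
  have [measurable]: "f \<in> borel_measurable borel" "g \<in> borel_measurable borel" using f g by auto
  have T0: "T \<ge> 0" using T[of 0] norm_ge_zero[of "g 0"] by linarith
  \<comment> \<open>The L1 modulus of continuity of \<open>f\<close>.\<close>
  define W where "W u = (\<integral>\<^sup>+x. norm (f (u + x) - f x) \<partial>lborel)" for u
  have [measurable]: "W \<in> borel_measurable borel" unfolding W_def[abs_def] by measurable
  have gf: "integrable lborel (\<lambda>x. g x * cnj (f x))"
  proof (rule Bochner_Integration.integrable_bound)
    show "integrable lborel (\<lambda>x. T * norm (f x))" using f by auto
    show "AE x in lborel. norm (g x * cnj (f x)) \<le> norm (T * norm (f x))"
      using T T0 by (auto simp: norm_mult abs_mult intro!: mult_right_mono)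
  qed measurable
  have bnd: "ennreal (norm (bform (a n) 0 g f - ?gf)) \<le> ennreal T * (\<integral>\<^sup>+v. gauss_mass 1 v * W (sqrt (a n) *\<^sub>R v) \<partial>lborel)" for n
  proof -
    note a0 = a(1)[of n]
    let ?k = "gauss_mass (a n) :: 'a \<Rightarrow> real"
    let ?V = "\<lambda>x. \<integral>\<^sup>+y. norm (f y - f x) * ?k (x - y) \<partial>lborel"
    let ?c = "\<lambda>x. \<integral>y. f y * of_real (?k (x - y)) \<partial>lborel" and ?D = "\<lambda>x. \<integral>y. (f y - f x) * of_real (?k (x - y)) \<partial>lborel"
    have kint: "integrable lborel (\<lambda>y. ?k (x - y))" and kval: "(\<integral>y. ?k (x - y) \<partial>lborel) = 1" for x
    proof -
      have "?k (x - y) = ?k (- x + y)" for y by (simp add: gauss_mass_def norm_minus_commute)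
      then show "integrable lborel (\<lambda>y. ?k (x - y))" "(\<integral>y. ?k (x - y) \<partial>lborel) = 1"
        using lborel_translation[of ?k "- x"] gauss_mass_integral[OF a0, where 'a = 'a] by simp_all
    qed
    have kb: "norm (f y * of_real (?k (x - y))) \<le> (a n) powr (- real DIM('a) / 2) * norm (f y)" for x y
    proof -
      have "?k (x - y) \<le> (a n) powr (- real DIM('a) / 2)"
        using a0 by (auto simp: gauss_mass_def intro!: mult_left_le)
      from mult_left_mono[OF this norm_ge_zero[of "f y"]] show ?thesis by (simp add: norm_mult mult.commute)
    qed
    have fint: "integrable lborel (\<lambda>y. f y * of_real (?k (x - y)))" for x
    proof (rule Bochner_Integration.integrable_bound)
      show "integrable lborel (\<lambda>y. (a n) powr (- real DIM('a) / 2) * norm (f y))" using f by auto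
      show "AE y in lborel. norm (f y * of_real (?k (x - y))) \<le> norm ((a n) powr (- real DIM('a) / 2) * norm (f y))"
        using kb by (auto intro: order.trans)
    qed measurable
    have 1: "bform (a n) 0 g f = (\<integral>x. g x * cnj (?c x) \<partial>lborel)"
      by (subst bform_kernel[OF a0 g f]) (simp add: gauss_kernel_0[OF a0] gauss_mass_def)
    have bi: "integrable lborel (\<lambda>x. g x * cnj (?c x))"
    proof (rule Bochner_Integration.integrable_bound)
      let ?B = "(a n) powr (- real DIM('a) / 2) * (L1_norm f)"
      show "integrable lborel (\<lambda>x. ?B * norm (g x))" using g by auto
      have "norm (?c x) \<le> ?B" for x
      proof -
        have "norm (?c x) \<le> (\<integral>y. norm (f y * of_real (?k (x - y))) \<partial>lborel)"
          by (rule integral_norm_bound)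
        also have "\<dots> \<le> (\<integral>y. (a n) powr (- real DIM('a) / 2) * norm (f y) \<partial>lborel)"
          by (rule integral_mono) (use integrable_norm[OF fint[of x]] f kb in auto)
        finally show ?thesis by simp
      qed
      from mult_left_mono[OF this norm_ge_zero]
      have "norm (g x * cnj (?c x)) \<le> ?B * norm (g x)" for x
        by (simp add: norm_mult mult_ac)
      then show "AE x in lborel. norm (g x * cnj (?c x)) \<le> norm (?B * norm (g x))"
        by (auto intro: order.trans)
    qed measurable
    have "bform (a n) 0 g f - ?gf = (\<integral>x. g x * cnj (?c x) - g x * cnj (f x) \<partial>lborel)"
      unfolding 1 by (rule Bochner_Integration.integral_diff[symmetric, OF bi gf])
    also have "\<dots> = (\<integral>x. g x * cnj (?D x) \<partial>lborel)"
    proof (rule Bochner_Integration.integral_cong)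
      fix x
      have "(?D x) = (?c x) - (\<integral>y. f x * of_real (?k (x - y)) \<partial>lborel)"
        unfolding left_diff_distrib by (rule Bochner_Integration.integral_diff) (use fint kint in auto)
      also have "(\<integral>y. f x * of_real (?k (x - y)) \<partial>lborel) = f x" using kval by simp
      finally show "g x * cnj (?c x) - g x * cnj (f x) = g x * cnj (?D x)"
        by (simp only: complex_cnj_diff right_diff_distrib)
    qed simp
    finally have "ennreal (norm (bform (a n) 0 g f - ?gf)) \<le> (\<integral>\<^sup>+x. norm (g x * cnj (?D x)) \<partial>lborel)"
      using norm_integral_le_nn_integral by simp
    also have "\<dots> \<le> (\<integral>\<^sup>+x. ennreal T * (?V x) \<partial>lborel)"
    proof (rule nn_integral_mono)
      fix x
      have "ennreal (norm (g x * cnj (?D x))) = ennreal (norm (g x)) * ennreal (norm (?D x))"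
        by (simp add: norm_mult ennreal_mult)
      also have "\<dots> \<le> ennreal T * (\<integral>\<^sup>+y. norm ((f y - f x) * of_real (?k (x - y))) \<partial>lborel)"
        by (intro mult_mono ennreal_leI T norm_integral_le_nn_integral) auto
      finally show "ennreal (norm (g x * cnj (?D x))) \<le> ennreal T * (?V x)"
        by (simp add: norm_mult)
    qed
    also have "\<dots> = ennreal T * (\<integral>\<^sup>+x. (?V x) \<partial>lborel)"
      by (rule nn_integral_cmult) measurable
    also have "(\<integral>\<^sup>+x. (?V x) \<partial>lborel) = (\<integral>\<^sup>+x. (\<integral>\<^sup>+u. norm (f (u + x) - f x) * ?k u \<partial>lborel) \<partial>lborel)"
    proof (rule nn_integral_cong)
      fix x
      have "(\<integral>\<^sup>+u. norm (f (x + u) - f x) * ?k (x - (x + u)) \<partial>lborel) = (?V x)"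
        by (rule nn_integral_translation[where f = "\<lambda>y. ennreal (norm (f y - f x) * ?k (x - y))"]) measurable
      then show "(?V x) = (\<integral>\<^sup>+u. norm (f (u + x) - f x) * ?k u \<partial>lborel)"
        by (simp add: gauss_mass_def add.commute)
    qed
    also have "\<dots> = (\<integral>\<^sup>+u. (\<integral>\<^sup>+x. norm (f (u + x) - f x) * ?k u \<partial>lborel) \<partial>lborel)"
      by (rule lborel_pair.Fubini') measurable
    also have "\<dots> = (\<integral>\<^sup>+u. ?k u * W u \<partial>lborel)"
      unfolding W_def by (simp add: nn_integral_cmult[symmetric] ennreal_mult mult.commute)
    also have "\<dots> = (\<integral>\<^sup>+v. gauss_mass 1 v * W (sqrt (a n) *\<^sub>R v) \<partial>lborel)"
      by (rule nn_integral_gauss_mass_scale[OF a0]) measurable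
    finally show ?thesis .
  qed
  have Wr: "W u = ennreal (\<integral>x. norm (f (u + x) - f x) \<partial>lborel)" for u
    unfolding W_def by (rule nn_integral_eq_integral) (use integrable_translation_diff[OF f, of u] in auto)
  \<comment> \<open>After rescaling, the density is fixed and \<open>a n\<close> sits in the
    argument of \<open>W\<close>. Since \<open>W\<close> is at most twice the L1 norm and tends to 0
    at the origin, dominated convergence applies.\<close>
  have "(\<lambda>n. \<integral>\<^sup>+v. gauss_mass 1 v * W (sqrt (a n) *\<^sub>R v) \<partial>lborel) \<longlonglongrightarrow> (\<integral>\<^sup>+(v::'a). 0 \<partial>lborel)"
  proof (rule nn_integral_dominated_convergence)
    let ?N = "L1_norm f"
    show "(\<lambda>v. ennreal (gauss_mass 1 v * (2 * ?N))) \<in> borel_measurable lborel" by measurable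
    show "AE v in lborel. gauss_mass 1 v * W (sqrt (a n) *\<^sub>R v) \<le> ennreal (gauss_mass 1 v * (2 * ?N))" for n
    proof (rule AE_I2)
      fix v :: 'a
      have "(\<integral>x. norm (f (u + x) - f x) \<partial>lborel) \<le> 2 * ?N" for u
      proof -
        have i: "integrable lborel (\<lambda>x. f (u + x))" using f by (subst lborel_translation(1)) auto
        have "(\<integral>x. norm (f (u + x) - f x) \<partial>lborel) \<le> (\<integral>x. norm (f (u + x)) + norm (f x) \<partial>lborel)"
          by (rule integral_mono) (use f i in \<open>auto intro: norm_triangle_ineq4\<close>)
        also have "\<dots> = (\<integral>x. norm (f (u + x)) \<partial>lborel) + ?N" using f i by simp
        also have "(\<integral>x. norm (f (u + x)) \<partial>lborel) = ?N"
          by (rule lborel_translation(2)[where f = "\<lambda>x. norm (f x)"]) measurable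
        finally show ?thesis by simp
      qed
      then have "gauss_mass 1 v * W (sqrt (a n) *\<^sub>R v) \<le> gauss_mass 1 v * ennreal (2 * ?N)"
        unfolding Wr by (intro mult_left_mono ennreal_leI) auto
      then show "gauss_mass 1 v * W (sqrt (a n) *\<^sub>R v) \<le> ennreal (gauss_mass 1 v * (2 * ?N))"
        by (simp add: ennreal_mult)
    qed
    have "(\<integral>\<^sup>+v. ennreal (gauss_mass 1 (v::'a) * (2 * ?N)) \<partial>lborel) = ennreal (\<integral>v. gauss_mass 1 (v::'a) * (2 * ?N) \<partial>lborel)"
      by (rule nn_integral_eq_integral) (use gauss_mass_integral(1)[of 1, where 'a = 'a] in auto)
    then show "(\<integral>\<^sup>+v. ennreal (gauss_mass 1 (v::'a) * (2 * ?N)) \<partial>lborel) < \<infinity>" by simp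
    show "AE v in lborel. (\<lambda>n. gauss_mass 1 (v::'a) * W (sqrt (a n) *\<^sub>R v)) \<longlonglongrightarrow> 0"
    proof (rule AE_I2)
      fix v :: 'a
      have "(\<lambda>n. sqrt (a n) *\<^sub>R v) \<longlonglongrightarrow> sqrt 0 *\<^sub>R v" by (intro tendsto_intros a)
      then have "(\<lambda>n. sqrt (a n) *\<^sub>R v) \<longlonglongrightarrow> 0" by simp
      from L1_translation_continuous[OF f this]
      have "(\<lambda>n. ennreal (gauss_mass 1 v * (\<integral>x. norm (f (sqrt (a n) *\<^sub>R v + x) - f x) \<partial>lborel))) \<longlonglongrightarrow> ennreal (gauss_mass 1 v * 0)"
        by (intro tendsto_ennrealI tendsto_intros)
      then show "(\<lambda>n. gauss_mass 1 v * W (sqrt (a n) *\<^sub>R v)) \<longlonglongrightarrow> 0"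
        unfolding Wr by (simp add: ennreal_mult)
    qed
  qed measurable
  then have "(\<lambda>n. ennreal T * (\<integral>\<^sup>+v. gauss_mass 1 v * W (sqrt (a n) *\<^sub>R v) \<partial>lborel)) \<longlonglongrightarrow> ennreal T * 0"
    by (intro ennreal_tendsto_cmult) auto
  then have lim: "(\<lambda>n. ennreal T * (\<integral>\<^sup>+v. gauss_mass 1 v * W (sqrt (a n) *\<^sub>R v) \<partial>lborel)) \<longlonglongrightarrow> 0" by simp
  have "(\<lambda>n. ennreal (norm (bform (a n) 0 g f - ?gf))) \<longlonglongrightarrow> 0"
  proof (rule tendsto_sandwich[OF _ _ tendsto_const lim])
    show "\<forall>\<^sub>F n in sequentially. ennreal (norm (bform (a n) 0 g f - ?gf)) \<le> ennreal T * (\<integral>\<^sup>+v. gauss_mass 1 v * W (sqrt (a n) *\<^sub>R v) \<partial>lborel)"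
      by (intro always_eventually allI bnd)
  qed simp_all
  then have "(\<lambda>n. norm (bform (a n) 0 g f - ?gf)) \<longlonglongrightarrow> 0"
    by (subst (asm) ennreal_tendsto_0_iff) auto
  then have "(\<lambda>n. bform (a n) 0 g f - ?gf) \<longlonglongrightarrow> 0"
    by (rule tendsto_norm_zero_cancel)
  then show ?thesis unfolding LIM_zero_iff .
qed

text \<open>The other half of Plancherel, by testing against the truncation \<open>g T\<close> of
  \<open>f\<close>. Its pairing with \<open>f\<close> is q, its own square norm, and Cauchy-Schwarz
  in the limit gives q^2 <= q M. So q <= M for every T, and Fatou lets T grow.\<close>

lemma L2_from_energy_bound:
  fixes f :: "'a::euclidean_space \<Rightarrow> complex"
  assumes f: "integrable lborel f" and M: "\<And>n::nat. energy (a n) f \<le> M"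
    and a: "\<And>n. a n > 0" "a \<longlonglongrightarrow> 0"
  shows "integrable lborel (\<lambda>x. (norm (f x))\<^sup>2)" "(\<integral>x. (norm (f x))\<^sup>2 \<partial>lborel) \<le> M"
proof -
  have [measurable]: "f \<in> borel_measurable borel" using f by auto
  have M0: "M \<ge> 0" using M[of 0] energy_nonneg[of "a 0" f] by linarith
  define g where "g = (\<lambda>T x. if norm (f x) \<le> T then f x else 0)"
  have [measurable]: "g T \<in> borel_measurable borel" for T unfolding g_def by measurable
  have g: "integrable lborel (g T)" for T
    by (rule Bochner_Integration.integrable_bound[OF f]) (auto simp: g_def)
  have g2: "integrable lborel (\<lambda>x. (norm (g T x))\<^sup>2)" if T: "T \<ge> 0" for T
  proof (rule Bochner_Integration.integrable_bound)
    show "integrable lborel (\<lambda>x. T * norm (f x))" using f by auto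
    show "AE x in lborel. norm ((norm (g T x))\<^sup>2) \<le> norm (T * norm (f x))"
      using T by (auto simp: g_def power2_eq_square intro!: mult_right_mono)
  qed measurable
  have bound: "(\<integral>x. (norm (g T x))\<^sup>2 \<partial>lborel) \<le> M" if T: "T \<ge> 0" for T
  proof -
    let ?q = "\<integral>x. (norm (g T x))\<^sup>2 \<partial>lborel"
    have q0: "?q \<ge> 0" by (rule Bochner_Integration.integral_nonneg) simp
    have "(\<lambda>n. bform (a n) 0 (g T) f) \<longlonglongrightarrow> (\<integral>x. g T x * cnj (f x) \<partial>lborel)"
      by (rule bform_tendsto_inner[OF f g _ a, of _ T]) (auto simp: g_def T)
    also have "(\<integral>x. g T x * cnj (f x) \<partial>lborel) = (\<integral>x. complex_of_real ((norm (g T x))\<^sup>2) \<partial>lborel)"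
      by (rule Bochner_Integration.integral_cong) (auto simp: g_def simp flip: complex_norm_square of_real_power)
    also have "\<dots> = of_real ?q" by (rule integral_complex_of_real)
    finally have lim: "(\<lambda>n. (norm (bform (a n) 0 (g T) f))\<^sup>2) \<longlonglongrightarrow> (norm (complex_of_real ?q))\<^sup>2"
      by (intro tendsto_intros)
    have le: "(norm (bform (a n) 0 (g T) f))\<^sup>2 \<le> ?q * M" for n
    proof -
      have "(norm (bform (a n) 0 (g T) f))\<^sup>2 \<le> energy (a n) (g T) * energy (a n) f"
        by (rule bform_Cauchy_Schwarz[OF a(1) g f])
      also have "\<dots> \<le> ?q * M"
        by (intro mult_mono energy_le_L2[OF a(1) g g2] M T) (auto simp: q0)
      finally show ?thesis .
    qed
    have "(norm (complex_of_real ?q))\<^sup>2 \<le> ?q * M" by (rule LIMSEQ_le_const2[OF lim]) (use le in auto)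
    then have "?q * ?q \<le> ?q * M" by (simp add: power2_eq_square)
    then show ?thesis using q0 M0 by (cases "?q = 0") (auto simp: mult_le_cancel_left_pos)
  qed
  have "(\<integral>\<^sup>+x. ennreal ((norm (f x))\<^sup>2) \<partial>lborel) = (\<integral>\<^sup>+x. liminf (\<lambda>n. ennreal ((norm (g (real n) x))\<^sup>2)) \<partial>lborel)"
  proof (rule nn_integral_cong)
    fix x
    have "\<forall>\<^sub>F n in sequentially. real n \<ge> norm (f x)"
      by (metis eventually_sequentiallyI nat_ceiling_le_eq)
    then have "\<forall>\<^sub>F n in sequentially. ennreal ((norm (g (real n) x))\<^sup>2) = ennreal ((norm (f x))\<^sup>2)"
      by eventually_elim (simp add: g_def)
    then have "(\<lambda>n. ennreal ((norm (g (real n) x))\<^sup>2)) \<longlonglongrightarrow> ennreal ((norm (f x))\<^sup>2)" by (rule tendsto_eventually)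
    then show "ennreal ((norm (f x))\<^sup>2) = liminf (\<lambda>n. ennreal ((norm (g (real n) x))\<^sup>2))"
      by (intro lim_imp_Liminf[symmetric]) auto
  qed
  also have "\<dots> \<le> liminf (\<lambda>n. \<integral>\<^sup>+x. ennreal ((norm (g (real n) x))\<^sup>2) \<partial>lborel)"
    by (rule nn_integral_liminf) measurable
  also have "\<dots> \<le> ennreal M"
  proof -
    have "(\<integral>\<^sup>+x. ennreal ((norm (g (real n) x))\<^sup>2) \<partial>lborel) \<le> ennreal M" for n
      by (subst nn_integral_eq_integral[OF g2]) (auto intro!: ennreal_leI bound)
    then have "liminf (\<lambda>n. \<integral>\<^sup>+x. ennreal ((norm (g (real n) x))\<^sup>2) \<partial>lborel) \<le> liminf (\<lambda>n::nat. ennreal M)"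
      by (intro Liminf_mono always_eventually) auto
    then show ?thesis by (simp add: Liminf_const)
  qed
  finally have le: "(\<integral>\<^sup>+x. ennreal ((norm (f x))\<^sup>2) \<partial>lborel) \<le> ennreal M" .
  show int: "integrable lborel (\<lambda>x. (norm (f x))\<^sup>2)"
    by (rule integrableI_bounded) (use le_less_trans[OF le ennreal_less_top] in auto)
  show "(\<integral>x. (norm (f x))\<^sup>2 \<partial>lborel) \<le> M"
    using le M0 by (subst (asm) nn_integral_eq_integral[OF int]) auto
qed

lemma bform_sum:
  fixes f g :: "'i \<Rightarrow> 'a::euclidean_space \<Rightarrow> complex"
  assumes a: "a > 0" and f: "\<And>i. i \<in> A \<Longrightarrow> integrable lborel (f i)" and g: "\<And>j. j \<in> B \<Longrightarrow> integrable lborel (g j)"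
  shows "bform a b (\<lambda>x. \<Sum>i\<in>A. f i x) (\<lambda>x. \<Sum>j\<in>B. g j x) = (\<Sum>i\<in>A. \<Sum>j\<in>B. bform a b (f i) (g j))"
proof -
  have "bform a b (\<lambda>x. \<Sum>i\<in>A. f i x) (\<lambda>x. \<Sum>j\<in>B. g j x) =
    (\<integral>\<xi>. (\<Sum>i\<in>A. \<Sum>j\<in>B. fourier (f i) \<xi> * (cnj (fourier (g j) \<xi>) * gauss a b \<xi>)) \<partial>lborel)"
    unfolding bform_def
    by (rule Bochner_Integration.integral_cong) (simp_all add: fourier_sum f g sum_product sum_distrib_left sum_distrib_right, rule sum.swap)
  also have "\<dots> = (\<Sum>i\<in>A. \<Sum>j\<in>B. bform a b (f i) (g j))"
    unfolding bform_def using f g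
    by (subst Bochner_Integration.integral_sum; (intro Bochner_Integration.integrable_sum)?)
       (auto intro!: sum.cong Bochner_Integration.integral_sum integrable_bform a)
  finally show ?thesis .
qed

text \<open>Continuity of the form in L1 for fixed \<open>a\<close> and \<open>b\<close>, used to
  pass from finitely many level sets to \<open>f\<close>. The constant may depend on
  \<open>f\<close>, since only a limit is taken.\<close>

lemma bform_diff_le:
  fixes f g :: "'a::euclidean_space \<Rightarrow> complex"
  assumes a: "a > 0" and f: "integrable lborel f" and g: "integrable lborel g" and gf: "\<And>x. norm (g x) \<le> norm (f x)"
  shows "norm (bform a b f f - bform a b g g) \<le>
    (a\<^sup>2 + b\<^sup>2) powr (- real DIM('a) / 4) * (2 * (L1_norm f)) * (\<integral>x. norm (f x - g x) \<partial>lborel)"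
proof -
  let ?h = "\<lambda>x. f x - g x" and ?c = "(a\<^sup>2 + b\<^sup>2) powr (- real DIM('a) / 4)"
  let ?F = "L1_norm f" and ?G = "L1_norm g" and ?H = "\<integral>x. norm (f x - g x) \<partial>lborel"
  have h: "integrable lborel ?h" using f g by simp
  have "bform a b ?h f = bform a b f f - bform a b g f"
    unfolding bform_def Bochner_Integration.integral_diff[OF integrable_bform[OF a f f] integrable_bform[OF a g f], symmetric]
    by (simp add: fourier_diff f g left_diff_distrib)
  moreover have "bform a b g ?h = bform a b g f - bform a b g g"
    unfolding bform_def Bochner_Integration.integral_diff[OF integrable_bform[OF a g f] integrable_bform[OF a g g], symmetric]
    by (simp add: fourier_diff f g left_diff_distrib right_diff_distrib)
  ultimately have "bform a b f f - bform a b g g = bform a b ?h f + bform a b g ?h" by simp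
  also have "norm \<dots> \<le> norm (bform a b ?h f) + norm (bform a b g ?h)" by (rule norm_triangle_ineq)
  also have "\<dots> \<le> ?c * ?H * ?F + ?c * ?G * ?H"
    by (intro add_mono bform_L1_bound a f g h)
  also have "\<dots> \<le> ?c * ?H * ?F + ?c * ?F * ?H"
  proof -
    have "?G \<le> ?F" by (rule integral_mono) (use f g gf in auto)
    then have "?c * ?G * ?H \<le> ?c * ?F * ?H"
      by (intro mult_right_mono mult_left_mono Bochner_Integration.integral_nonneg) auto
    then show ?thesis by (rule add_left_mono)
  qed
  finally show ?thesis by (simp add: algebra_simps)
qed

lemma le_powr_interpolation:
  fixes z X Y s :: real
  assumes "0 \<le> z" "z \<le> X" "z \<le> Y" "0 \<le> s" "s \<le> 1"
  shows "z \<le> X powr s * Y powr (1 - s)"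
proof (cases "z = 0")
  case False
  then have "z = z powr s * z powr (1 - s)" using assms by (simp add: powr_add[symmetric])
  also have "\<dots> \<le> X powr s * Y powr (1 - s)" using assms by (intro mult_mono powr_mono2) auto
  finally show ?thesis .
qed simp

lemma sum_geometric_abs_int:
  fixes r :: real and S :: "int set"
  assumes r: "0 \<le> r" "r < 1" and S: "finite S"
  shows "(\<Sum>k\<in>S. r ^ nat \<bar>k + c\<bar>) \<le> 2 / (1 - r)"
proof -
  have geo: "(\<Sum>k\<in>T. r ^ nat k) \<le> 1 / (1 - r)" if "finite T" "T \<subseteq> {0..}" for T :: "int set"
  proof -
    have "(\<Sum>k\<in>T. r ^ nat k) = (\<Sum>k\<in>nat ` T. r ^ k)"
    proof (subst sum.reindex)
      show "inj_on nat T"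
      proof (rule inj_onI)
        fix x y assume "x \<in> T" "y \<in> T" "nat x = nat y"
        moreover have "0 \<le> x" "0 \<le> y" using that(2) \<open>x \<in> T\<close> \<open>y \<in> T\<close> by auto
        ultimately show "x = y" by simp
      qed
    qed simp
    also have "\<dots> \<le> (\<Sum>k. r ^ k)"
      by (rule sum_le_suminf) (use that r in \<open>auto intro: summable_geometric\<close>)
    also have "\<dots> = 1 / (1 - r)" using r by (intro suminf_geometric) auto
    finally show ?thesis .
  qed
  define T where "T = (\<lambda>k. k + c) ` S"
  have T: "finite T" using S by (simp add: T_def)
  have "(\<Sum>k\<in>S. r ^ nat \<bar>k + c\<bar>) = (\<Sum>k\<in>T. r ^ nat \<bar>k\<bar>)"
    unfolding T_def by (subst sum.reindex) (auto simp: inj_on_def)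
  also have "\<dots> = (\<Sum>k\<in>T \<inter> {0..}. r ^ nat \<bar>k\<bar>) + (\<Sum>k\<in>T \<inter> {..<0}. r ^ nat \<bar>k\<bar>)"
    by (subst sum.union_disjoint[symmetric]) (use T in \<open>auto intro!: sum.cong\<close>)
  also have "(\<Sum>k\<in>T \<inter> {0..}. r ^ nat \<bar>k\<bar>) = (\<Sum>k\<in>T \<inter> {0..}. r ^ nat k)" by (intro sum.cong) auto
  also have "(\<Sum>k\<in>T \<inter> {..<0}. r ^ nat \<bar>k\<bar>) = (\<Sum>k\<in>uminus ` (T \<inter> {..<0}). r ^ nat k)"
    by (subst sum.reindex) (auto simp: inj_on_def intro!: sum.cong)
  also have "(\<Sum>k\<in>T \<inter> {0..}. r ^ nat k) + (\<Sum>k\<in>uminus ` (T \<inter> {..<0}). r ^ nat k) \<le> 1 / (1 - r) + 1 / (1 - r)"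
    by (intro add_mono geo) (use T in auto)
  finally show ?thesis by simp
qed

section \<open>Interpolation over level sets\<close>

text \<open>On a dyadic level |f| is comparable to 2^n, so its first and second powers can be traded
  for the p-th power at the price of a power of 2^n. The factor 4 absorbs the upper end 2^(n+1) of
  the level.\<close>

lemma level_piece_bounds:
  fixes f :: "'a::euclidean_space \<Rightarrow> complex" and n :: int and p :: real
  assumes f: "integrable lborel f" and fp: "integrable lborel (\<lambda>x. norm (f x) powr p)" and p: "1 \<le> p" "p \<le> 2"
    and h: "h = (\<lambda>x. if 2 powr n \<le> norm (f x) \<and> norm (f x) < 2 powr (real_of_int n + 1) then f x else 0)"
  shows "integrable lborel h" "integrable lborel (\<lambda>x. norm (h x) powr p)" "integrable lborel (\<lambda>x. (norm (h x))\<^sup>2)"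
    and "(L1_norm h) \<le> 2 powr (n * (1 - p)) * (\<integral>x. norm (h x) powr p \<partial>lborel)"
    and "(\<integral>x. (norm (h x))\<^sup>2 \<partial>lborel) \<le> 4 * 2 powr (n * (2 - p)) * (\<integral>x. norm (h x) powr p \<partial>lborel)"
proof -
  have [measurable]: "f \<in> borel_measurable borel" using f by auto
  have [measurable]: "h \<in> borel_measurable borel" unfolding h by measurable
  show hi: "integrable lborel h"
    by (rule Bochner_Integration.integrable_bound[OF f]) (auto simp: h)
  show hp: "integrable lborel (\<lambda>x. norm (h x) powr p)"
    by (rule Bochner_Integration.integrable_bound[OF fp]) (auto simp: h)
  have b1: "norm (h x) \<le> 2 powr (n * (1 - p)) * norm (h x) powr p" for x
  proof (cases "h x = 0")
    case False
    then have ge: "2 powr n \<le> norm (h x)" by (auto simp: h split: if_splits)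
    have pos: "norm (h x) > 0" using False by simp
    have "norm (h x) = norm (h x) powr (1 - p) * norm (h x) powr p" using pos by (simp add: powr_add[symmetric])
    also have "\<dots> \<le> (2 powr n) powr (1 - p) * norm (h x) powr p"
      by (intro mult_right_mono powr_mono2') (use ge p in auto)
    finally show ?thesis by (simp add: powr_powr)
  qed simp
  have b2: "(norm (h x))\<^sup>2 \<le> 4 * 2 powr (n * (2 - p)) * norm (h x) powr p" for x
  proof (cases "h x = 0")
    case False
    then have le: "norm (h x) \<le> 2 powr (real_of_int n + 1)" by (auto simp: h split: if_splits)
    have pos: "norm (h x) > 0" using False by simp
    have "(norm (h x))\<^sup>2 = norm (h x) powr (2 - p) * norm (h x) powr p"
      using pos by (simp add: powr_add[symmetric] powr_numeral)
    also have "\<dots> \<le> (2 powr (real_of_int n + 1)) powr (2 - p) * norm (h x) powr p"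
      by (intro mult_right_mono powr_mono2) (use le p in auto)
    also have "(2 powr (real_of_int n + 1)) powr (2 - p) = 2 powr (2 - p) * 2 powr (n * (2 - p))"
      by (simp add: powr_powr powr_add[symmetric] algebra_simps)
    also have "\<dots> \<le> 4 * 2 powr (n * (2 - p))"
      using powr_mono[of "2 - p" 2 2] p by (intro mult_right_mono) auto
    finally show ?thesis by (simp add: mult_right_mono)
  qed simp
  show "integrable lborel (\<lambda>x. (norm (h x))\<^sup>2)"
    by (rule Bochner_Integration.integrable_bound[of lborel "\<lambda>x. 4 * 2 powr (n * (2 - p)) * norm (h x) powr p"])
       (use hp b2 in \<open>auto intro: order.trans\<close>)
  show "(L1_norm h) \<le> 2 powr (n * (1 - p)) * (\<integral>x. norm (h x) powr p \<partial>lborel)"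
    unfolding Bochner_Integration.integral_mult_right_zero[symmetric]
    by (rule integral_mono) (use hi hp b1 in auto)
  show "(\<integral>x. (norm (h x))\<^sup>2 \<partial>lborel) \<le> 4 * 2 powr (n * (2 - p)) * (\<integral>x. norm (h x) powr p \<partial>lborel)"
    unfolding Bochner_Integration.integral_mult_right_zero[symmetric]
    by (rule integral_mono) (use \<open>integrable lborel (\<lambda>x. (norm (h x))\<^sup>2)\<close> hp b2 in auto)
qed

text \<open>Discarding \<open>a\<close> makes the decay uniform in the damping.\<close>

lemma kernel_decay:
  fixes l :: nat
  assumes "a > 0" "l > 0"
  shows "(a\<^sup>2 + (real l / 4)\<^sup>2) powr (- real d / 4) \<le> 4 powr (real d / 2) * real l powr (- real d / 2)"
proof -
  have "(a\<^sup>2 + (real l / 4)\<^sup>2) powr (- real d / 4) \<le> ((real l / 4)\<^sup>2) powr (- real d / 4)"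
    by (rule powr_mono2') (use assms in auto)
  also have "\<dots> = (real l / 4) powr (- real d / 2)"
    using assms by (simp add: powr_numeral[symmetric] powr_powr del: powr_numeral)
  also have "\<dots> = 4 powr (real d / 2) * real l powr (- real d / 2)"
    using assms by (simp add: powr_divide powr_minus_divide)
  finally show ?thesis .
qed

text \<open>The exponent \<open>s = \<theta> \<plusminus> \<eta>\<close> is taken on the side that makes the power of 2 decay in \<open>\<bar>m + n\<bar>\<close>; this gain makes the
  double sum over the level sets converge, and \<open>\<theta> - \<eta> > 2 / DIM\<close> keeps the decay in \<open>l\<close> summable.\<close>
lemma level_pair_bound:
  fixes f :: "'a::euclidean_space \<Rightarrow> complex" and l :: nat and m n :: int and p \<theta> \<eta> :: real
  assumes p: "1 < p" "p < 2 * DIM('a) / (DIM('a) + 2)"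
    and f: "integrable lborel f" and fp: "integrable lborel (\<lambda>x. norm (f x) powr p)" and f1: "(\<integral>x. norm (f x) powr p \<partial>lborel) \<le> 1"
    and a: "a > 0" and l: "l > 0"
    and \<theta>: "\<theta> = 2 / p - 1" and \<eta>: "\<eta> \<ge> 0" "\<theta> + \<eta> \<le> 1" "0 \<le> \<theta> - \<eta>"
    and h: "h = (\<lambda>(n::int) x. if 2 powr n \<le> norm (f x) \<and> norm (f x) < 2 powr (real_of_int n + 1) then f x else 0)"
    and A: "A = (\<lambda>n. \<integral>x. norm (h n x) powr p \<partial>lborel)"
  shows "norm (bform a (real l / 4) (h m) (h n)) \<le>
    4 * 4 powr (DIM('a) / 2) * real l powr (- (DIM('a) * (\<theta> - \<eta>) / 2)) * ((2 powr (- (\<eta> * p / 2))) ^ nat \<bar>m + n\<bar> * ((A m + A n) / 2))"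
proof -
  let ?d = "real DIM('a)"
  have p2: "p \<le> 2"
  proof -
    have "p < 2 * ?d / (?d + 2)" using p(2) by (simp add: add.commute)
    also have "\<dots> \<le> 2" by (simp add: divide_simps)
    finally show ?thesis by simp
  qed
  note lp = level_piece_bounds[OF f fp less_imp_le[OF p(1)] p2]
  have hn: "h n = (\<lambda>x. if 2 powr n \<le> norm (f x) \<and> norm (f x) < 2 powr (real_of_int n + 1) then f x else 0)" for n
    by (simp add: h)
  have A0: "A n \<ge> 0" for n unfolding A by (rule Bochner_Integration.integral_nonneg) simp
  have A1: "A n \<le> 1" for n
  proof -
    have "A n \<le> (\<integral>x. norm (f x) powr p \<partial>lborel)"
      unfolding A by (rule integral_mono) (use lp(2)[OF hn] fp in \<open>auto simp: h\<close>)
    then show ?thesis using f1 by simp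
  qed
  define z where "z = norm (bform a (real l / 4) (h m) (h n))"
  define B where "B = A m * A n"
  define c where "c = 4 powr (?d / 2)"
  have B: "0 \<le> B" "B \<le> 1" using A0[of m] A0[of n] A1[of m] A1[of n] by (auto simp: B_def intro: mult_le_one)
  have c: "c \<ge> 1" unfolding c_def by (intro ge_one_powr_ge_zero) auto
  define t where "t = real_of_int (m + n)"
  \<comment> \<open>\<open>X\<close> is the L1 endpoint and \<open>Y\<close> the L2 endpoint; both
    see the levels only through t = m + n and the product \<open>B\<close> of the masses.\<close>
  define X where "X = c * real l powr (- ?d / 2) * (2 powr (t * (1 - p)) * B)"
  define Y where "Y = 4 * (2 powr (t * (1 - p / 2)) * B powr (1/2))"
  have zX: "z \<le> X"
  proof -
    have "z \<le> (a\<^sup>2 + (real l / 4)\<^sup>2) powr (- ?d / 4) * (\<integral>x. norm (h m x) \<partial>lborel) * (\<integral>x. norm (h n x) \<partial>lborel)"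
      unfolding z_def by (rule bform_L1_bound[OF a]) (use lp(1)[OF hn] in auto)
    also have "\<dots> \<le> (c * real l powr (- ?d / 2)) * (2 powr (m * (1 - p)) * A m) * (2 powr (n * (1 - p)) * A n)"
      unfolding c_def A
      by (intro mult_mono kernel_decay a l lp(4)[OF hn] mult_nonneg_nonneg Bochner_Integration.integral_nonneg) auto
    also have "\<dots> = X" unfolding X_def B_def t_def by (simp add: powr_add[symmetric] algebra_simps)
    finally show ?thesis .
  qed
  have zY: "z \<le> Y"
  proof -
    have e: "energy a (h k) \<le> 4 * 2 powr (k * (2 - p)) * A k" for k
      using order.trans[OF energy_le_L2[OF a lp(1)[OF hn] lp(3)[OF hn]] lp(5)[OF hn]] by (simp add: A)
    have "z\<^sup>2 \<le> energy a (h m) * energy a (h n)"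
      unfolding z_def by (rule bform_Cauchy_Schwarz[OF a lp(1)[OF hn] lp(1)[OF hn]])
    also have "\<dots> \<le> (4 * 2 powr (m * (2 - p)) * A m) * (4 * 2 powr (n * (2 - p)) * A n)"
      by (intro mult_mono e) (use A0 in auto)
    also have "\<dots> = 16 * 2 powr (t * (2 - p)) * B"
      unfolding B_def t_def by (simp add: distrib_right powr_add)
    also have "\<dots> = Y\<^sup>2"
    proof -
      have "(2 powr (t * (1 - p / 2)))\<^sup>2 = (2::real) powr (t * (2 - p))"
        by (simp add: power2_eq_square powr_add[symmetric] algebra_simps)
      moreover have "(B powr (1/2))\<^sup>2 = B" using B by (simp add: powr_half_sqrt)
      ultimately show ?thesis unfolding Y_def power_mult_distrib by simp
    qed
    finally show ?thesis by (rule power2_le_imp_le) (auto simp: Y_def)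
  qed
  have z0: "z \<ge> 0" by (simp add: z_def)
  define s where "s = (if m + n \<ge> 0 then \<theta> + \<eta> else \<theta> - \<eta>)"
  have s: "0 \<le> s" "s \<le> 1" "\<theta> - \<eta> \<le> s" using \<eta> by (auto simp: s_def)
  have l1: "real l \<ge> 1" using l by simp
  have "z \<le> X powr s * Y powr (1 - s)" by (rule le_powr_interpolation[OF z0 zX zY s(1,2)])
  also have "\<dots> = (c powr s * 4 powr (1 - s)) * real l powr (- ?d / 2 * s) * (2 powr (t * (1 - p) * s) * 2 powr (t * (1 - p / 2) * (1 - s))) * (B powr s * B powr (1/2 * (1 - s)))"
    unfolding X_def Y_def using c B l1 by (simp add: powr_mult powr_powr mult_ac)
  also have "\<dots> \<le> (c * 4) * real l powr (- (?d * (\<theta> - \<eta>) / 2)) * ((2 powr (- (\<eta> * p / 2))) ^ nat \<bar>m + n\<bar>) * B powr (1 / 2)"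
  proof (intro mult_mono)
    have "c powr s \<le> c powr 1" by (rule powr_mono) (use c s in auto)
    then show "c powr s \<le> c" using c by simp
    show "(4::real) powr (1 - s) \<le> 4" using powr_mono[of "1 - s" 1 "4::real"] s by simp
    have "- ?d / 2 * s \<le> - (?d * (\<theta> - \<eta>) / 2)" using s(3) by (simp add: mult_left_mono)
    then show "real l powr (- ?d / 2 * s) \<le> real l powr (- (?d * (\<theta> - \<eta>) / 2))"
      by (rule powr_mono) (use l1 in auto)
    \<comment> \<open>The interpolated exponent of 2 vanishes exactly at s = 2/p - 1, which is the
      origin of \<open>\<theta>\<close>. The offset by \<open>\<eta>\<close> has the sign of t, so
      it leaves -(\<eta> p / 2) |t|.\<close>
    have "t * (1 - p) * s + t * (1 - p / 2) * (1 - s) = t * (1 - p / 2 - s * p / 2)"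
      by (simp add: field_simps)
    also have "1 - p / 2 - s * p / 2 = - ((s - \<theta>) * p / 2)" using p unfolding \<theta> by (simp add: field_simps)
    also have "t * (- ((s - \<theta>) * p / 2)) = - (\<eta> * p / 2) * real (nat \<bar>m + n\<bar>)"
      by (simp add: s_def t_def algebra_simps)
    finally have E: "t * (1 - p) * s + t * (1 - p / 2) * (1 - s) = - (\<eta> * p / 2) * real (nat \<bar>m + n\<bar>)" .
    have R: "(2 powr e) ^ k = (2::real) powr (e * real k)" for e :: real and k :: nat
      by (simp add: powr_powr flip: powr_realpow)
    show "2 powr (t * (1 - p) * s) * 2 powr (t * (1 - p / 2) * (1 - s)) \<le> (2 powr (- (\<eta> * p / 2))) ^ nat \<bar>m + n\<bar>"
      by (simp only: powr_add[symmetric] E R order_refl)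
    \<comment> \<open>The normalization gives B <= 1, so lowering the exponent only enlarges the
      power; at 1/2 the mean inequality turns the product into a sum.\<close>
    have "1/2 \<le> s + 1/2 * (1 - s)" using s by (simp add: field_simps)
    then have "B powr (s + 1/2 * (1 - s)) \<le> B powr (1/2)"
      by (rule powr_mono') (use B s in auto)
    then show "B powr s * B powr (1/2 * (1 - s)) \<le> B powr (1/2)"
      by (simp only: powr_add)
  qed (use c in auto)
  also have "\<dots> \<le> (c * 4) * real l powr (- (?d * (\<theta> - \<eta>) / 2)) * ((2 powr (- (\<eta> * p / 2))) ^ nat \<bar>m + n\<bar>) * ((A m + A n) / 2)"
  proof (intro mult_left_mono)
    have "B powr (1/2) = sqrt B" using B by (simp add: powr_half_sqrt)
    also have "\<dots> \<le> (A m + A n) / 2" unfolding B_def by (rule arith_geo_mean_sqrt) (use A0 in auto)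
    finally show "B powr (1/2) \<le> (A m + A n) / 2" .
  qed (use c in auto)
  finally show ?thesis unfolding z_def c_def by (simp add: mult_ac)
qed

text \<open>The pair bounds decay geometrically in |m + n|, so each row sums to at most 2/(1 - r),
  and the masses \<open>A\<close> sum to at most 1. Finitely many levels give \<open>F N\<close>,
  which tends to \<open>f\<close> in L1.\<close>

lemma bform_decay_normalized:
  fixes f :: "'a::euclidean_space \<Rightarrow> complex" and l :: nat and p \<theta> \<eta> :: real
  assumes p: "1 < p" "p < 2 * DIM('a) / (DIM('a) + 2)"
    and f: "integrable lborel f" and fp: "integrable lborel (\<lambda>x. norm (f x) powr p)" and f1: "(\<integral>x. norm (f x) powr p \<partial>lborel) \<le> 1"
    and a: "a > 0" and l: "l > 0"
    and \<theta>: "\<theta> = 2 / p - 1" and \<eta>: "\<eta> > 0" "\<theta> + \<eta> \<le> 1" "0 \<le> \<theta> - \<eta>"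
  shows "norm (bform a (real l / 4) f f) \<le>
    4 * 4 powr (DIM('a) / 2) * real l powr (- (DIM('a) * (\<theta> - \<eta>) / 2)) * (2 / (1 - 2 powr (- (\<eta> * p / 2))))"
proof -
  have [measurable]: "f \<in> borel_measurable borel" using f by auto
  define h where "h = (\<lambda>(n::int) x. if 2 powr n \<le> norm (f x) \<and> norm (f x) < 2 powr (real_of_int n + 1) then f x else 0)"
  define A where "A = (\<lambda>n. \<integral>x. norm (h n x) powr p \<partial>lborel)"
  define r where "r = 2 powr (- (\<eta> * p / 2))"
  define D where "D = 4 * 4 powr (DIM('a) / 2) * real l powr (- (DIM('a) * (\<theta> - \<eta>) / 2))"
  define S where "S N = {- int N..int N}" for N
  define F where "F N x = (\<Sum>n\<in>S N. h n x)" for N x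
  have r: "0 \<le> r" "r < 1" using \<eta>(1) p by (auto simp: r_def powr_less_one)
  have D0: "D \<ge> 0" by (simp add: D_def)
  have hint: "integrable lborel (h n)" for n
    by (rule Bochner_Integration.integrable_bound[OF f]) (auto simp: h_def)
  have hpint: "integrable lborel (\<lambda>x. norm (h n x) powr p)" for n
    by (rule Bochner_Integration.integrable_bound[OF fp]) (auto simp: h_def)
  \<comment> \<open>Each point lies in exactly one level. Where \<open>f\<close> vanishes both sides
    are 0, whatever value the logarithm takes there.\<close>
  have unique: "h n x = (if n = \<lfloor>log 2 (norm (f x))\<rfloor> then f x else 0)" for n x
  proof (cases "f x = 0")
    case False
    then have "2 powr n \<le> norm (f x) \<and> norm (f x) < 2 powr (real_of_int n + 1) \<longleftrightarrow> \<lfloor>log 2 (norm (f x))\<rfloor> = n"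
      by (simp add: powr_le_iff less_powr_iff floor_eq_iff)
    then show ?thesis by (auto simp: h_def)
  qed (simp add: h_def)
  have Feq: "F N x = (if \<lfloor>log 2 (norm (f x))\<rfloor> \<in> S N then f x else 0)" for N x
    unfolding F_def unique by (subst sum.delta) (auto simp: S_def)
  have Fint: "integrable lborel (F N)" for N unfolding F_def[abs_def] using hint by auto
  have sumA: "(\<Sum>n\<in>S N. A n) \<le> 1" for N
  proof -
    have "(\<Sum>n\<in>S N. A n) = (\<integral>x. (\<Sum>n\<in>S N. norm (h n x) powr p) \<partial>lborel)"
      unfolding A_def using hpint by simp
    also have "\<dots> \<le> (\<integral>x. norm (f x) powr p \<partial>lborel)"
    proof (rule integral_mono)
      fix x
      have "(\<Sum>n\<in>S N. norm (h n x) powr p) = (\<Sum>n\<in>S N. if n = \<lfloor>log 2 (norm (f x))\<rfloor> then norm (f x) powr p else 0)"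
        unfolding unique by (intro sum.cong) auto
      also have "\<dots> \<le> norm (f x) powr p" by (subst sum.delta) (auto simp: S_def)
      finally show "(\<Sum>n\<in>S N. norm (h n x) powr p) \<le> norm (f x) powr p" .
    qed (use fp hpint in auto)
    finally show ?thesis using f1 by simp
  qed
  have A0: "A n \<ge> 0" for n unfolding A_def by (rule Bochner_Integration.integral_nonneg) simp
  have main: "norm (bform a (real l / 4) (F N) (F N)) \<le> D * (2 / (1 - r))" for N
  proof -
    have fin: "finite (S N)" by (simp add: S_def)
    have "bform a (real l / 4) (F N) (F N) = (\<Sum>m\<in>S N. \<Sum>n\<in>S N. bform a (real l / 4) (h m) (h n))"
      unfolding F_def[abs_def] by (rule bform_sum[OF a]) (use hint in auto)
    also have "norm \<dots> \<le> (\<Sum>m\<in>S N. \<Sum>n\<in>S N. D * (r ^ nat \<bar>m + n\<bar> * ((A m + A n) / 2)))"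
      unfolding D_def r_def
      by (intro sum_norm_le level_pair_bound[OF p f fp f1 a l \<theta> less_imp_le[OF \<eta>(1)] \<eta>(2,3) h_def A_def])
    also have "\<dots> = D * (((\<Sum>m\<in>S N. \<Sum>n\<in>S N. r ^ nat \<bar>m + n\<bar> * A m) + (\<Sum>m\<in>S N. \<Sum>n\<in>S N. r ^ nat \<bar>m + n\<bar> * A n)) / 2)"
      by (simp only: sum.distrib[symmetric] sum_divide_distrib sum_distrib_left times_divide_eq_right distrib_left)
    \<comment> \<open>The coefficients are symmetric in m and n, so both halves of the mean (A m + A
      n)/2 contribute equally.\<close>
    also have "(\<Sum>m\<in>S N. \<Sum>n\<in>S N. r ^ nat \<bar>m + n\<bar> * A n) = (\<Sum>m\<in>S N. \<Sum>n\<in>S N. r ^ nat \<bar>m + n\<bar> * A m)"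
      by (subst sum.swap) (simp add: add.commute)
    also have "D * (((\<Sum>m\<in>S N. \<Sum>n\<in>S N. r ^ nat \<bar>m + n\<bar> * A m) + (\<Sum>m\<in>S N. \<Sum>n\<in>S N. r ^ nat \<bar>m + n\<bar> * A m)) / 2)
       = D * (\<Sum>m\<in>S N. A m * (\<Sum>n\<in>S N. r ^ nat \<bar>n + m\<bar>))"
      by (simp add: sum_distrib_left mult_ac add.commute)
    also have "\<dots> \<le> D * (\<Sum>m\<in>S N. A m * (2 / (1 - r)))"
      by (intro mult_left_mono sum_mono sum_geometric_abs_int r fin A0 D0)
    also have "\<dots> = D * ((\<Sum>m\<in>S N. A m) * (2 / (1 - r)))" by (simp add: sum_distrib_right sum_divide_distrib)
    also have "\<dots> \<le> D * (1 * (2 / (1 - r)))"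
      by (intro mult_left_mono mult_right_mono sumA D0) (use r in auto)
    finally show ?thesis by simp
  qed
  have "(\<lambda>N. \<integral>x. norm (f x - F N x) \<partial>lborel) \<longlonglongrightarrow> (\<integral>x. 0 \<partial>(lborel :: 'a measure))"
  proof (rule integral_dominated_convergence[where w = "\<lambda>x. norm (f x)"])
    show "AE x in lborel. (\<lambda>N. norm (f x - F N x)) \<longlonglongrightarrow> 0"
    proof (rule AE_I2)
      fix x
      have "\<forall>\<^sub>F N in sequentially. norm (f x - F N x) = 0"
        by (rule eventually_sequentiallyI[of "nat \<bar>\<lfloor>log 2 (norm (f x))\<rfloor>\<bar>"]) (auto simp: Feq S_def)
      then show "(\<lambda>N. norm (f x - F N x)) \<longlonglongrightarrow> 0" by (rule tendsto_eventually)
    qed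
    show "(\<lambda>x. norm (f x - F N x)) \<in> borel_measurable lborel" for N using Fint[of N] by measurable
  qed (use f in \<open>auto simp: Feq\<close>)
  then have lim0: "(\<lambda>N. \<integral>x. norm (f x - F N x) \<partial>lborel) \<longlonglongrightarrow> 0" by simp
  let ?c = "(a\<^sup>2 + (real l / 4)\<^sup>2) powr (- real DIM('a) / 4) * (2 * (L1_norm f))"
  have "norm (bform a (real l / 4) f f) \<le> D * (2 / (1 - r)) + ?c * (\<integral>x. norm (f x - F N x) \<partial>lborel)" for N
  proof -
    have "norm (bform a (real l / 4) f f) \<le> norm (bform a (real l / 4) (F N) (F N)) + norm (bform a (real l / 4) f f - bform a (real l / 4) (F N) (F N))"
      by (metis add.commute diff_add_cancel norm_triangle_ineq)
    also have "\<dots> \<le> D * (2 / (1 - r)) + ?c * (\<integral>x. norm (f x - F N x) \<partial>lborel)"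
      by (intro add_mono main bform_diff_le a f Fint) (auto simp: Feq)
    finally show ?thesis .
  qed
  moreover have "(\<lambda>N. D * (2 / (1 - r)) + ?c * (\<integral>x. norm (f x - F N x) \<partial>lborel)) \<longlonglongrightarrow> D * (2 / (1 - r)) + ?c * 0"
    by (intro tendsto_intros lim0)
  ultimately have "norm (bform a (real l / 4) f f) \<le> D * (2 / (1 - r)) + ?c * 0"
    by (intro LIMSEQ_le_const) auto
  then show ?thesis by (simp add: D_def r_def)
qed

lemma bform_scale: "bform a b (\<lambda>x. of_real c * f x) (\<lambda>x. of_real c * f x) = of_real (c\<^sup>2) * bform a b f f"
  unfolding bform_def fourier_def integral_mult_right_zero[symmetric]
  by (rule Bochner_Integration.integral_cong) (simp_all add: mult.assoc power2_eq_square mult_ac)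

text \<open>For p = 1 the kernel bound alone gives \<kappa> = d/2, and the hypothesis on
  \<open>p\<close> then reads d > 2. For p > 1 it is equivalent to \<theta> > 2/d, while p > 1 means
  \<theta> < 1; this leaves room for a positive \<open>\<eta>\<close>. Homogeneity removes the
  normalization.\<close>

theorem bform_decay:
  fixes p :: real
  assumes p: "1 \<le> p" "p < 2 * DIM('a::euclidean_space) / (DIM('a) + 2)"
  obtains C \<kappa> where "C > 0" "\<kappa> > 1"
    "\<And>(f :: 'a \<Rightarrow> complex) a l. integrable lborel f \<Longrightarrow> integrable lborel (\<lambda>x. norm (f x) powr p) \<Longrightarrow> a > 0 \<Longrightarrow> l > 0 \<Longrightarrow>
      norm (bform a (real l / 4) f f) \<le> C * real l powr (- \<kappa>) * ((\<integral>x. norm (f x) powr p \<partial>lborel) powr (1 / p))\<^sup>2"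
proof -
  let ?d = "real DIM('a)"
  have p': "p < 2 * ?d / (?d + 2)" using p(2) by (simp add: add.commute)
  have p2: "p * (?d + 2) < 2 * ?d" using p' by (simp add: field_simps)
  show thesis
  proof (cases "p = 1")
    case True
    have d2: "?d / 2 > 1" using p2 True by simp
    show thesis
    proof (rule that[of "4 powr (?d / 2)" "?d / 2"])
      fix f :: "'a \<Rightarrow> complex" and a :: real and l :: nat
      assume f: "integrable lborel f" and a: "a > 0" and l: "l > 0"
      have "norm (bform a (real l / 4) f f) \<le> (a\<^sup>2 + (real l / 4)\<^sup>2) powr (- ?d / 4) * (L1_norm f) * (L1_norm f)"
        by (rule bform_L1_bound[OF a f f])
      also have "\<dots> \<le> 4 powr (?d / 2) * real l powr (- ?d / 2) * (L1_norm f) * (L1_norm f)"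
        by (intro mult_right_mono kernel_decay a l Bochner_Integration.integral_nonneg) auto
      finally show "norm (bform a (real l / 4) f f) \<le> 4 powr (?d / 2) * real l powr (- (?d / 2)) * ((\<integral>x. norm (f x) powr p \<partial>lborel) powr (1 / p))\<^sup>2"
        by (simp add: True power2_eq_square mult_ac)
    qed (use d2 in auto)
  next
    case False
    then have p1: "1 < p" using p by simp
    define \<theta> where "\<theta> = 2 / p - 1"
    \<comment> \<open>The smaller of the two gaps, from \<open>\<theta>\<close> up to 1 and down to
      2/d; half of it leaves both inequalities intact, the second one strictly.\<close>
    define e where "e = min (1 - \<theta>) (\<theta> - 2 / ?d)"
    define \<eta> where "\<eta> = e / 2"
    have "\<theta> > 2 / ?d" using p2 p1 by (simp add: \<theta>_def field_simps)
    moreover have "\<theta> < 1" using p1 by (simp add: \<theta>_def field_simps)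
    ultimately have "e > 0" "e \<le> 1 - \<theta>" "e \<le> \<theta> - 2 / ?d" by (simp_all add: e_def)
    then have \<eta>: "\<eta> > 0" "\<theta> + \<eta> \<le> 1" "\<theta> - \<eta> > 2 / ?d" unfolding \<eta>_def by linarith+
    have "2 / ?d > 0" by simp
    then have \<eta>0: "0 \<le> \<theta> - \<eta>" using \<eta>(3) by linarith
    define \<kappa> where "\<kappa> = ?d * (\<theta> - \<eta>) / 2"
    define r where "r = 2 powr (- (\<eta> * p / 2))"
    have r: "0 \<le> r" "r < 1" using \<eta>(1) p1 by (auto simp: r_def powr_less_one)
    define C where "C = 4 * 4 powr (?d / 2) * (2 / (1 - r))"
    show thesis
    proof (rule that[of C \<kappa>])
      show "C > 0" using r by (simp add: C_def)
      show "\<kappa> > 1" using \<eta>(3) by (simp add: \<kappa>_def field_simps)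
      fix f :: "'a \<Rightarrow> complex" and a :: real and l :: nat
      assume f: "integrable lborel f" and fp: "integrable lborel (\<lambda>x. norm (f x) powr p)" and a: "a > 0" and l: "l > 0"
      have [measurable]: "f \<in> borel_measurable borel" using f by auto
      define I where "I = (\<integral>x. norm (f x) powr p \<partial>lborel)"
      define s where "s = I powr (1 / p)"
      have I0: "I \<ge> 0" unfolding I_def by (rule Bochner_Integration.integral_nonneg) simp
      show "norm (bform a (real l / 4) f f) \<le> C * real l powr (- \<kappa>) * ((\<integral>x. norm (f x) powr p \<partial>lborel) powr (1 / p))\<^sup>2"
      proof (cases "I = 0")
        \<comment> \<open>Normalizing is impossible here, but \<open>f\<close> vanishes almost
          everywhere and the L1 bound gives 0.\<close>
        case True
        then have "AE x in lborel. norm (f x) powr p = 0"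
          using integral_nonneg_eq_0_iff_AE[OF fp] by (simp add: I_def)
        then have "AE x in lborel. f x = 0" by eventually_elim simp
        then have "(L1_norm f) = (\<integral>x. 0 \<partial>(lborel :: 'a measure))"
          by (intro integral_cong_AE) auto
        then have "norm (bform a (real l / 4) f f) \<le> 0" using bform_L1_bound[OF a f f, of "real l / 4"] by simp
        then show ?thesis using True by (simp add: I_def)
      next
        case False
        then have Ip: "I > 0" using I0 by simp
        then have sp: "s > 0" "s powr p = I" using p1 by (auto simp: s_def powr_powr)
        let ?g = "\<lambda>x. complex_of_real (1 / s) * f x"
        have gp: "norm (?g x) powr p = norm (f x) powr p / I" for x
          using sp by (simp add: norm_divide powr_divide)
        have "norm (bform a (real l / 4) ?g ?g) \<le> C * real l powr (- \<kappa>)"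
        proof -
          have "norm (bform a (real l / 4) ?g ?g) \<le> 4 * 4 powr (?d / 2) * real l powr (- (?d * (\<theta> - \<eta>) / 2)) * (2 / (1 - 2 powr (- (\<eta> * p / 2))))"
            by (rule bform_decay_normalized[OF p1 p(2) _ _ _ a l \<theta>_def \<eta>(1,2) \<eta>0])
              (use f fp Ip in \<open>auto simp: gp I_def[symmetric] simp del: of_real_divide\<close>)
          then show ?thesis by (simp add: C_def \<kappa>_def r_def mult_ac)
        qed
        moreover have "bform a (real l / 4) f f = of_real (s\<^sup>2) * bform a (real l / 4) ?g ?g"
          unfolding bform_scale using sp by (simp add: power_divide)
        ultimately have "norm (bform a (real l / 4) f f) \<le> s\<^sup>2 * (C * real l powr (- \<kappa>))"
          by (simp add: norm_mult norm_power mult_left_mono)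
        then show ?thesis by (simp add: s_def I_def mult_ac)
      qed
    qed
  qed
qed

section \<open>Polar coordinates and Haar measure\<close>

text \<open>Half the area of the unit sphere; the half comes from the variable t = r^2, since
  r^(d-1) dr = t^(d/2-1) dt / 2.\<close>

definition radial_const :: "nat \<Rightarrow> real" where
  "radial_const d = unit_ball_vol d * d / 2"

text \<open>Both measures are compared on half-lines, whose preimages are balls. The square of the
  norm is taken as radial variable because it is an integer at lattice points.\<close>

lemma lborel_norm_square_distr:
  assumes d: "DIM('a::euclidean_space) \<ge> 2"
  shows "distr (lborel :: 'a measure) borel (\<lambda>x. (norm x)\<^sup>2) =
    density lborel (\<lambda>t. ennreal (radial_const DIM('a) * (if t > 0 then t powr (real DIM('a) / 2 - 1) else 0)))"
    (is "?L = density _ ?w")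
proof -
  let ?d = "real DIM('a)" and ?E = "range (\<lambda>t::real. {..t})"
  have L: "emeasure ?L {..t} = ennreal (if t > 0 then unit_ball_vol ?d * t powr (?d / 2) else 0)" for t
  proof -
    have "emeasure ?L {..t} = emeasure lborel ((\<lambda>x::'a. (norm x)\<^sup>2) -` {..t})"
      by (subst emeasure_distr) auto
    also have "\<dots> = ennreal (if t > 0 then unit_ball_vol ?d * t powr (?d / 2) else 0)"
    proof (cases "t > 0")
      case True
      have "(\<lambda>x::'a. (norm x)\<^sup>2) -` {..t} = cball 0 (sqrt t)"
        by (auto simp: real_le_rsqrt sqrt_le_D dist_norm) (metis norm_ge_zero real_le_rsqrt real_sqrt_le_iff real_sqrt_unique True less_imp_le power2_eq_iff_nonneg real_sqrt_ge_zero sqrt_le_D)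
      then have "emeasure lborel ((\<lambda>x::'a. (norm x)\<^sup>2) -` {..t}) = ennreal (unit_ball_vol ?d * sqrt t ^ DIM('a))"
        using True by (simp add: emeasure_cball)
      also have "sqrt t ^ DIM('a) = t powr (?d / 2)"
        using True by (simp add: powr_half_sqrt[symmetric] powr_powr powr_realpow[symmetric])
      finally show ?thesis using True by simp
    next
      case False
      have "(\<lambda>x::'a. (norm x)\<^sup>2) -` {..t} \<subseteq> {0}"
        using False by (auto simp: not_less) (smt (verit) norm_eq_zero zero_eq_power2 zero_le_power2)
      then have "emeasure lborel ((\<lambda>x::'a. (norm x)\<^sup>2) -` {..t}) \<le> emeasure lborel {0::'a}" by (intro emeasure_mono) auto
      then show ?thesis using False by simp
    qed
    finally show ?thesis .
  qed
  have R: "emeasure (density lborel ?w) {..t} = ennreal (if t > 0 then unit_ball_vol ?d * t powr (?d / 2) else 0)" for t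
  proof -
    have "emeasure (density lborel ?w) {..t} = (\<integral>\<^sup>+s. ?w s * indicator {..t} s \<partial>lborel)"
      by (subst emeasure_density) auto
    also have "\<dots> = (\<integral>\<^sup>+s. ennreal (radial_const DIM('a) * (indicator {0..t} s *\<^sub>R (s powr (?d / 2 - 1)))) \<partial>lborel)"
    proof (rule nn_integral_cong)
      fix s :: real
      \<comment> \<open>In \<open>powr\<close> every power of 0 is 0, so the two densities agree at
        the endpoint too.\<close>
      have "(0::real) powr (?d / 2 - 1) = 0" by simp
      then show "?w s * indicator {..t} s = ennreal (radial_const DIM('a) * (indicator {0..t} s *\<^sub>R (s powr (?d / 2 - 1))))"
        by (cases "s = 0") (auto split: split_indicator)
    qed
    also have "\<dots> = ennreal (if t > 0 then unit_ball_vol ?d * t powr (?d / 2) else 0)"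
    proof (cases "t > 0")
      case True
      have "?d / 2 - 1 > -1" using d by simp
      from has_integral_powr_from_0[OF this, of t]
      have "((\<lambda>s. s powr (?d / 2 - 1)) has_integral (t powr (?d / 2) / (?d / 2))) {0..t}" using True by simp
      then have "((\<lambda>s. radial_const DIM('a) * s powr (?d / 2 - 1)) has_integral (radial_const DIM('a) * (t powr (?d / 2) / (?d / 2)))) {0..t}"
        by (rule has_integral_mult_right)
      then have "(\<integral>\<^sup>+s. ennreal (indicator {0..t} s * (radial_const DIM('a) * s powr (?d / 2 - 1))) \<partial>lborel) = radial_const DIM('a) * (t powr (?d / 2) / (?d / 2))"
        by (intro nn_integral_has_integral_lebesgue) (auto simp: radial_const_def)
      also have "(\<integral>\<^sup>+s. ennreal (indicator {0..t} s * (radial_const DIM('a) * s powr (?d / 2 - 1))) \<partial>lborel) = (\<integral>\<^sup>+s. ennreal (radial_const DIM('a) * (indicator {0..t} s *\<^sub>R (s powr (?d / 2 - 1)))) \<partial>lborel)"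
        by (intro nn_integral_cong) (auto split: split_indicator)
      finally show ?thesis using True d by (simp add: radial_const_def)
    next
      case False
      then have "ennreal (radial_const DIM('a) * (indicator {0..t} s *\<^sub>R (s powr (?d / 2 - 1)))) = 0" for s
        by (cases "s = 0") (auto split: split_indicator)
      then show ?thesis using False by simp
    qed
    finally show ?thesis .
  qed
  show ?thesis
  proof (rule measure_eqI_generator_eq[where \<Omega> = UNIV and E = ?E and A = "\<lambda>n. {..real n}"])
    show "Int_stable ?E" by (auto simp: Int_stable_def)
    show "sets ?L = sigma_sets UNIV ?E" by (simp add: borel_eq_atMost)
    show "sets (density lborel ?w) = sigma_sets UNIV ?E" by (simp add: borel_eq_atMost)
    show "(\<Union>n. {..real n}) = (UNIV :: real set)" using real_arch_simple by auto
    show "emeasure ?L X = emeasure (density lborel ?w) X" if "X \<in> ?E" for X using that L R by auto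
    show "emeasure ?L {..real n} \<noteq> \<infinity>" for n by (simp add: L)
  qed auto
qed

lemma nn_integral_norm_square:
  fixes g :: "real \<Rightarrow> ennreal"
  assumes d: "DIM('a::euclidean_space) \<ge> 2" and [measurable]: "g \<in> borel_measurable borel"
  shows "(\<integral>\<^sup>+x. g ((norm (x::'a))\<^sup>2) \<partial>lborel) =
     (\<integral>\<^sup>+t. ennreal (radial_const DIM('a) * (if t > 0 then t powr (real DIM('a) / 2 - 1) else 0)) * g t \<partial>lborel)"
proof -
  have "(\<integral>\<^sup>+x. g ((norm (x::'a))\<^sup>2) \<partial>lborel) = (\<integral>\<^sup>+t. g t \<partial>distr (lborel :: 'a measure) borel (\<lambda>x. (norm x)\<^sup>2))"
    by (subst nn_integral_distr) auto
  then show ?thesis unfolding lborel_norm_square_distr[OF d] by (subst (asm) nn_integral_density) auto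
qed

text \<open>A translation-invariant measure is determined up to a factor, and the unit ball, which
  \<open>T\<close> preserves, fixes the factor. Concretely, integrating the indicators of the ball
  at y and of \<open>A\<close> at T x + y in both orders compares the two measures without computing
  a determinant.\<close>

lemma lborel_distr_orthogonal:
  fixes T :: "'a::euclidean_space \<Rightarrow> 'a"
  assumes T: "orthogonal_transformation T"
  shows "distr lborel borel T = lborel"
proof (rule measure_eqI)
  define S where "S = inv T"
  have lin: "linear T" using T by (rule orthogonal_transformation_linear)
  have TS: "T (S y) = y" for y
    unfolding S_def by (rule surj_f_inv_f[OF orthogonal_transformation_surj[OF T]])
  have [measurable]: "T \<in> borel_measurable borel"
    using lin by (intro borel_measurable_continuous_onI linear_continuous_on) (simp add: linear_conv_bounded_linear)
  have "orthogonal_transformation S" unfolding S_def by (rule orthogonal_transformation_inv[OF T])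
  then have "linear S" by (rule orthogonal_transformation_linear)
  then have [measurable]: "S \<in> borel_measurable borel"
    by (intro borel_measurable_continuous_onI linear_continuous_on) (simp add: linear_conv_bounded_linear)
  fix A :: "'a set" assume "A \<in> sets (distr lborel borel T)"
  then have [measurable]: "A \<in> sets borel" by simp
  let ?I = "indicator :: 'a set \<Rightarrow> 'a \<Rightarrow> ennreal" and ?B = "cball 0 1 :: 'a set"
  have [measurable]: "?B \<in> sets borel" by simp
  have "emeasure lborel (T -` A) * emeasure lborel ?B = (\<integral>\<^sup>+y. ?I ?B y * (\<integral>\<^sup>+x. ?I A (T x) \<partial>lborel) \<partial>lborel)"
  proof -
    have "T -` A \<inter> space borel \<in> sets borel" by measurable
    then have "emeasure lborel (T -` A) = (\<integral>\<^sup>+x. ?I (T -` A) x \<partial>lborel)" by simp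
    also have "\<dots> = (\<integral>\<^sup>+x. ?I A (T x) \<partial>lborel)" by (intro nn_integral_cong) (auto split: split_indicator)
    finally have "(\<integral>\<^sup>+x. ?I A (T x) \<partial>lborel) = emeasure lborel (T -` A)" by simp
    then show ?thesis by (simp add: mult.commute[of "indicator _ _"] nn_integral_cmult_indicator)
  qed
  also have "\<dots> = (\<integral>\<^sup>+y. (\<integral>\<^sup>+x. ?I ?B y * ?I A (T x + y) \<partial>lborel) \<partial>lborel)"
  proof (rule nn_integral_cong)
    fix y
    have "(\<integral>\<^sup>+x. ?I A (T x) \<partial>lborel) = (\<integral>\<^sup>+x. ?I A (T (S y + x)) \<partial>lborel)"
      by (rule nn_integral_translation[symmetric]) measurable
    then show "?I ?B y * (\<integral>\<^sup>+x. ?I A (T x) \<partial>lborel) = (\<integral>\<^sup>+x. ?I ?B y * ?I A (T x + y) \<partial>lborel)"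
      by (simp add: linear_add[OF lin] TS add.commute nn_integral_cmult)
  qed
  also have "\<dots> = (\<integral>\<^sup>+x. (\<integral>\<^sup>+y. ?I ?B y * ?I A (T x + y) \<partial>lborel) \<partial>lborel)"
    by (rule lborel_pair.Fubini') measurable
  also have "\<dots> = (\<integral>\<^sup>+x. (\<integral>\<^sup>+y. ?I ?B (y - T x) * ?I A y \<partial>lborel) \<partial>lborel)"
  proof (rule nn_integral_cong)
    fix x
    have "(\<integral>\<^sup>+y. ?I ?B (y - T x) * ?I A y \<partial>lborel) = (\<integral>\<^sup>+y. ?I ?B ((T x + y) - T x) * ?I A (T x + y) \<partial>lborel)"
      by (rule nn_integral_translation[symmetric]) measurable
    then show "(\<integral>\<^sup>+y. ?I ?B y * ?I A (T x + y) \<partial>lborel) = (\<integral>\<^sup>+y. ?I ?B (y - T x) * ?I A y \<partial>lborel)" by simp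
  qed
  also have "\<dots> = (\<integral>\<^sup>+y. (\<integral>\<^sup>+x. ?I ?B (y - T x) * ?I A y \<partial>lborel) \<partial>lborel)"
    by (rule lborel_pair.Fubini') measurable
  also have "\<dots> = (\<integral>\<^sup>+y. emeasure lborel ?B * ?I A y \<partial>lborel)"
  proof (rule nn_integral_cong)
    fix y
    have "?I ?B (y - T x) = ?I ?B (- S y + x)" for x
    proof -
      have "norm (y - T x) = norm (T (S y - x))" by (simp add: linear_diff[OF lin] TS)
      also have "\<dots> = norm (S y - x)" by (rule orthogonal_transformation_norm[OF T])
      finally show ?thesis by (auto split: split_indicator simp: norm_minus_commute)
    qed
    then have "(\<integral>\<^sup>+x. ?I ?B (y - T x) \<partial>lborel) = (\<integral>\<^sup>+x. ?I ?B (- S y + x) \<partial>lborel)" by simp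
    also have "\<dots> = (\<integral>\<^sup>+x. ?I ?B x \<partial>lborel)" by (rule nn_integral_translation) measurable
    also have "\<dots> = emeasure lborel ?B" by simp
    finally show "(\<integral>\<^sup>+x. ?I ?B (y - T x) * ?I A y \<partial>lborel) = emeasure lborel ?B * ?I A y"
      by (simp add: nn_integral_multc)
  qed
  also have "\<dots> = emeasure lborel A * emeasure lborel ?B" by (subst nn_integral_cmult_indicator) (auto simp: mult.commute)
  finally have "emeasure lborel ?B * emeasure lborel (T -` A) = emeasure lborel ?B * emeasure lborel A" by (simp add: mult.commute)
  moreover have "emeasure lborel ?B \<noteq> 0" "emeasure lborel ?B \<noteq> top"
  proof -
    have "unit_ball_vol (real DIM('a)) \<noteq> 0" using unit_ball_vol_pos[of "real DIM('a)"] by linarith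
    then show "emeasure lborel ?B \<noteq> 0" "emeasure lborel ?B \<noteq> top" by (simp_all add: emeasure_cball)
  qed
  ultimately have "emeasure lborel (T -` A) = emeasure lborel A" by (simp add: ennreal_mult_cancel_left)
  then show "emeasure (distr lborel borel T) A = emeasure lborel A" by (simp add: emeasure_distr)
qed simp

section \<open>Rotations and Haar averages\<close>

lemma continuous_on_matrix_mult [continuous_intros]:
  fixes f g :: "'a::topological_space \<Rightarrow> real^'n^'n"
  assumes "continuous_on S f" "continuous_on S g"
  shows "continuous_on S (\<lambda>x. f x ** g x)"
  unfolding matrix_matrix_mult_def by (intro continuous_intros assms)

lemma continuous_on_matrix_vector_mult' [continuous_intros]:
  fixes f :: "'a::topological_space \<Rightarrow> real^'n^'n" and g :: "'a \<Rightarrow> real^'n"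
  assumes "continuous_on S f" "continuous_on S g"
  shows "continuous_on S (\<lambda>x. f x *v g x)"
  unfolding matrix_vector_mult_def by (intro continuous_intros assms)

lemma continuous_on_transpose [continuous_intros]:
  fixes f :: "'a::topological_space \<Rightarrow> real^'n^'n"
  assumes "continuous_on S f"
  shows "continuous_on S (\<lambda>x. transpose (f x))"
  unfolding transpose_def by (intro continuous_intros assms)

lemma measurable_matrix_mult [measurable (raw)]:
  fixes f g :: "'a \<Rightarrow> real^'n^'n"
  assumes "f \<in> borel_measurable M" "g \<in> borel_measurable M"
  shows "(\<lambda>x. f x ** g x) \<in> borel_measurable M"
  by (rule borel_measurable_continuous_Pair[OF assms]) (intro continuous_intros)

lemma measurable_matrix_vector_mult [measurable (raw)]:
  fixes f :: "'a \<Rightarrow> real^'n^'n" and g :: "'a \<Rightarrow> real^'n"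
  assumes "f \<in> borel_measurable M" "g \<in> borel_measurable M"
  shows "(\<lambda>x. f x *v g x) \<in> borel_measurable M"
  by (rule borel_measurable_continuous_Pair[OF assms]) (intro continuous_intros)

lemma measurable_transpose [measurable]: "(transpose :: real^'n^'n \<Rightarrow> _) \<in> borel_measurable borel"
  by (intro borel_measurable_continuous_onI continuous_intros)

lemma SO_transpose: "\<rho> \<in> SO \<Longrightarrow> transpose \<rho> \<in> SO"
  by (auto simp: SO_def orthogonal_matrix_def)

lemma SO_mult: "\<rho> \<in> SO \<Longrightarrow> \<sigma> \<in> SO \<Longrightarrow> \<rho> ** \<sigma> \<in> SO"
  by (auto simp: SO_def orthogonal_matrix_mul det_mul)

lemma SO_orthogonal_transformation: "\<rho> \<in> SO \<Longrightarrow> orthogonal_transformation ((*v) \<rho>)"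
  by (simp add: SO_def orthogonal_transformation_matrix)

lemma SO_norm: "\<rho> \<in> SO \<Longrightarrow> norm (\<rho> *v x) = norm x"
  by (rule orthogonal_transformation_norm[OF SO_orthogonal_transformation])

lemma SO_inner: "\<rho> \<in> SO \<Longrightarrow> (\<rho> *v x) \<bullet> (\<rho> *v y) = x \<bullet> y"
  using SO_orthogonal_transformation[of \<rho>] by (simp add: orthogonal_transformation_def)

locale haar =
  fixes \<mu> :: "(real^'n^'n) measure"
  assumes haar: "haar_SO \<mu>"
begin

sublocale prob_space \<mu>
  using haar by (simp add: haar_SO_def)

lemma sets_haar: "sets \<mu> = sets (restrict_space borel (SO :: (real^'n^'n) set))"
  using haar by (simp add: haar_SO_def)

lemma space_haar: "space \<mu> = SO"
  using sets_eq_imp_space_eq[OF sets_haar] by (simp add: space_restrict_space)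

lemma measurable_haar [measurable (raw)]: "f \<in> measurable borel M \<Longrightarrow> f \<in> measurable \<mu> M"
  by (subst measurable_cong_sets[OF sets_haar refl]) (rule measurable_restrict_space1)

lemma id_haar_measurable [measurable]: "(\<lambda>x. x) \<in> measurable \<mu> borel"
  by (rule measurable_haar) simp

lemma measurable_into_haar:
  assumes "f \<in> borel_measurable M" "\<And>x. x \<in> space M \<Longrightarrow> f x \<in> SO"
  shows "f \<in> measurable M \<mu>"
  by (subst measurable_cong_sets[OF refl sets_haar]) (rule measurable_restrict_space2, use assms in auto)

lemma haar_left:
  fixes h :: "real^'n^'n \<Rightarrow> ennreal"
  assumes \<sigma>: "\<sigma> \<in> SO" and [measurable]: "h \<in> borel_measurable borel"
  shows "(\<integral>\<^sup>+\<rho>. h (\<sigma> ** \<rho>) \<partial>\<mu>) = (\<integral>\<^sup>+\<rho>. h \<rho> \<partial>\<mu>)"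
proof -
  have m: "(\<lambda>\<rho>. \<sigma> ** \<rho>) \<in> measurable \<mu> \<mu>"
    by (rule measurable_into_haar) (use SO_mult[OF \<sigma>] in \<open>auto simp: space_haar\<close>)
  have "distr \<mu> \<mu> (\<lambda>\<rho>. \<sigma> ** \<rho>) = \<mu>"
  proof (rule measure_eqI)
    fix A assume "A \<in> sets (distr \<mu> \<mu> (\<lambda>\<rho>. \<sigma> ** \<rho>))"
    then have A: "A \<in> sets \<mu>" by simp
    then show "emeasure (distr \<mu> \<mu> (\<lambda>\<rho>. \<sigma> ** \<rho>)) A = emeasure \<mu> A"
      using haar \<sigma> by (subst emeasure_distr[OF m]) (auto simp: haar_SO_def space_haar)
  qed simp
  then show ?thesis
    using nn_integral_distr[OF m, of h] by simp
qed

text \<open>Left invariance alone is assumed; integrating \<open>h (\<rho>\<^sup>T \<tau>)\<close> over both variables in either order shows that the mean is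
  invariant under transposition, which exchanges left and right translations.\<close>
lemma haar_right:
  fixes h :: "real^'n^'n \<Rightarrow> ennreal"
  assumes \<sigma>: "\<sigma> \<in> SO" and [measurable]: "h \<in> borel_measurable borel"
  shows "(\<integral>\<^sup>+\<rho>. h (\<rho> ** \<sigma>) \<partial>\<mu>) = (\<integral>\<^sup>+\<rho>. h \<rho> \<partial>\<mu>)"
proof -
  interpret pair_sigma_finite \<mu> \<mu> by standard
  have inv: "(\<integral>\<^sup>+\<rho>. h \<rho> \<partial>\<mu>) = (\<integral>\<^sup>+\<rho>. h (transpose \<rho>) \<partial>\<mu>)" if [measurable]: "h \<in> borel_measurable borel" for h
  proof -
    have "(\<integral>\<^sup>+\<rho>. h \<rho> \<partial>\<mu>) = (\<integral>\<^sup>+\<rho>. (\<integral>\<^sup>+\<tau>. h \<tau> \<partial>\<mu>) \<partial>\<mu>)" by (simp add: emeasure_space_1)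
    also have "\<dots> = (\<integral>\<^sup>+\<rho>. (\<integral>\<^sup>+\<tau>. h (transpose \<rho> ** \<tau>) \<partial>\<mu>) \<partial>\<mu>)"
      by (intro nn_integral_cong haar_left[symmetric]) (auto simp: space_haar intro: SO_transpose)
    also have "\<dots> = (\<integral>\<^sup>+\<tau>. (\<integral>\<^sup>+\<rho>. h (transpose \<rho> ** \<tau>) \<partial>\<mu>) \<partial>\<mu>)"
      by (rule Fubini'[symmetric]) measurable
    also have "\<dots> = (\<integral>\<^sup>+\<tau>. (\<integral>\<^sup>+\<rho>. h (transpose (transpose \<tau> ** \<rho>)) \<partial>\<mu>) \<partial>\<mu>)"
      by (simp add: matrix_transpose_mul)
    also have "\<dots> = (\<integral>\<^sup>+\<tau>. (\<integral>\<^sup>+\<rho>. h (transpose \<rho>) \<partial>\<mu>) \<partial>\<mu>)"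
      by (intro nn_integral_cong haar_left[where h = "\<lambda>\<rho>. h (transpose \<rho>)"]) (auto simp: space_haar intro: SO_transpose)
    also have "\<dots> = (\<integral>\<^sup>+\<rho>. h (transpose \<rho>) \<partial>\<mu>)" by (simp add: emeasure_space_1)
    finally show ?thesis .
  qed
  have "(\<integral>\<^sup>+\<rho>. h (\<rho> ** \<sigma>) \<partial>\<mu>) = (\<integral>\<^sup>+\<rho>. h (transpose \<rho> ** \<sigma>) \<partial>\<mu>)"
    by (rule inv) measurable
  also have "\<dots> = (\<integral>\<^sup>+\<rho>. h (transpose (transpose \<sigma> ** \<rho>)) \<partial>\<mu>)"
    by (simp add: matrix_transpose_mul)
  also have "\<dots> = (\<integral>\<^sup>+\<rho>. h (transpose \<rho>) \<partial>\<mu>)"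
    by (rule haar_left[where h = "\<lambda>\<rho>. h (transpose \<rho>)"]) (use SO_transpose[OF \<sigma>] in auto)
  also have "\<dots> = (\<integral>\<^sup>+\<rho>. h \<rho> \<partial>\<mu>)" by (rule inv[symmetric]) measurable
  finally show ?thesis .
qed

text \<open>From dimension 2 on some rotation carries x to y. It multiplies \<rho> from the right,
  which is where right invariance is needed.\<close>

lemma haar_radial:
  fixes F :: "real^'n \<Rightarrow> ennreal"
  assumes card: "CARD('n) \<ge> 2" and xy: "norm x = norm y" and [measurable]: "F \<in> borel_measurable borel"
  shows "(\<integral>\<^sup>+\<rho>. F (\<rho> *v x) \<partial>\<mu>) = (\<integral>\<^sup>+\<rho>. F (\<rho> *v y) \<partial>\<mu>)"
proof -
  obtain T where T: "orthogonal_transformation T" "det (matrix T) = 1" "T x = y"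
    using rotation_exists[OF card xy] .
  have \<sigma>: "matrix T \<in> SO"
    using T by (simp add: SO_def orthogonal_transformation_matrix)
  have "y = matrix T *v x" by (simp add: matrix_works orthogonal_transformation_linear T)
  then have "(\<integral>\<^sup>+\<rho>. F (\<rho> *v y) \<partial>\<mu>) = (\<integral>\<^sup>+\<rho>. F ((\<rho> ** matrix T) *v x) \<partial>\<mu>)"
    by (simp add: matrix_vector_mul_assoc)
  also have "\<dots> = (\<integral>\<^sup>+\<rho>. F (\<rho> *v x) \<partial>\<mu>)"
    by (rule haar_right[OF \<sigma>]) measurable
  finally show ?thesis by simp
qed

text \<open>The Haar mean over the orbit of one unit vector plays the part of normalized surface
  measure. Rotation invariance of Lebesgue measure allows averaging over \<rho>; after the exchange
  of integrals the inner mean depends on the norm alone.\<close>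

lemma nn_integral_polar:
  fixes F :: "real^'n \<Rightarrow> ennreal" and w :: "real \<Rightarrow> ennreal"
  assumes card: "CARD('n) \<ge> 2" and e: "norm e = 1"
    and [measurable]: "F \<in> borel_measurable borel" "w \<in> borel_measurable borel"
  shows "(\<integral>\<^sup>+\<xi>. F \<xi> * w ((norm \<xi>)\<^sup>2) \<partial>lborel) =
    (\<integral>\<^sup>+t. ennreal (radial_const CARD('n) * (if t > 0 then t powr (real CARD('n) / 2 - 1) else 0)) * (w t * (\<integral>\<^sup>+\<rho>. F (\<rho> *v (sqrt t *\<^sub>R e)) \<partial>\<mu>)) \<partial>lborel)"
proof -
  interpret pair_sigma_finite \<mu> "lborel :: (real^'n) measure" by standard
  have "(\<integral>\<^sup>+\<xi>. F \<xi> * w ((norm \<xi>)\<^sup>2) \<partial>lborel) = (\<integral>\<^sup>+\<rho>. (\<integral>\<^sup>+\<xi>. F \<xi> * w ((norm \<xi>)\<^sup>2) \<partial>lborel) \<partial>\<mu>)"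
    by (simp add: emeasure_space_1)
  also have "\<dots> = (\<integral>\<^sup>+\<rho>. (\<integral>\<^sup>+\<xi>. F (\<rho> *v \<xi>) * w ((norm \<xi>)\<^sup>2) \<partial>lborel) \<partial>\<mu>)"
  proof (rule nn_integral_cong)
    fix \<rho> assume "\<rho> \<in> space \<mu>"
    then have \<rho>: "\<rho> \<in> SO" by (simp add: space_haar)
    have "(\<integral>\<^sup>+\<xi>. F \<xi> * w ((norm \<xi>)\<^sup>2) \<partial>lborel) = (\<integral>\<^sup>+\<xi>. F \<xi> * w ((norm \<xi>)\<^sup>2) \<partial>distr lborel borel ((*v) \<rho>))"
      by (simp only: lborel_distr_orthogonal[OF SO_orthogonal_transformation[OF \<rho>]])
    also have "\<dots> = (\<integral>\<^sup>+\<xi>. F (\<rho> *v \<xi>) * w ((norm \<xi>)\<^sup>2) \<partial>lborel)"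
      by (subst nn_integral_distr) (auto simp: SO_norm[OF \<rho>])
    finally show "(\<integral>\<^sup>+\<xi>. F \<xi> * w ((norm \<xi>)\<^sup>2) \<partial>lborel) = (\<integral>\<^sup>+\<xi>. F (\<rho> *v \<xi>) * w ((norm \<xi>)\<^sup>2) \<partial>lborel)" .
  qed
  also have "\<dots> = (\<integral>\<^sup>+\<xi>. (\<integral>\<^sup>+\<rho>. F (\<rho> *v \<xi>) * w ((norm \<xi>)\<^sup>2) \<partial>\<mu>) \<partial>lborel)"
    by (rule Fubini'[symmetric]) measurable
  also have "\<dots> = (\<integral>\<^sup>+\<xi>. w ((norm (\<xi> :: real^'n))\<^sup>2) * (\<integral>\<^sup>+\<rho>. F (\<rho> *v (sqrt ((norm \<xi>)\<^sup>2) *\<^sub>R e)) \<partial>\<mu>) \<partial>lborel)"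
  proof (rule nn_integral_cong)
    fix \<xi> :: "real^'n"
    have "(\<integral>\<^sup>+\<rho>. F (\<rho> *v \<xi>) \<partial>\<mu>) = (\<integral>\<^sup>+\<rho>. F (\<rho> *v (sqrt ((norm \<xi>)\<^sup>2) *\<^sub>R e)) \<partial>\<mu>)"
      by (rule haar_radial[OF card]) (auto simp: e)
    then show "(\<integral>\<^sup>+\<rho>. F (\<rho> *v \<xi>) * w ((norm \<xi>)\<^sup>2) \<partial>\<mu>) = w ((norm \<xi>)\<^sup>2) * (\<integral>\<^sup>+\<rho>. F (\<rho> *v (sqrt ((norm \<xi>)\<^sup>2) *\<^sub>R e)) \<partial>\<mu>)"
      by (subst nn_integral_multc) (auto simp: mult.commute)
  qed
  also have "\<dots> = (\<integral>\<^sup>+t. ennreal (radial_const CARD('n) * (if t > 0 then t powr (real CARD('n) / 2 - 1) else 0)) * (w t * (\<integral>\<^sup>+\<rho>. F (\<rho> *v (sqrt t *\<^sub>R e)) \<partial>\<mu>)) \<partial>lborel)"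
    by (subst nn_integral_norm_square[where g = "\<lambda>t. w t * (\<integral>\<^sup>+\<rho>. F (\<rho> *v (sqrt t *\<^sub>R e)) \<partial>\<mu>)"]) (use card in \<open>auto cong: if_cong\<close>)
  finally show ?thesis .
qed

end

section \<open>Sampling with Fejer kernels\<close>

text \<open>The sum over |l| < N of (1 - |l|/N) cis(l \<theta>), in the form that shows it to be
  nonnegative. For N = 0 division by zero makes it 0.\<close>

definition fejer :: "nat \<Rightarrow> real \<Rightarrow> real" where
  "fejer N \<theta> = (norm (\<Sum>a<N. cis (real a * \<theta>)))\<^sup>2 / real N"

lemma fejer_nonneg [simp]: "fejer N \<theta> \<ge> 0"
  by (simp add: fejer_def)

lemma continuous_on_fejer [continuous_intros]: "continuous_on S f \<Longrightarrow> continuous_on S (\<lambda>x. fejer N (f x))"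
  unfolding fejer_def by (cases "N = 0") (auto intro!: continuous_intros)

lemma fejer_measurable [measurable]: "fejer N \<in> borel_measurable borel"
  by (intro borel_measurable_continuous_onI continuous_intros)

lemma fejer_double_sum:
  "complex_of_real (fejer N \<theta>) = (\<Sum>a<N. \<Sum>b<N. cis ((real a - real b) * \<theta>)) / of_nat N"
proof -
  have "complex_of_real ((norm (\<Sum>a<N. cis (real a * \<theta>)))\<^sup>2) = (\<Sum>a<N. cis (real a * \<theta>)) * cnj (\<Sum>a<N. cis (real a * \<theta>))"
    by (rule complex_norm_square)
  also have "\<dots> = (\<Sum>a<N. \<Sum>b<N. cis ((real a - real b) * \<theta>))"
    by (simp add: sum_product cis_cnj cis_mult left_diff_distrib)
  finally show ?thesis by (simp add: fejer_def)
qed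

lemma fejer_cos_sum: "fejer N \<theta> = (\<Sum>a<N. \<Sum>b<N. cos ((real a - real b) * \<theta>)) / real N"
  using arg_cong[OF fejer_double_sum[of N \<theta>], of Re] by simp

lemma fejer_period: "fejer N (\<theta> + 2 * pi * real j) = fejer N \<theta>"
proof -
  have "cis (real a * (\<theta> + 2 * pi * real j)) = cis (real a * \<theta>)" for a :: nat
  proof -
    have "cis (real a * (\<theta> + 2 * pi * real j)) = cis (real a * \<theta>) * cis (2 * pi * real (a * j))"
      by (simp add: cis_mult algebra_simps)
    also have "cis (2 * pi * real (a * j)) = 1" by (rule cis_multiple_2pi) simp
    finally show ?thesis by simp
  qed
  then show ?thesis by (simp add: fejer_def)
qed

lemma fejer_bound:
  assumes "cis \<theta> \<noteq> 1"
  shows "fejer N \<theta> \<le> 4 / (2 - 2 * cos \<theta>) / real N"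
proof -
  have sq: "(norm (1 - cis \<theta>))\<^sup>2 = 2 - 2 * cos \<theta>"
    by (simp add: cmod_power2 power2_diff)
  have "(\<Sum>a<N. cis (real a * \<theta>)) = (\<Sum>a<N. cis \<theta> ^ a)" by (intro sum.cong refl) (rule Complex.DeMoivre[symmetric])
  also have "\<dots> = (1 - cis \<theta> ^ N) / (1 - cis \<theta>)" using assms by (simp add: sum_gp_strict)
  finally have "norm (\<Sum>a<N. cis (real a * \<theta>)) = norm (1 - cis \<theta> ^ N) / norm (1 - cis \<theta>)" by (simp add: norm_divide)
  also have "\<dots> \<le> 2 / norm (1 - cis \<theta>)"
    using norm_triangle_ineq4[of 1 "cis \<theta> ^ N"] by (intro divide_right_mono) (auto simp: norm_power)
  finally have "(norm (\<Sum>a<N. cis (real a * \<theta>)))\<^sup>2 \<le> (2 / norm (1 - cis \<theta>))\<^sup>2" by (intro power_mono) auto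
  also have "\<dots> = 4 / (2 - 2 * cos \<theta>)" by (simp add: power_divide sq)
  finally show ?thesis unfolding fejer_def by (intro divide_right_mono) auto
qed

text \<open>In the scaled variable the period is 8, the spacing of the progression 4 mod 8. Only the
  N diagonal terms of the double sum survive integration over a period.\<close>

lemma fejer_integral:
  assumes N: "N > 0"
  shows "((\<lambda>t. fejer N (pi * (t - c) / 4)) has_integral 8) {c - 4..c + 4}"
proof -
  have trm: "((\<lambda>t. cos ((real a - real b) * (pi * (t - c) / 4))) has_integral (if a = b then 8 else 0)) {c - 4..c + 4}" for a b :: nat
  proof (cases "a = b")
    case True
    then show ?thesis using has_integral_const_real[of "1::real" "c - 4" "c + 4"] by simp
  next
    case False
    define k where "k = (real a - real b) * pi / 4"
    have k: "k \<noteq> 0" using False by (simp add: k_def)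
    have "((\<lambda>t. cos (k * (t - c))) has_integral (sin (k * (c + 4 - c)) / k - sin (k * (c - 4 - c)) / k)) {c - 4..c + 4}"
    proof (rule fundamental_theorem_of_calculus)
      fix x
      show "((\<lambda>t. sin (k * (t - c)) / k) has_vector_derivative cos (k * (x - c))) (at x within {c - 4..c + 4})"
        unfolding has_real_derivative_iff_has_vector_derivative[symmetric]
        by (auto intro!: derivative_eq_intros simp: k)
    qed simp
    moreover have s4: "sin (k * 4) = 0"
    proof -
      have "k * 4 = of_int (int a - int b) * pi" by (simp add: k_def)
      then show ?thesis by (simp only: sin_zero_iff_int2) blast
    qed
    moreover have "sin (k * (c + 4 - c)) = 0" "sin (k * (c - 4 - c)) = 0"
      using s4 by simp_all
    ultimately have int0: "((\<lambda>t. cos (k * (t - c))) has_integral 0) {c - 4..c + 4}" by simp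
    have eq: "(real a - real b) * (pi * (t - c) / 4) = k * (t - c)" for t by (simp add: k_def)
    show ?thesis unfolding eq using False int0 by simp
  qed
  have "((\<lambda>t. (\<Sum>a<N. \<Sum>b<N. cos ((real a - real b) * (pi * (t - c) / 4))) / real N) has_integral (\<Sum>a<N. \<Sum>b<N. if a = b then 8 else 0) / real N) {c - 4..c + 4}"
    by (intro has_integral_divide has_integral_sum trm) auto
  moreover have "(\<Sum>a<N. \<Sum>b<N. if a = b then 8 else (0::real)) = 8 * real N" by simp
  ultimately show ?thesis using N by (simp add: fejer_cos_sum)
qed

lemma fejer_approximate_identity:
  fixes H :: "real \<Rightarrow> real"
  assumes H: "continuous_on UNIV H" and M: "\<And>t. t \<in> {c - 4..c + 4} \<Longrightarrow> \<bar>H t\<bar> \<le> M"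
  shows "(\<lambda>N. integral {c - 4..c + 4} (\<lambda>t. H t * fejer (Suc N) (pi * (t - c) / 4))) \<longlonglongrightarrow> 8 * H c"
proof (rule LIMSEQ_I)
  let ?K = "\<lambda>N t. fejer (Suc N) (pi * (t - c) / 4)" and ?I = "{c - 4..c + 4}"
  have cont: "continuous_on S H" for S using H continuous_on_subset by blast
  have KI: "?K N integrable_on ?I" for N using fejer_integral[of "Suc N" c] by (auto simp: integrable_on_def)
  have HKI: "(\<lambda>t. H t * ?K N t) integrable_on ?I" for N
    by (intro integrable_continuous_real continuous_intros cont) auto
  have Kval: "integral ?I (?K N) = 8" for N using fejer_integral[of "Suc N" c] by (intro integral_unique) simp
  have M0: "M \<ge> 0" using M[of c] by simp
  fix e :: real assume e: "e > 0"
  have "isCont H c" using H by (simp add: continuous_on_eq_continuous_at)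
  then have "\<exists>\<delta>>0. \<forall>t. dist t c < \<delta> \<longrightarrow> dist (H t) (H c) < e / 16"
    unfolding continuous_at_eps_delta using divide_pos_pos[OF e, of 16] by (elim allE[of _ "e / 16"]) simp
  then obtain \<delta> where \<delta>: "\<delta> > 0" "\<And>t. \<bar>t - c\<bar> < \<delta> \<Longrightarrow> \<bar>H t - H c\<bar> < e / 16"
    unfolding dist_real_def by blast
  \<comment> \<open>The cap at 4 keeps the angles in [0, pi], where cosine decreases, so the kernel
    is uniformly small away from the centre.\<close>
  define \<delta>' where "\<delta>' = min \<delta> 4"
  have \<delta>': "0 < \<delta>'" "\<delta>' \<le> 4" "\<delta>' \<le> \<delta>" using \<delta> by (auto simp: \<delta>'_def)
  define q where "q = 2 - 2 * cos (pi * \<delta>' / 4)"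
  have "cos (pi * \<delta>' / 4) < cos 0" using \<delta>' by (intro cos_monotone_0_pi) (auto simp: field_simps)
  then have q: "q > 0" by (simp add: q_def)
  have far: "?K N t \<le> 4 / q / real (Suc N)" if t: "t \<in> ?I" "\<bar>t - c\<bar> \<ge> \<delta>'" for N t
  proof -
    have "pi * \<bar>t - c\<bar> / 4 = \<bar>pi * (t - c) / 4\<bar>" by (simp add: abs_mult)
    then have "cos (pi * (t - c) / 4) = cos (pi * \<bar>t - c\<bar> / 4)" by (simp only: cos_abs_real)
    also have "\<dots> \<le> cos (pi * \<delta>' / 4)"
      using t \<delta>' by (intro cos_monotone_0_pi_le) (auto simp: field_simps abs_if split: if_splits)
    finally have c1: "2 - 2 * cos (pi * (t - c) / 4) \<ge> q" by (simp add: q_def)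
    then have "cis (pi * (t - c) / 4) \<noteq> 1" using q by (auto simp: complex_eq_iff)
    from fejer_bound[OF this, of "Suc N"] have "?K N t \<le> 4 / (2 - 2 * cos (pi * (t - c) / 4)) / real (Suc N)" .
    also have "\<dots> \<le> 4 / q / real (Suc N)" using c1 q by (intro divide_right_mono divide_left_mono) auto
    finally show ?thesis .
  qed
  have main: "\<bar>integral ?I (\<lambda>t. H t * ?K N t) - 8 * H c\<bar> \<le> e / 2 + 64 * M / q / real (Suc N)" for N
  proof -
    have "8 * H c = integral ?I (\<lambda>t. H c * ?K N t)" using Kval[of N] by (simp add: integral_mult_right)
    then have "integral ?I (\<lambda>t. H t * ?K N t) - 8 * H c = integral ?I (\<lambda>t. H t * ?K N t) - integral ?I (\<lambda>t. H c * ?K N t)" by simp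
    also have "\<dots> = integral ?I (\<lambda>t. H t * ?K N t - H c * ?K N t)"
      by (rule Henstock_Kurzweil_Integration.integral_diff[symmetric, OF HKI integrable_on_mult_right[OF KI]])
    finally have "\<bar>integral ?I (\<lambda>t. H t * ?K N t) - 8 * H c\<bar> = norm (integral ?I (\<lambda>t. H t * ?K N t - H c * ?K N t))" by simp
    \<comment> \<open>Near the centre continuity costs e/16 against a kernel of mass 8, so e/2 in
      total; elsewhere the crude bound 2M meets a kernel of size O(1/N).\<close>
    also have "\<dots> \<le> integral ?I (\<lambda>t. e / 16 * ?K N t + 2 * M * (4 / q / real (Suc N)))"
    proof (rule integral_norm_bound_integral)
      show "(\<lambda>t. H t * ?K N t - H c * ?K N t) integrable_on ?I"
        by (intro integrable_diff HKI integrable_on_mult_right KI)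
      show "(\<lambda>t. e / 16 * ?K N t + 2 * M * (4 / q / real (Suc N))) integrable_on ?I"
        by (intro integrable_add integrable_on_mult_right KI integrable_const_ivl)
      fix t assume t: "t \<in> ?I"
      have "norm (H t * ?K N t - H c * ?K N t) = \<bar>H t - H c\<bar> * ?K N t"
        by (simp add: left_diff_distrib[symmetric] abs_mult)
      also have "\<dots> \<le> e / 16 * ?K N t + 2 * M * (4 / q / real (Suc N))"
      proof (cases "\<bar>t - c\<bar> < \<delta>'")
        case True
        then have "\<bar>H t - H c\<bar> \<le> e / 16" using \<delta>(2)[of t] \<delta>' by auto
        then have "\<bar>H t - H c\<bar> * ?K N t \<le> e / 16 * ?K N t" by (rule mult_right_mono) simp
        moreover have "2 * M * (4 / q / real (Suc N)) \<ge> 0" using M0 q by simp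
        ultimately show ?thesis by linarith
      next
        case False
        have "\<bar>H t - H c\<bar> \<le> 2 * M" using M[OF t] M[of c] by simp
        then have "\<bar>H t - H c\<bar> * ?K N t \<le> 2 * M * (4 / q / real (Suc N))"
          using far[OF t] False M0 by (intro mult_mono) auto
        moreover have "e / 16 * ?K N t \<ge> 0" using e by simp
        ultimately show ?thesis by linarith
      qed
      finally show "norm (H t * ?K N t - H c * ?K N t) \<le> e / 16 * ?K N t + 2 * M * (4 / q / real (Suc N))" .
    qed
    also have "\<dots> = e / 16 * 8 + 8 * (2 * M * (4 / q / real (Suc N)))"
      by (subst Henstock_Kurzweil_Integration.integral_add)
        (auto simp: Kval intro!: integrable_on_mult_right KI integrable_const_ivl)
    finally show ?thesis by (simp add: field_simps)
  qed
  have "(\<lambda>N. 64 * M / q / real (Suc N)) \<longlonglongrightarrow> 0"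
    by (rule filterlim_compose[OF lim_const_over_n filterlim_Suc])
  then have "\<forall>\<^sub>F N in sequentially. 64 * M / q / real (Suc N) < e / 2" by (rule order_tendstoD) (use e in auto)
  then obtain N0 where N0: "\<And>N. N \<ge> N0 \<Longrightarrow> 64 * M / q / real (Suc N) < e / 2" by (auto simp: eventually_sequentially)
  show "\<exists>N0. \<forall>N\<ge>N0. norm (integral ?I (\<lambda>t. H t * ?K N t) - 8 * H c) < e"
  proof (intro exI[of _ N0] allI impI)
    fix N assume "N \<ge> N0"
    then show "norm (integral ?I (\<lambda>t. H t * ?K N t) - 8 * H c) < e"
      using main[of N] N0[of N] unfolding real_norm_def by linarith
  qed
qed

text \<open>The inequality replacing Poisson summation. As N grows, the kernel puts mass 8 at each
  point 8j + 4, so a lower bound for all the smoothed integrals passes to the samples. The bounds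
  \<open>B\<close> on the blocks justify taking the limit under the sum.\<close>

lemma fejer_sampling_bound:
  fixes H :: "real \<Rightarrow> real" and B :: "nat \<Rightarrow> real"
  assumes H: "continuous_on UNIV H" and H0: "\<And>t. H t \<ge> 0" "\<And>t. t \<le> 0 \<Longrightarrow> H t = 0"
    and B: "summable B" "\<And>j t. t \<in> {8 * real j..8 * real j + 8} \<Longrightarrow> H t \<le> B j"
    and Q: "\<And>N. ennreal Q \<le> (\<integral>\<^sup>+t. ennreal (H t * fejer (Suc N) (pi * (t - 4) / 4)) \<partial>lborel)"
  shows "summable (\<lambda>j. H (8 * real j + 4))" "Q \<le> 8 * (\<Sum>j. H (8 * real j + 4))"
proof -
  let ?c = "\<lambda>j::nat. 8 * real j + 4" and ?K = "\<lambda>N t. fejer (Suc N) (pi * (t - 4) / 4)"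
  let ?I = "\<lambda>j. {?c j - 4..?c j + 4}"
  define A where "A N j = integral (?I j) (\<lambda>t. H t * ?K N t)" for N j
  have [measurable]: "H \<in> borel_measurable borel" using H by (rule borel_measurable_continuous_onI)
  have cont: "continuous_on S H" for S using H continuous_on_subset by blast
  have Bnd: "H t \<le> B j" if "t \<in> ?I j" for t j using B(2)[of t j] that by simp
  have B0: "B j \<ge> 0" for j using order.trans[OF H0(1) Bnd[of "?c j" j]] by simp
  \<comment> \<open>The kernel centred at 4 is also centred at every other 8j + 4 by
    periodicity.\<close>
  have K: "?K N t = fejer (Suc N) (pi * (t - ?c j) / 4)" for N t j
    using fejer_period[of "Suc N" "pi * (t - ?c j) / 4" j] by (simp add: field_simps)
  show sm: "summable (\<lambda>j. H (?c j))"
    by (rule summable_comparison_test[OF _ B(1)]) (use Bnd H0 in auto)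
  have HKI: "(\<lambda>t. H t * ?K N t) integrable_on ?I j" for N j
    by (intro integrable_continuous_real continuous_intros cont) auto
  have lim: "(\<lambda>N. A N j) \<longlonglongrightarrow> 8 * H (?c j)" for j
    unfolding A_def K[of _ _ j] by (rule fejer_approximate_identity[OF H, where M = "B j"]) (use Bnd H0 in auto)
  have A0: "A N j \<ge> 0" for N j
    unfolding A_def by (rule Henstock_Kurzweil_Integration.integral_nonneg[OF HKI]) (auto simp: H0)
  have Abnd: "A N j \<le> 8 * B j" for N j
  proof -
    have Kj: "((\<lambda>t. ?K N t) has_integral 8) (?I j)" unfolding K[of _ _ j] by (rule fejer_integral) simp
    have "A N j \<le> integral (?I j) (\<lambda>t. B j * ?K N t)"
      unfolding A_def
      by (rule integral_le[OF HKI integrable_on_mult_right]) (use Kj Bnd in \<open>auto intro!: mult_right_mono has_integral_integrable\<close>)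
    also have "\<dots> = 8 * B j" using integral_unique[OF Kj] by (simp add: integral_mult_right)
    finally show ?thesis .
  qed
  have sA: "summable (A N)" for N
    by (rule summable_comparison_test[OF _ summable_mult[OF B(1), of 8]]) (use A0 Abnd in auto)
  \<comment> \<open>Adjacent blocks share an endpoint; counting it twice is harmless for an upper
    bound.\<close>
  have QA: "Q \<le> (\<Sum>j. A N j)" for N
  proof -
    have "ennreal Q \<le> (\<integral>\<^sup>+t. ennreal (H t * ?K N t) \<partial>lborel)" by (rule Q)
    also have "\<dots> \<le> (\<integral>\<^sup>+t. (\<Sum>j. ennreal (indicator (?I j) t * (H t * ?K N t))) \<partial>lborel)"
    proof (rule nn_integral_mono)
      fix t :: real
      show "ennreal (H t * ?K N t) \<le> (\<Sum>j. ennreal (indicator (?I j) t * (H t * ?K N t)))"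
      proof (cases "t \<le> 0")
        case True then show ?thesis using H0 by simp
      next
        case False
        define j where "j = nat \<lfloor>t / 8\<rfloor>"
        have "real j = of_int \<lfloor>t / 8\<rfloor>" using False by (simp add: j_def)
        then have "real j \<le> t / 8" "t / 8 < real j + 1" by linarith+
        then have "t \<in> ?I j" by (simp add: field_simps)
        then have "ennreal (H t * ?K N t) = (\<Sum>i\<in>{j}. ennreal (indicator (?I i) t * (H t * ?K N t)))" by simp
        also have "\<dots> \<le> (\<Sum>j. ennreal (indicator (?I j) t * (H t * ?K N t)))"
          by (rule sum_le_suminf) auto
        finally show ?thesis .
      qed
    qed
    also have "\<dots> = (\<Sum>j. \<integral>\<^sup>+t. ennreal (indicator (?I j) t * (H t * ?K N t)) \<partial>lborel)"
      by (rule nn_integral_suminf) measurable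
    also have "\<dots> = (\<Sum>j. ennreal (A N j))"
    proof (rule arg_cong[where f = suminf], rule ext)
      fix j
      show "(\<integral>\<^sup>+t. ennreal (indicator (?I j) t * (H t * ?K N t)) \<partial>lborel) = ennreal (A N j)"
        unfolding A_def
        by (rule nn_integral_has_integral_lebesgue) (use H0 HKI in \<open>auto intro: integrable_integral\<close>)
    qed
    also have "\<dots> = ennreal (\<Sum>j. A N j)" by (rule suminf_ennreal2) (use A0 sA in auto)
    finally show ?thesis using suminf_nonneg[OF sA A0] by (simp add: ennreal_le_iff)
  qed
  have "(\<lambda>N. \<Sum>j. A N j) \<longlonglongrightarrow> (\<Sum>j. 8 * H (?c j))"
  proof -
    have "\<forall>\<^sub>F (j, N) in at_top \<times>\<^sub>F sequentially. norm (A N j) \<le> 8 * B j"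
      by (rule always_eventually) (use A0 Abnd in auto)
    from tannerys_theorem[OF lim this summable_mult[OF B(1)]] show ?thesis by simp
  qed
  then have "Q \<le> (\<Sum>j. 8 * H (?c j))" by (rule LIMSEQ_le_const) (use QA in auto)
  then show "Q \<le> 8 * (\<Sum>j. H (?c j))" using suminf_mult[OF sm, of 8] by simp
qed

section \<open>Fourier coefficients of periodizations\<close>

lemma cis_unit_integral:
  fixes n :: int
  shows "(\<integral>t. indicator {0..1} t *\<^sub>R cis (2 * pi * (t * of_int n)) \<partial>lborel) = (if n = 0 then 1 else 0)"
proof (cases "n = 0")
  case True
  have "(\<integral>t. indicator {0..1} t *\<^sub>R (1::complex) \<partial>(lborel :: real measure)) = 1" by simp
  then show ?thesis using True by simp
next
  case False
  define c where "c = 2 * pi * real_of_int n"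
  have c: "c \<noteq> 0" using False by (simp add: c_def)
  let ?F = "\<lambda>t. Complex (sin (c * t) / c) (- cos (c * t) / c)"
  have "(\<integral>t. indicator {0..1} t *\<^sub>R cis (c * t) \<partial>lborel) = ?F 1 - ?F 0"
  proof (rule integral_FTC_Icc)
    fix t :: real
    show "(?F has_vector_derivative cis (c * t)) (at t within {0..1})"
      unfolding has_vector_derivative_complex_iff using c by (auto intro!: derivative_eq_intros)
  qed (auto intro!: continuous_intros)
  also have "\<dots> = 0"
  proof -
    have "cis c = 1" unfolding c_def by (rule cis_multiple_2pi) simp
    then have "cos c = 1" "sin c = 0" by (simp_all add: complex_eq_iff)
    then show ?thesis by (simp add: complex_eq_iff)
  qed
  finally show ?thesis using False by (simp add: c_def mult_ac)
qed

lemma int_lattice_inner: "m \<in> int_lattice \<Longrightarrow> \<nu> \<in> int_lattice \<Longrightarrow> m \<bullet> \<nu> \<in> \<int>"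
  unfolding int_lattice_def inner_vec_def by (auto intro!: Ints_sum Ints_mult)

lemma int_lattice_diff: "m \<in> int_lattice \<Longrightarrow> \<nu> \<in> int_lattice \<Longrightarrow> m - \<nu> \<in> int_lattice"
  by (auto simp: int_lattice_def)

lemma cis_2pi_Ints: "x \<in> \<int> \<Longrightarrow> cis (2 * pi * x) = 1"
  by (rule cis_multiple_2pi)

abbreviation cube_measure :: "(real^'n) measure" where
  "cube_measure \<equiv> restrict_space lborel unit_cube"

lemma cube_orthonormal:
  fixes k :: "real^'n"
  assumes k: "k \<in> int_lattice"
  shows "(\<integral>x. cis (2 * pi * (x \<bullet> k)) \<partial>cube_measure) = (if k = 0 then 1 else 0)"
proof -
  obtain n :: "'n \<Rightarrow> int" where n: "\<And>i. k $ i = of_int (n i)"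
  proof -
    have "\<forall>i. \<exists>j. k $ i = of_int j" using k by (auto simp: int_lattice_def elim: Ints_cases)
    then show thesis using that by metis
  qed
  have kb: "\<exists>j::int. k \<bullet> b = of_int j" if "b \<in> Basis" for b
    using that n by (auto simp: Basis_vec_def inner_axis)
  then obtain j :: "real^'n \<Rightarrow> int" where j: "\<And>b. b \<in> Basis \<Longrightarrow> k \<bullet> b = of_int (j b)" by metis
  let ?g = "\<lambda>b t. indicator {0..1} t *\<^sub>R cis (2 * pi * (t * (k \<bullet> b)))"
  have "(\<integral>x. cis (2 * pi * (x \<bullet> k)) \<partial>cube_measure) = (\<integral>x. indicator unit_cube x *\<^sub>R cis (2 * pi * (x \<bullet> k)) \<partial>lborel)"
    by (subst integral_restrict_space) (auto simp: unit_cube_def)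
  also have "\<dots> = (\<integral>x. (\<Prod>b\<in>Basis. ?g b (x \<bullet> b)) \<partial>lborel)"
  proof (rule Bochner_Integration.integral_cong)
    fix x :: "real^'n"
    have "indicator unit_cube x = (\<Prod>b\<in>Basis. indicat_real {0..1} (x \<bullet> b))"
    proof (cases "x \<in> unit_cube")
      case True
      then show ?thesis by (simp add: unit_cube_def mem_box)
    next
      case False
      then obtain b where "b \<in> Basis" "x \<bullet> b \<notin> {0..1}" by (auto simp: unit_cube_def mem_box)
      then have "(\<Prod>b\<in>Basis. indicat_real {0..1} (x \<bullet> b)) = 0" by (intro prod_zero bexI[of _ b]) auto
      then show ?thesis using False by simp
    qed
    moreover have "cis (2 * pi * (x \<bullet> k)) = (\<Prod>b\<in>Basis. cis (2 * pi * ((x \<bullet> b) * (k \<bullet> b))))"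
      by (subst euclidean_inner) (simp add: sum_distrib_left cis_sum)
    ultimately show "indicator unit_cube x *\<^sub>R cis (2 * pi * (x \<bullet> k)) = (\<Prod>b\<in>Basis. ?g b (x \<bullet> b))"
      by (simp add: scaleR_conv_of_real prod.distrib)
  qed simp
  also have "\<dots> = (\<Prod>b\<in>Basis. \<integral>t. ?g b t \<partial>lborel)"
    by (rule lborel_integral_prod(2)) (auto intro!: borel_integrable_compact continuous_intros)
  also have "\<dots> = (\<Prod>b\<in>(Basis :: (real^'n) set). if j b = 0 then 1 else 0)"
    by (intro prod.cong refl) (simp add: j cis_unit_integral)
  also have "\<dots> = (if k = 0 then 1 else 0)"
  proof (cases "k = 0")
    case True
    then have "j b = 0" if "b \<in> Basis" for b using j[OF that] by simp
    then show ?thesis using True by simp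
  next
    case False
    then obtain b where "b \<in> Basis" "k \<bullet> b \<noteq> 0" by (metis euclidean_all_zero_iff)
    then have "(\<Prod>b\<in>(Basis :: (real^'n) set). if j b = 0 then 1 else (0::complex)) = 0"
      using j by (intro prod_zero) auto
    then show ?thesis using False by simp
  qed
  finally show ?thesis .
qed

lemma emeasure_cube: "emeasure (cube_measure :: (real^'n) measure) (space cube_measure) = 1"
proof -
  have "emeasure lborel (unit_cube :: (real^'n) set) = 1"
    unfolding unit_cube_def by (subst emeasure_lborel_cbox_eq) (auto simp: inner_Basis)
  then show ?thesis by (simp add: emeasure_restrict_space space_restrict_space unit_cube_def)
qed

lemma cube_prob_space: "prob_space (cube_measure :: (real^'n) measure)"
  by (rule prob_spaceI) (rule emeasure_cube)

lemma (in prob_space) integrable_if_square_integrable: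
  fixes g :: "'a \<Rightarrow> complex"
  assumes [measurable]: "g \<in> borel_measurable M" and g2: "integrable M (\<lambda>x. (norm (g x))\<^sup>2)"
  shows "integrable M g"
proof (rule Bochner_Integration.integrable_bound)
  show "integrable M (\<lambda>x. 1 + (norm (g x))\<^sup>2)" using g2 by simp
  have "norm z \<le> 1 + (norm z)\<^sup>2" for z :: complex
    using zero_le_power2[of "norm z - 1/2"] by (simp add: power2_diff field_simps)
  then show "AE x in M. norm (g x) \<le> norm (1 + (norm (g x))\<^sup>2)" by (auto simp: abs_of_nonneg add_nonneg_nonneg)
qed measurable

definition cube_coeff :: "(real^'n \<Rightarrow> complex) \<Rightarrow> real^'n \<Rightarrow> complex" where
  "cube_coeff g m = (\<integral>x. g x * cis (- (2 * pi * (x \<bullet> m))) \<partial>cube_measure)"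

lemma bessel_inequality:
  fixes G :: "real^'n \<Rightarrow> complex"
  assumes [measurable]: "G \<in> borel_measurable cube_measure"
    and G2: "integrable cube_measure (\<lambda>x. (norm (G x))\<^sup>2)"
    and S: "finite S" "S \<subseteq> int_lattice"
  shows "(\<Sum>m\<in>S. (norm (cube_coeff G m))\<^sup>2) \<le> (\<integral>x. (norm (G x))\<^sup>2 \<partial>cube_measure)"
proof -
  define M where "M = (cube_measure :: (real^'n) measure)"
  interpret M: prob_space M unfolding M_def by (rule cube_prob_space)
  have cont: "h \<in> borel_measurable M" if "continuous_on UNIV h" for h :: "real^'n \<Rightarrow> complex"
    unfolding M_def by (intro measurable_restrict_space1) (use that in \<open>simp add: borel_measurable_continuous_onI\<close>)
  have [measurable]: "(\<lambda>x. cis (c * (x \<bullet> m))) \<in> borel_measurable M" "(\<lambda>x. cis (- (c * (x \<bullet> m)))) \<in> borel_measurable M" for c m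
    by (intro cont continuous_intros)+
  have [measurable]: "G \<in> borel_measurable M" using assms(1) by (simp add: M_def)
  have G1: "integrable M G" by (rule M.integrable_if_square_integrable) (use G2 in \<open>simp_all add: M_def[symmetric]\<close>)
  define a where "a = cube_coeff G"
  define P where "P x = (\<Sum>m\<in>S. a m * cis (2 * pi * (x \<bullet> m)))" for x
  have [measurable]: "P \<in> borel_measurable M" unfolding P_def by measurable
  have bdd: "integrable M (\<lambda>x. c * cis (2 * pi * (x \<bullet> m)))" for c m
    by (rule M.integrable_const_bound[where B = "norm c"]) auto
  have Gc: "integrable M (\<lambda>x. G x * (c * cis (- (2 * pi * (x \<bullet> m)))))" for c m
    by (rule Bochner_Integration.integrable_bound[of _ "\<lambda>x. c * G x"]) (use G1 in \<open>auto simp: norm_mult\<close>)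
  have GPeq: "G x * cnj (P x) = (\<Sum>m\<in>S. G x * (cnj (a m) * cis (- (2 * pi * (x \<bullet> m)))))" for x
    by (simp add: P_def cis_cnj sum_distrib_left)
  have GPi: "integrable M (\<lambda>x. G x * cnj (P x))" unfolding GPeq by (intro Bochner_Integration.integrable_sum Gc)
  have GP: "(\<integral>x. G x * cnj (P x) \<partial>M) = of_real (\<Sum>m\<in>S. (norm (a m))\<^sup>2)"
  proof -
    have "(\<integral>x. G x * cnj (P x) \<partial>M) = (\<Sum>m\<in>S. \<integral>x. G x * (cnj (a m) * cis (- (2 * pi * (x \<bullet> m)))) \<partial>M)"
      unfolding GPeq by (intro Bochner_Integration.integral_sum Gc)
    also have "\<dots> = (\<Sum>m\<in>S. cnj (a m) * a m)"
      unfolding a_def cube_coeff_def M_def[symmetric] Bochner_Integration.integral_mult_right_zero[symmetric]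
      by (intro sum.cong Bochner_Integration.integral_cong) (auto simp: mult_ac)
    also have "\<dots> = of_real (\<Sum>m\<in>S. (norm (a m))\<^sup>2)"
      by (simp add: complex_norm_square mult.commute del: of_real_power)
    finally show ?thesis .
  qed
  have PPeq: "P x * cnj (P x) = (\<Sum>m\<in>S. \<Sum>n\<in>S. (a m * cnj (a n)) * cis (2 * pi * (x \<bullet> (m - n))))" for x
  proof -
    have "P x * cnj (P x) = (\<Sum>m\<in>S. \<Sum>n\<in>S. (a m * cis (2 * pi * (x \<bullet> m))) * cnj (a n * cis (2 * pi * (x \<bullet> n))))"
      unfolding P_def cnj_sum sum_product ..
    also have "\<dots> = (\<Sum>m\<in>S. \<Sum>n\<in>S. (a m * cnj (a n)) * (cis (2 * pi * (x \<bullet> m)) * cis (- (2 * pi * (x \<bullet> n)))))"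
      by (simp add: cis_cnj mult_ac)
    also have "\<dots> = (\<Sum>m\<in>S. \<Sum>n\<in>S. (a m * cnj (a n)) * cis (2 * pi * (x \<bullet> (m - n))))"
      by (simp add: cis_mult inner_diff_right algebra_simps)
    finally show ?thesis .
  qed
  have PPi: "integrable M (\<lambda>x. P x * cnj (P x))" unfolding PPeq by (intro Bochner_Integration.integrable_sum bdd)
  have PP: "(\<integral>x. P x * cnj (P x) \<partial>M) = of_real (\<Sum>m\<in>S. (norm (a m))\<^sup>2)"
  proof -
    have "(\<integral>x. P x * cnj (P x) \<partial>M) = (\<Sum>m\<in>S. \<Sum>n\<in>S. \<integral>x. (a m * cnj (a n)) * cis (2 * pi * (x \<bullet> (m - n))) \<partial>M)"
      unfolding PPeq
      by (subst Bochner_Integration.integral_sum, intro Bochner_Integration.integrable_sum bdd)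
        (intro sum.cong refl Bochner_Integration.integral_sum bdd)
    also have "\<dots> = (\<Sum>m\<in>S. \<Sum>n\<in>S. (a m * cnj (a n)) * (if m - n = 0 then 1 else 0))"
    proof (intro sum.cong refl)
      fix m n assume "m \<in> S" "n \<in> S"
      then have "m - n \<in> int_lattice" using S by (intro int_lattice_diff) auto
      then show "(\<integral>x. (a m * cnj (a n)) * cis (2 * pi * (x \<bullet> (m - n))) \<partial>M) = (a m * cnj (a n)) * (if m - n = 0 then 1 else 0)"
        unfolding M_def by (simp only: Bochner_Integration.integral_mult_right_zero cube_orthonormal)
    qed
    also have "\<dots> = (\<Sum>m\<in>S. a m * cnj (a m))" using S(1) by (simp add: if_distrib sum.delta cong: if_cong)
    also have "\<dots> = of_real (\<Sum>m\<in>S. (norm (a m))\<^sup>2)"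
      by (simp add: complex_norm_square del: of_real_power)
    finally show ?thesis .
  qed
  have P2: "complex_of_real ((norm (P x))\<^sup>2) = P x * cnj (P x)" for x by (rule complex_norm_square)
  have P2i: "integrable M (\<lambda>x. (norm (P x))\<^sup>2)"
    using PPi unfolding P2[symmetric] complex_of_real_integrable_eq .
  have P2v: "(\<integral>x. (norm (P x))\<^sup>2 \<partial>M) = (\<Sum>m\<in>S. (norm (a m))\<^sup>2)"
    using PP unfolding P2[symmetric] integral_complex_of_real by (simp only: of_real_eq_iff)
  have expand: "(norm (G x - P x))\<^sup>2 = (norm (G x))\<^sup>2 - 2 * Re (G x * cnj (P x)) + (norm (P x))\<^sup>2" for x
    unfolding cmod_power2 by (simp add: power2_eq_square algebra_simps)
  have "0 \<le> (\<integral>x. (norm (G x - P x))\<^sup>2 \<partial>M)" by (rule Bochner_Integration.integral_nonneg) simp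
  also have "\<dots> = (\<integral>x. (norm (G x))\<^sup>2 \<partial>M) - 2 * Re (\<integral>x. G x * cnj (P x) \<partial>M) + (\<integral>x. (norm (P x))\<^sup>2 \<partial>M)"
  proof -
    have "integrable M (\<lambda>x. Re (G x * cnj (P x)))" "(\<integral>x. Re (G x * cnj (P x)) \<partial>M) = Re (\<integral>x. G x * cnj (P x) \<partial>M)"
      using GPi by (rule integrable_Re, intro integral_Re)
    then show ?thesis
      unfolding expand using G2 P2i by (simp add: M_def[symmetric] del: times_complex.sel)
  qed
  also have "\<dots> = (\<integral>x. (norm (G x))\<^sup>2 \<partial>M) - (\<Sum>m\<in>S. (norm (a m))\<^sup>2)"
    unfolding GP P2v by simp
  finally show ?thesis by (simp add: a_def M_def)
qed

section \<open>Lattice cells and unfolding\<close>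

lemma countable_int_lattice: "countable (int_lattice :: (real^'n) set)"
proof -
  have "int_lattice \<subseteq> range (\<lambda>n::int^'n. \<chi> i. real_of_int (n $ i))"
  proof
    fix \<nu> :: "real^'n" assume "\<nu> \<in> int_lattice"
    then have "\<forall>i. \<exists>j. \<nu> $ i = of_int j" by (auto simp: int_lattice_def elim: Ints_cases)
    then obtain j where "\<And>i. \<nu> $ i = of_int (j i)" by metis
    then have "\<nu> = (\<chi> i. real_of_int ((\<chi> i. j i) $ i))" by (simp add: vec_eq_iff)
    then show "\<nu> \<in> range (\<lambda>n::int^'n. \<chi> i. real_of_int (n $ i))" by blast
  qed
  moreover have "countable (UNIV :: (int^'n) set)"
  proof -
    have "countable (PiE (UNIV :: 'n set) (\<lambda>_. UNIV :: int set))" by (rule countable_PiE) auto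
    then have "countable (vec_lambda ` (PiE (UNIV :: 'n set) (\<lambda>_. UNIV :: int set)))" by (rule countable_image)
    moreover have "vec_lambda ` (PiE (UNIV :: 'n set) (\<lambda>_. UNIV :: int set)) = UNIV"
      by (simp add: PiE_UNIV_domain) (metis surjI vec_lambda_eta)
    ultimately show ?thesis by simp
  qed
  ultimately show ?thesis by (meson countable_image countable_subset)
qed

lemma infinite_int_lattice: "infinite (int_lattice :: (real^'n) set)"
proof
  assume "finite (int_lattice :: (real^'n) set)"
  moreover have "range (\<lambda>n::nat. (\<chi> i. real n) :: real^'n) \<subseteq> int_lattice" by (auto simp: int_lattice_def)
  moreover have "inj (\<lambda>n::nat. (\<chi> i. real n) :: real^'n)" by (auto simp: inj_def vec_eq_iff)
  ultimately show False using finite_subset finite_imageD by (metis infinite_UNIV_nat)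
qed

text \<open>A genuine fundamental domain: its lattice translates tile space without overlap, whereas
  those of the closed \<open>unit_cube\<close> meet along faces. The two cubes differ by a null
  set.\<close>

definition half_cube :: "(real^'n) set" where
  "half_cube = {x. \<forall>i. 0 \<le> x $ i \<and> x $ i < 1}"

lemma half_cube_measurable [measurable]: "(half_cube :: (real^'n) set) \<in> sets borel"
  unfolding half_cube_def by measurable

lemma half_cube_translate:
  fixes x :: "real^'n"
  shows "\<exists>\<nu>\<in>int_lattice. \<forall>\<nu>'\<in>int_lattice. x + \<nu>' \<in> half_cube \<longleftrightarrow> \<nu>' = \<nu>"
proof (intro bexI ballI)
  let ?v = "(\<chi> i. - of_int \<lfloor>x $ i\<rfloor>) :: real^'n"
  show "?v \<in> int_lattice" by (simp add: int_lattice_def)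
  fix \<nu>' :: "real^'n" assume "\<nu>' \<in> int_lattice"
  then have "\<forall>i. \<exists>j. \<nu>' $ i = of_int j" by (auto simp: int_lattice_def elim: Ints_cases)
  then obtain j where j: "\<And>i. \<nu>' $ i = of_int (j i)" by metis
  have "x $ i + of_int (j i) \<ge> 0 \<and> x $ i + of_int (j i) < 1 \<longleftrightarrow> j i = - \<lfloor>x $ i\<rfloor>" for i by linarith
  then show "x + \<nu>' \<in> half_cube \<longleftrightarrow> \<nu>' = ?v"
    by (simp add: half_cube_def vec_eq_iff j) (metis of_int_eq_iff of_int_minus)
qed

lemma AE_half_cube: "AE x in lborel. x \<in> (unit_cube :: (real^'n) set) \<longleftrightarrow> x \<in> half_cube"
proof -
  have Basis: "(\<forall>b\<in>Basis. Q (x \<bullet> b)) \<longleftrightarrow> (\<forall>i. Q (x $ i))" for Q and x :: "real^'n"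
    by (auto simp: Basis_vec_def inner_axis)
  have "x \<in> unit_cube \<longleftrightarrow> (\<forall>b\<in>Basis. 0 \<le> x \<bullet> b \<and> x \<bullet> b \<le> 1)" for x :: "real^'n"
    by (simp add: unit_cube_def mem_box)
  then have box: "unit_cube = {x::real^'n. \<forall>i. 0 \<le> x $ i \<and> x $ i \<le> 1}"
    using Basis[of "\<lambda>t. 0 \<le> t \<and> t \<le> 1"] by auto
  have "x \<in> box 0 One \<longleftrightarrow> (\<forall>b\<in>Basis. 0 < x \<bullet> b \<and> x \<bullet> b < 1)" for x :: "real^'n"
    by (simp add: mem_box)
  then have "box 0 One \<subseteq> (half_cube :: (real^'n) set)"
    using Basis[of "\<lambda>t. 0 < t \<and> t < 1"] unfolding half_cube_def by (auto intro: less_imp_le)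
  then have "unit_cube - half_cube \<subseteq> (cbox 0 One - box 0 One :: (real^'n) set)" unfolding unit_cube_def by auto
  moreover have "half_cube \<subseteq> (unit_cube :: (real^'n) set)" unfolding box half_cube_def by (auto intro: less_imp_le)
  moreover have "emeasure lborel (cbox 0 One - box 0 One :: (real^'n) set) = 0"
    by (subst emeasure_Diff) (auto simp: emeasure_lborel_cbox_eq emeasure_lborel_box_eq box_subset_cbox inner_Basis)
  then have "AE x in lborel. x \<notin> (cbox 0 One - box 0 One :: (real^'n) set)"
    by (intro AE_not_in) (auto simp: null_sets_def)
  ultimately show ?thesis by (auto elim!: eventually_mono)
qed

text \<open>Unfolding: the character is invariant under the lattice, so the integral over space, cut
  into cells, becomes an integral of the lattice sum over one cell. An unordered sum is 0 by
  convention where it fails to converge, so almost everywhere absolute convergence has to be proved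
  before it can be identified with a series.\<close>

lemma cube_coeff_periodic_sum:
  fixes h :: "real^'n \<Rightarrow> complex"
  assumes h: "integrable lborel h" and m: "m \<in> int_lattice"
    and meas: "(\<lambda>x. \<Sum>\<^sub>\<infinity>\<nu>\<in>int_lattice. h (x - \<nu>)) \<in> borel_measurable cube_measure"
  shows "cube_coeff (\<lambda>x. \<Sum>\<^sub>\<infinity>\<nu>\<in>int_lattice. h (x - \<nu>)) m = fourier h m"
    (is "cube_coeff ?P m = _")
proof -
  have [measurable]: "h \<in> borel_measurable borel" using h by auto
  \<comment> \<open>An enumeration of the lattice, to use the theorems on integrating
    series.\<close>
  define e where "e = from_nat_into (int_lattice :: (real^'n) set)"
  have e: "bij_betw e UNIV int_lattice"
    unfolding e_def by (rule bij_betw_from_nat_into[OF countable_int_lattice infinite_int_lattice])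
  have eL: "e k \<in> int_lattice" for k using e by (auto simp: bij_betw_def)
  let ?I = "indicat_real (half_cube :: (real^'n) set)"
  let ?\<phi> = "\<lambda>x. cis (- (2 * pi * (x \<bullet> m)))"
  let ?H = "\<lambda>x. h x * ?\<phi> x"
  have H: "integrable lborel ?H" by (rule integrable_mult_cis[OF h]) measurable
  have one: "\<exists>j. \<forall>k. x + e k \<in> half_cube \<longleftrightarrow> k = j" for x
  proof -
    obtain \<nu> where \<nu>: "\<nu> \<in> int_lattice" "\<And>\<nu>'. \<nu>' \<in> int_lattice \<Longrightarrow> x + \<nu>' \<in> half_cube \<longleftrightarrow> \<nu>' = \<nu>"
      using half_cube_translate[of x] by blast
    obtain j where "\<nu> = e j" using \<nu>(1) e by (auto simp: bij_betw_def)
    then show ?thesis using \<nu>(2)[OF eL] e by (auto simp: bij_betw_def inj_eq)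
  qed
  \<comment> \<open>\<open>?X k\<close> is the part of the integrand on the k-th cell,
    \<open>?Y k\<close> the same part moved back into the half-open cube.\<close>
  let ?X = "\<lambda>k x. ?I (x + e k) *\<^sub>R ?H x" and ?Y = "\<lambda>k y. ?I y *\<^sub>R ?H (y - e k)"
  have \<phi>_per: "?\<phi> (x - e k) = ?\<phi> x" for x k
  proof -
    have "cis (2 * pi * (e k \<bullet> m)) = 1" by (rule cis_2pi_Ints[OF int_lattice_inner[OF eL m]])
    moreover have "?\<phi> (x - e k) = ?\<phi> x * cis (2 * pi * (e k \<bullet> m))"
      by (simp add: cis_mult inner_diff_left algebra_simps)
    ultimately show ?thesis by simp
  qed
  have tr: "integrable lborel (\<lambda>y. ?Y k y)" "(\<integral>y. ?Y k y \<partial>lborel) = (\<integral>x. ?X k x \<partial>lborel)"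
    "(\<integral>y. norm (?Y k y) \<partial>lborel) = (\<integral>x. norm (?X k x) \<partial>lborel)" for k
  proof -
    let ?f = "\<lambda>y. ?Y k y"
    have i: "integrable lborel (\<lambda>x. ?I (e k + x) *\<^sub>R ?H x)"
      by (rule Bochner_Integration.integrable_bound[OF H]) (auto simp: norm_mult split: split_indicator)
    have fm: "?f \<in> borel_measurable borel" "(\<lambda>y. norm (?f y)) \<in> borel_measurable borel" by measurable
    show "integrable lborel ?f" using lborel_translation(1)[OF fm(1), of "e k"] i by simp
    show "(\<integral>y. ?f y \<partial>lborel) = (\<integral>x. ?X k x \<partial>lborel)"
      using lborel_translation(2)[OF fm(1), of "e k"] by (simp add: add.commute)
    show "(\<integral>y. norm (?f y) \<partial>lborel) = (\<integral>x. norm (?X k x) \<partial>lborel)"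
      using lborel_translation(2)[OF fm(2), of "e k"] by (simp add: add.commute)
  qed
  have pt_sums: "(\<lambda>k. ?I (x + e k) *\<^sub>R z) sums z" for x and z :: "'z::real_normed_vector"
  proof -
    obtain j where j: "\<And>k. x + e k \<in> half_cube \<longleftrightarrow> k = j" using one[of x] by blast
    have "(\<lambda>k. ?I (x + e k) *\<^sub>R z) = (\<lambda>k. if k = j then z else 0)" using j by (auto split: split_indicator)
    then show ?thesis using sums_single[of j "\<lambda>_. z"] by simp
  qed
  have i1: "integrable lborel (\<lambda>x. ?X k x)" for k
    by (rule Bochner_Integration.integrable_bound[OF H]) (auto simp: norm_mult split: split_indicator)
  have n1: "norm (?X k x) = ?I (x + e k) *\<^sub>R norm (?H x)" for x k by simp
  have norm_sums: "(\<lambda>k. \<integral>x. norm (?X k x) \<partial>lborel) sums (\<integral>x. norm (?H x) \<partial>lborel)"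
  proof -
    have "(\<Sum>k. ennreal (\<integral>x. norm (?X k x) \<partial>lborel)) = (\<Sum>k. \<integral>\<^sup>+x. norm (?X k x) \<partial>lborel)"
      by (intro arg_cong[where f = suminf] ext nn_integral_eq_integral[symmetric] integrable_norm i1) auto
    also have "\<dots> = (\<integral>\<^sup>+x. (\<Sum>k. ennreal (norm (?X k x))) \<partial>lborel)"
      by (rule nn_integral_suminf[symmetric]) measurable
    also have "\<dots> = (\<integral>\<^sup>+x. ennreal (norm (?H x)) \<partial>lborel)"
    proof (rule nn_integral_cong)
      fix x
      have "(\<lambda>k. ennreal (norm (?X k x))) sums ennreal (norm (?H x))"
        unfolding n1 using pt_sums[of x "norm (?H x)"] by (subst sums_ennreal) auto
      then show "(\<Sum>k. ennreal (norm (?X k x))) = ennreal (norm (?H x))" by (rule sums_unique[symmetric])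
    qed
    also have "\<dots> = ennreal (\<integral>x. norm (?H x) \<partial>lborel)"
      by (rule nn_integral_eq_integral[OF integrable_norm[OF H]]) simp
    finally have "(\<lambda>k. ennreal (\<integral>x. norm (?X k x) \<partial>lborel)) sums ennreal (\<integral>x. norm (?H x) \<partial>lborel)"
      unfolding sums_iff by (intro conjI summableI)
    then show ?thesis by (subst (asm) sums_ennreal) (auto intro!: Bochner_Integration.integral_nonneg)
  qed
  have int_sums: "(\<lambda>k. \<integral>x. ?X k x \<partial>lborel) sums (\<integral>x. ?H x \<partial>lborel)"
  proof -
    have "(\<lambda>k. \<integral>x. ?X k x \<partial>lborel) sums (\<integral>x. (\<Sum>k. ?X k x) \<partial>lborel)"
    proof (rule sums_integral[OF i1])
      show "AE x in lborel. summable (\<lambda>k. norm (?X k x))"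
        unfolding n1 using pt_sums sums_summable by blast
      show "summable (\<lambda>k. \<integral>x. norm (?X k x) \<partial>lborel)" using norm_sums by (rule sums_summable)
    qed
    moreover have "(\<Sum>k. ?X k x) = ?H x" for x by (rule sums_unique[OF pt_sums, symmetric])
    ultimately show ?thesis by simp
  qed
  \<comment> \<open>The integrals of the norms have a finite sum, so the sum of the norms is finite
    almost everywhere.\<close>
  have AEs: "AE y in lborel. summable (\<lambda>k. norm (?Y k y))"
  proof -
    have "(\<integral>\<^sup>+y. (\<Sum>k. ennreal (norm (?Y k y))) \<partial>lborel) = (\<Sum>k. \<integral>\<^sup>+y. norm (?Y k y) \<partial>lborel)"
      by (rule nn_integral_suminf) measurable
    also have "\<dots> = (\<Sum>k. ennreal (\<integral>y. norm (?Y k y) \<partial>lborel))"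
      by (intro arg_cong[where f = suminf] ext nn_integral_eq_integral integrable_norm tr(1)) auto
    also have "\<dots> \<noteq> \<infinity>"
      unfolding tr(3) using norm_sums by (subst suminf_ennreal2) (auto simp: sums_iff intro!: Bochner_Integration.integral_nonneg)
    finally have "AE y in lborel. (\<Sum>k. ennreal (norm (?Y k y))) \<noteq> \<infinity>"
      by (intro nn_integral_PInf_AE) measurable
    then show ?thesis by eventually_elim (rule summable_suminf_not_top, auto)
  qed
  have "fourier h m = (\<Sum>k. \<integral>y. ?Y k y \<partial>lborel)"
    unfolding tr(2) fourier_def using sums_unique[OF int_sums] .
  also have "\<dots> = (\<integral>y. (\<Sum>k. ?Y k y) \<partial>lborel)"
  proof (rule integral_suminf[OF tr(1) AEs, symmetric])
    show "summable (\<lambda>k. \<integral>y. norm (?Y k y) \<partial>lborel)"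
      unfolding tr(3) by (rule sums_summable[OF norm_sums])
  qed
  also have "\<dots> = (\<integral>y. indicator unit_cube y *\<^sub>R (?P y * ?\<phi> y) \<partial>lborel)"
  proof (rule integral_cong_AE)
    show "(\<lambda>y. \<Sum>k. ?Y k y) \<in> borel_measurable lborel" by measurable
    have "(\<lambda>y. ?P y * ?\<phi> y) \<in> borel_measurable cube_measure"
      by (intro borel_measurable_times meas measurable_restrict_space1) measurable
    then show "(\<lambda>y. indicator unit_cube y *\<^sub>R (?P y * ?\<phi> y)) \<in> borel_measurable lborel"
      by (subst (asm) borel_measurable_restrict_space_iff) (auto simp: unit_cube_def)
    show "AE y in lborel. (\<Sum>k. ?Y k y) = indicator unit_cube y *\<^sub>R (?P y * ?\<phi> y)"
      using AEs AE_half_cube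
    proof eventually_elim
      case (elim y)
      show ?case
      proof (cases "y \<in> half_cube")
        case False
        then show ?thesis using elim(2) by simp
      next
        case True
        have sm: "summable (\<lambda>k. norm (h (y - e k)))" using elim(1) True by (simp add: norm_mult)
        have "((\<lambda>k. h (y - e k)) has_sum (\<Sum>k. h (y - e k))) UNIV"
          by (rule norm_summable_imp_has_sum[OF sm summable_sums[OF summable_norm_cancel[OF sm]]])
        then have "(\<Sum>\<^sub>\<infinity>k. h (y - e k)) = (\<Sum>k. h (y - e k))" by (rule infsumI)
        moreover have "(\<Sum>\<^sub>\<infinity>k. h (y - e k)) = ?P y"
          by (rule infsum_reindex_bij_betw[OF e])
        moreover have "(\<Sum>k. ?Y k y) = (\<Sum>k. h (y - e k)) * ?\<phi> y"
          unfolding \<phi>_per using True suminf_mult2[OF summable_norm_cancel[OF sm], of "?\<phi> y"] by simp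
        ultimately show ?thesis using True elim(2) by simp
      qed
    qed
  qed
  also have "\<dots> = cube_coeff ?P m"
    unfolding cube_coeff_def by (subst integral_restrict_space) (auto simp: unit_cube_def)
  finally show ?thesis by simp
qed

lemma orthogonal_integrable:
  fixes f :: "real^'n \<Rightarrow> complex"
  assumes \<rho>: "\<rho> \<in> SO" and f: "integrable lborel f"
  shows "integrable lborel (\<lambda>x. f (\<rho> *v x))" "fourier (\<lambda>x. f (\<rho> *v x)) m = fourier f (\<rho> *v m)"
proof -
  have [measurable]: "f \<in> borel_measurable borel" using f by auto
  have d: "distr lborel borel ((*v) \<rho>) = lborel" by (rule lborel_distr_orthogonal[OF SO_orthogonal_transformation[OF \<rho>]])
  have m[measurable]: "(*v) \<rho> \<in> measurable lborel borel" by measurable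
  have "integrable (distr lborel borel ((*v) \<rho>)) f" using f d by simp
  then show "integrable lborel (\<lambda>x. f (\<rho> *v x))" by (subst (asm) integrable_distr_eq[OF m]) auto
  have "fourier f (\<rho> *v m) = (\<integral>y. f y * cis (- (2 * pi * (y \<bullet> (\<rho> *v m)))) \<partial>distr lborel borel ((*v) \<rho>))"
    by (simp add: d fourier_def)
  also have "\<dots> = (\<integral>x. f (\<rho> *v x) * cis (- (2 * pi * ((\<rho> *v x) \<bullet> (\<rho> *v m)))) \<partial>lborel)"
    by (rule integral_distr[OF m]) measurable
  also have "\<dots> = fourier (\<lambda>x. f (\<rho> *v x)) m" by (simp add: fourier_def SO_inner[OF \<rho>])
  finally show "fourier (\<lambda>x. f (\<rho> *v x)) m = fourier f (\<rho> *v m)" by simp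
qed

text \<open>Since 0 is not in \<open>S\<close>, the constant \<open>c\<close> is orthogonal to all
  characters involved and leaves the coefficients unchanged. This is how the plain and the mean-free
  hypotheses are treated together.\<close>

lemma periodization_bessel:
  fixes f :: "real^'n \<Rightarrow> complex"
  assumes \<rho>: "\<rho> \<in> SO" and f: "integrable lborel f" and L2: "memL2_cube (periodization f \<rho>)"
    and S: "finite S" "S \<subseteq> int_lattice" "0 \<notin> S"
  shows "(\<Sum>m\<in>S. (norm (fourier f (\<rho> *v m)))\<^sup>2) \<le> L2_cube_sq (\<lambda>x. periodization f \<rho> x - c)"
proof -
  define M where "M = (cube_measure :: (real^'n) measure)"
  interpret M: prob_space M unfolding M_def by (rule cube_prob_space)
  define g where "g = periodization f \<rho>"
  have gh: "g = (\<lambda>x. \<Sum>\<^sub>\<infinity>\<nu>\<in>int_lattice. f (\<rho> *v (x - \<nu>)))"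
    by (simp add: g_def periodization_def fun_eq_iff)
  have gm[measurable]: "g \<in> borel_measurable M" using L2 by (simp add: memL2_cube_def g_def M_def)
  have cube: "unit_cube \<inter> space lborel \<in> sets (lborel :: (real^'n) measure)" by (simp add: unit_cube_def)
  have g2: "integrable M (\<lambda>x. (norm (g x))\<^sup>2)"
    using L2 unfolding memL2_cube_def set_integrable_def M_def g_def by (subst integrable_restrict_space[OF cube]) simp
  have g1: "integrable M g" by (rule M.integrable_if_square_integrable[OF gm g2])
  have gc2: "integrable M (\<lambda>x. (norm (g x - c))\<^sup>2)"
  proof (rule Bochner_Integration.integrable_bound)
    show "integrable M (\<lambda>x. 2 * (norm (g x))\<^sup>2 + 2 * (norm c)\<^sup>2)" using g2 by simp
    have "(norm (z - c))\<^sup>2 \<le> 2 * (norm z)\<^sup>2 + 2 * (norm c)\<^sup>2" for z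
    proof -
      have "(norm (z - c))\<^sup>2 \<le> (norm z + norm c)\<^sup>2" by (intro power_mono norm_triangle_ineq4) simp
      also have "\<dots> \<le> 2 * (norm z)\<^sup>2 + 2 * (norm c)\<^sup>2"
        using zero_le_power2[of "norm z - norm c"] by (simp add: power2_diff power2_sum)
      finally show ?thesis .
    qed
    then show "AE x in M. norm ((norm (g x - c))\<^sup>2) \<le> norm (2 * (norm (g x))\<^sup>2 + 2 * (norm c)\<^sup>2)"
      by (auto simp: abs_of_nonneg add_nonneg_nonneg)
  qed measurable
  have coeff: "cube_coeff (\<lambda>x. g x - c) m = fourier f (\<rho> *v m)" if "m \<in> S" for m
  proof -
    have m: "m \<in> int_lattice" "m \<noteq> 0" "- m \<in> int_lattice" using S that by (auto simp: int_lattice_def)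
    have cm[measurable]: "(\<lambda>x. - (2 * pi * (x \<bullet> m))) \<in> borel_measurable M"
      unfolding M_def by (intro measurable_restrict_space1) measurable
    have cm'[measurable]: "(\<lambda>x. cis (- (2 * pi * (x \<bullet> m)))) \<in> borel_measurable M" by measurable
    have "cube_coeff (\<lambda>x. g x - c) m = (\<integral>x. g x * cis (- (2 * pi * (x \<bullet> m))) \<partial>M) - (\<integral>x. c * cis (- (2 * pi * (x \<bullet> m))) \<partial>M)"
      unfolding cube_coeff_def M_def[symmetric] left_diff_distrib
      by (intro Bochner_Integration.integral_diff integrable_mult_cis g1 cm M.integrable_const_bound[where B = "norm c"]) auto
    also have "(\<integral>x. c * cis (- (2 * pi * (x \<bullet> m))) \<partial>M) = c * (\<integral>x. cis (2 * pi * (x \<bullet> (- m))) \<partial>M)" by simp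
    also have "\<dots> = 0" using cube_orthonormal[OF m(3)] m(2) by (simp only: M_def) simp
    also have "(\<integral>x. g x * cis (- (2 * pi * (x \<bullet> m))) \<partial>M) = cube_coeff g m" by (simp add: cube_coeff_def M_def)
    also have "cube_coeff g m = fourier (\<lambda>x. f (\<rho> *v x)) m"
      unfolding gh
      by (rule cube_coeff_periodic_sum[where h = "\<lambda>x. f (\<rho> *v x)", OF orthogonal_integrable(1)[OF \<rho> f] m(1)])
        (use gm in \<open>simp add: gh M_def\<close>)
    finally show ?thesis by (simp add: orthogonal_integrable(2)[OF \<rho> f])
  qed
  have "(\<Sum>m\<in>S. (norm (fourier f (\<rho> *v m)))\<^sup>2) = (\<Sum>m\<in>S. (norm (cube_coeff (\<lambda>x. g x - c) m))\<^sup>2)"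
    by (intro sum.cong) (simp_all add: coeff)
  also have "\<dots> \<le> (\<integral>x. (norm (g x - c))\<^sup>2 \<partial>M)"
    unfolding M_def by (rule bessel_inequality[OF _ _ S(1,2)]) (use gm gc2 in \<open>auto simp: M_def\<close>)
  also have "\<dots> = L2_cube_sq (\<lambda>x. g x - c)"
    unfolding L2_cube_sq_def set_lebesgue_integral_def M_def by (subst integral_restrict_space[OF cube]) simp
  finally show ?thesis by (simp add: g_def)
qed

section \<open>Lattice points on spheres\<close>

definition lattice_sphere :: "nat \<Rightarrow> (real^'n) set" where
  "lattice_sphere k = {m \<in> int_lattice. (norm m)\<^sup>2 = real k}"

lemma norm_square_cart: "(norm (x :: real^'n))\<^sup>2 = (\<Sum>i\<in>UNIV. (x $ i)\<^sup>2)"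
  unfolding norm_vec_def L2_set_def by (simp add: sum_nonneg)

lemma finite_lattice_sphere: "finite (lattice_sphere k :: (real^'n) set)"
proof (rule finite_subset)
  let ?B = "vec_lambda ` (PiE (UNIV :: 'n set) (\<lambda>_. real_of_int ` {- int k..int k}))"
  show "finite ?B" by (intro finite_imageI finite_PiE) auto
  show "(lattice_sphere k :: (real^'n) set) \<subseteq> ?B"
  proof
    fix m :: "real^'n" assume m: "m \<in> lattice_sphere k"
    have "m $ i \<in> real_of_int ` {- int k..int k}" for i
    proof -
      obtain j where j: "m $ i = of_int j" using m by (auto simp: lattice_sphere_def int_lattice_def elim: Ints_cases)
      have "(m $ i)\<^sup>2 \<le> (\<Sum>i\<in>UNIV. (m $ i)\<^sup>2)" by (rule member_le_sum) auto
      also have "\<dots> = real k" using m by (simp add: lattice_sphere_def norm_square_cart)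
      finally have "real_of_int (j\<^sup>2) \<le> real_of_int (int k)" by (simp add: j)
      then have "j\<^sup>2 \<le> int k" by (simp only: of_int_le_iff)
      then have "\<bar>j\<bar> \<le> int k" by (rule abs_le_of_square_le)
      then show ?thesis unfolding j by (intro imageI) auto
    qed
    then have "m = vec_lambda (\<lambda>i. m $ i)" "(\<lambda>i. m $ i) \<in> PiE (UNIV :: 'n set) (\<lambda>_. real_of_int ` {- int k..int k})"
      by (auto simp: PiE_UNIV_domain)
    then show "m \<in> ?B" by blast
  qed
qed

text \<open>Four coordinates are taken odd and the others as multiples 4y of 4. The latter change k
  by 16q, which preserves the residue 4 mod 8; if 16q <= k/2, then u >= k/8 and at least 2k odd
  quadruples complete the point. About k^((d-4)/2) choices of y then give the exponent d/2 -
  1.\<close>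

lemma card_lattice_sphere_ge:
  assumes d4: "CARD('n) \<ge> 4" and k: "k mod 8 = 4"
  shows "real (card (lattice_sphere k :: (real^'n) set)) \<ge>
    2 * (1 / (32 * CARD('n))) powr ((real CARD('n) - 4) / 2) * real k powr (real CARD('n) / 2 - 1)"
proof -
  let ?d = "CARD('n)"
  obtain X :: "'n set" where X: "card X = 4" "finite X" using d4 by (metis obtain_subset_with_card_n finite)
  obtain i1 i2 i3 i4 where i: "X = {i1, i2, i3, i4}" "distinct [i1, i2, i3, i4]"
    using X by (auto simp: card_Suc_eq numeral_eq_Suc)
  define R where "R = - X"
  have cR: "card R = ?d - 4" "finite R" using X by (simp_all add: R_def Compl_eq_Diff_UNIV card_Diff_subset)
  have iR: "i1 \<notin> R" "i2 \<notin> R" "i3 \<notin> R" "i4 \<notin> R" using i by (auto simp: R_def)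
  \<comment> \<open>With all y at most s one gets 16q <= 16 d s^2 = k/2, so at least half of k
    remains for the odd coordinates.\<close>
  define s where "s = sqrt (real k / (32 * ?d))"
  define N where "N = nat \<lfloor>s\<rfloor>"
  have s0: "s \<ge> 0" by (simp add: s_def)
  have N: "real N \<le> s" "s < real N + 1" using s0 by (simp_all add: N_def)
  define Y where "Y = PiE R (\<lambda>_. {0..int N})"
  define q where "q y = (\<Sum>i\<in>R. (y i)\<^sup>2)" for y :: "'n \<Rightarrow> int"
  define Q where "Q y = odd_quads (int k - 16 * q y)" for y
  have finY: "finite Y" unfolding Y_def using cR by (intro finite_PiE) auto
  have qb: "32 * q y \<le> int k" "0 \<le> q y" if y: "y \<in> Y" for y
  proof -
    show "0 \<le> q y" unfolding q_def by (rule sum_nonneg) simp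
    have "q y \<le> (\<Sum>i\<in>R. (int N)\<^sup>2)" unfolding q_def
      using y by (intro sum_mono power_mono) (auto simp: Y_def PiE_iff)
    also have "\<dots> \<le> int ?d * (int N)\<^sup>2" using cR by (simp add: mult_right_mono)
    finally have "real_of_int (q y) \<le> real_of_int (int ?d * (int N)\<^sup>2)" by (simp only: of_int_le_iff)
    also have "\<dots> = real ?d * (real N)\<^sup>2" by simp
    also have "\<dots> \<le> real ?d * s\<^sup>2" using N(1) by (intro mult_left_mono power_mono) auto
    also have "\<dots> = real k / 32" using d4 by (simp add: s_def)
    finally have "real_of_int (32 * q y) \<le> real_of_int (int k)" by simp
    then show "32 * q y \<le> int k" by (simp only: of_int_le_iff)
  qed
  have Qcard: "2 * k \<le> card (Q y)" if y: "y \<in> Y" for y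
  proof -
    have "(int k - 16 * q y) mod 8 = 4" using k by presburger
    then have "\<exists>u. odd u \<and> int k - 16 * q y = 4 * u" by presburger
    then obtain u where u: "odd u" "int k - 16 * q y = 4 * u" by blast
    have "k > 0" using k by (cases k) auto
    have "8 * u \<ge> int k" using u(2) qb[OF y] by linarith
    then have "u > 0" "16 * u \<ge> 2 * int k" using \<open>k > 0\<close> by linarith+
    then have "int (card (Q y)) \<ge> 2 * int k" using card_odd_quads_ge[OF u(1)] u(2) by (simp add: Q_def)
    then show ?thesis by linarith
  qed
  define \<Phi> where "\<Phi> = (\<lambda>(y, a, b, c, d). (\<chi> i. real_of_int (if i = i1 then a else if i = i2 then b else if i = i3 then c else if i = i4 then d else 4 * y i)) :: real^'n)"
  have comp: "\<Phi> (y, a, b, c, d) $ i1 = a" "\<Phi> (y, a, b, c, d) $ i2 = b" "\<Phi> (y, a, b, c, d) $ i3 = c" "\<Phi> (y, a, b, c, d) $ i4 = d"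
    "i \<in> R \<Longrightarrow> \<Phi> (y, a, b, c, d) $ i = 4 * y i" for y a b c d i
    using i iR by (auto simp: \<Phi>_def)
  have "inj_on \<Phi> (Sigma Y Q)"
  proof (rule inj_onI)
    fix p p' assume p: "p \<in> Sigma Y Q" "p' \<in> Sigma Y Q" "\<Phi> p = \<Phi> p'"
    obtain y a b c d where 1: "p = (y, a, b, c, d)" by (metis prod_cases5)
    obtain y' a' b' c' d' where 2: "p' = (y', a', b', c', d')" by (metis prod_cases5)
    have e: "\<Phi> (y, a, b, c, d) $ i = \<Phi> (y', a', b', c', d') $ i" for i using p(3) 1 2 by simp
    have "a = a'" "b = b'" "c = c'" "d = d'" using e[of i1] e[of i2] e[of i3] e[of i4] by (simp_all add: comp)
    moreover have "y = y'"
    proof (rule PiE_ext[of y R "\<lambda>_. {0..int N}" y'])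
      show "y \<in> PiE R (\<lambda>_. {0..int N})" "y' \<in> PiE R (\<lambda>_. {0..int N})" using p 1 2 by (auto simp: Y_def)
      show "y i = y' i" if "i \<in> R" for i using e[of i] that by (simp add: comp)
    qed
    ultimately show "p = p'" using 1 2 by simp
  qed
  moreover have "\<Phi> ` Sigma Y Q \<subseteq> lattice_sphere k"
  proof
    fix m assume "m \<in> \<Phi> ` Sigma Y Q"
    then obtain y a b c d where m: "m = \<Phi> (y, a, b, c, d)" "y \<in> Y" "(a, b, c, d) \<in> Q y" by auto
    have "m \<in> int_lattice" unfolding m(1) int_lattice_def \<Phi>_def by auto
    moreover have "(norm m)\<^sup>2 = real k"
    proof -
      have "(norm m)\<^sup>2 = (\<Sum>i\<in>X. (m $ i)\<^sup>2) + (\<Sum>i\<in>R. (m $ i)\<^sup>2)"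
        unfolding norm_square_cart R_def by (subst sum.union_disjoint[symmetric]) auto
      also have "(\<Sum>i\<in>X. (m $ i)\<^sup>2) = real_of_int (a\<^sup>2 + b\<^sup>2 + c\<^sup>2 + d\<^sup>2)"
        unfolding i(1) m(1) using i(2) by (simp add: comp)
      also have "a\<^sup>2 + b\<^sup>2 + c\<^sup>2 + d\<^sup>2 = int k - 16 * q y" using m(3) by (simp add: Q_def odd_quads_def)
      also have "(\<Sum>i\<in>R. (m $ i)\<^sup>2) = real_of_int (16 * q y)"
        unfolding m(1) q_def by (simp add: comp power_mult_distrib sum_distrib_left)
      finally show ?thesis by simp
    qed
    ultimately show "m \<in> lattice_sphere k" by (simp add: lattice_sphere_def)
  qed
  ultimately have "card (Sigma Y Q) \<le> card (lattice_sphere k :: (real^'n) set)"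
    by (metis card_inj_on_le finite_lattice_sphere)
  moreover have "card (Sigma Y Q) = (\<Sum>y\<in>Y. card (Q y))"
    by (rule card_SigmaI[OF finY]) (simp add: Q_def finite_odd_quads)
  moreover have "(\<Sum>y\<in>Y. card (Q y)) \<ge> (\<Sum>y\<in>Y. 2 * k)" by (intro sum_mono Qcard)
  ultimately have c1: "card Y * (2 * k) \<le> card (lattice_sphere k :: (real^'n) set)" by simp
  have cY: "card Y = (N + 1) ^ (?d - 4)"
  proof -
    have "card {0..int N} = N + 1" by (simp add: nat_add_distrib)
    then show ?thesis unfolding Y_def card_PiE[OF cR(2)] by (simp only: prod_constant cR(1))
  qed
  have k0: "real k > 0" using k by (cases k) auto
  have s1: "s > 0" using k0 d4 by (simp add: s_def)
  \<comment> \<open>Counting from 0 gives N + 1 > s values per coordinate, so the bound survives for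
    small k, when N = 0.\<close>
  have "s ^ (?d - 4) \<le> (real N + 1) ^ (?d - 4)" using N(2) s0 by (intro power_mono) auto
  then have "s ^ (?d - 4) * (2 * real k) \<le> real (card Y * (2 * k))" using cY by (simp add: add.commute mult_right_mono)
  also have "\<dots> \<le> real (card (lattice_sphere k :: (real^'n) set))" using c1 by (simp only: of_nat_le_iff)
  finally have "s ^ (?d - 4) * (2 * real k) \<le> real (card (lattice_sphere k :: (real^'n) set))" .
  moreover have "s ^ (?d - 4) * (2 * real k) = 2 * (1 / (32 * ?d)) powr ((real ?d - 4) / 2) * real k powr (real ?d / 2 - 1)"
  proof -
    have "s ^ (?d - 4) = s powr (real ?d - 4)" using s1 d4 by (simp add: powr_realpow[symmetric] of_nat_diff)
    also have "\<dots> = (1 / (32 * ?d) * real k) powr ((real ?d - 4) / 2)"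
      using k0 d4 by (simp add: s_def powr_half_sqrt[symmetric] powr_powr)
    also have "\<dots> = (1 / (32 * ?d)) powr ((real ?d - 4) / 2) * real k powr ((real ?d - 4) / 2)"
      by (rule powr_mult) 
    finally have "s ^ (?d - 4) * (2 * real k) = 2 * (1 / (32 * ?d)) powr ((real ?d - 4) / 2) * (real k powr ((real ?d - 4) / 2) * real k powr 1)"
      using k0 by simp
    also have "real k powr ((real ?d - 4) / 2) * real k powr 1 = real k powr (real ?d / 2 - 1)"
      unfolding powr_add[symmetric] by (simp add: diff_divide_distrib)
    finally show ?thesis .
  qed
  ultimately show ?thesis by simp
qed

section \<open>The energy estimate\<close>

text \<open>In the double sum for the Fejer kernel the pair (i, j) produces the form with
  \<open>b = (i - j) / 4\<close>. The N diagonal terms, each divided by N, add up to the energy; the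
  others are errors controlled by row sums.\<close>

lemma fejer_gauss_integral:
  fixes f :: "'a::euclidean_space \<Rightarrow> complex"
  assumes a: "a > 0" and f: "integrable lborel f" and N: "N > 0"
    and E: "\<And>l::nat. l > 0 \<Longrightarrow> norm (bform a (real l / 4) f f) \<le> E l" and Es: "summable E" "\<And>l. E l \<ge> 0"
  shows "energy a f - 2 * (\<Sum>l. E l) \<le>
      (\<integral>\<xi>. (norm (fourier f \<xi>))\<^sup>2 * (exp (- pi * a * (norm \<xi>)\<^sup>2) * fejer N (pi * ((norm \<xi>)\<^sup>2 - 4) / 4)) \<partial>lborel)"
    and "integrable lborel (\<lambda>\<xi>. (norm (fourier f \<xi>))\<^sup>2 * (exp (- pi * a * (norm \<xi>)\<^sup>2) * fejer N (pi * ((norm \<xi>)\<^sup>2 - 4) / 4)))"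
proof -
  let ?W = "\<lambda>\<xi>. (norm (fourier f \<xi>))\<^sup>2 * (exp (- pi * a * (norm \<xi>)\<^sup>2) * fejer N (pi * ((norm \<xi>)\<^sup>2 - 4) / 4))"
  let ?b = "\<lambda>i j::nat. (real i - real j) / 4"
  \<comment> \<open>The unimodular phase comes from centring the kernel at 4.\<close>
  let ?u = "\<lambda>i j::nat. cis (- ((real i - real j) * pi)) / of_nat N"
  let ?T = "\<lambda>i j \<xi>. ?u i j * (fourier f \<xi> * (cnj (fourier f \<xi>) * gauss a (?b i j) \<xi>))"
  have W: "complex_of_real (?W \<xi>) = (\<Sum>i<N. \<Sum>j<N. ?T i j \<xi>)" for \<xi>
  proof -
    have c: "cis ((real i - real j) * (pi * ((norm \<xi>)\<^sup>2 - 4) / 4)) = cis (- ((real i - real j) * pi)) * cis (pi * ?b i j * (norm \<xi>)\<^sup>2)" for i j :: nat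
      unfolding cis_mult by (rule arg_cong[where f = cis]) (simp add: field_simps)
    have "complex_of_real (?W \<xi>) = (fourier f \<xi> * cnj (fourier f \<xi>)) * (of_real (exp (- pi * a * (norm \<xi>)\<^sup>2)) * complex_of_real (fejer N (pi * ((norm \<xi>)\<^sup>2 - 4) / 4)))"
      by (simp only: of_real_mult complex_norm_square)
    also have "\<dots> = (\<Sum>i<N. \<Sum>j<N. ?T i j \<xi>)"
      unfolding fejer_double_sum c gauss_def
      by (simp add: sum_distrib_left sum_divide_distrib mult_ac)
    finally show ?thesis .
  qed
  have Ti: "integrable lborel (?T i j)" for i j
    by (intro integrable_mult_right integrable_bform[OF a f f])
  have Tv: "(\<integral>\<xi>. ?T i j \<xi> \<partial>lborel) = ?u i j * bform a (?b i j) f f" for i j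
    unfolding bform_def by (rule Bochner_Integration.integral_mult_right_zero)
  have "integrable lborel (\<lambda>\<xi>. complex_of_real (?W \<xi>))"
    unfolding W by (intro Bochner_Integration.integrable_sum Ti)
  then show Wi: "integrable lborel ?W" unfolding complex_of_real_integrable_eq .
  have "complex_of_real (\<integral>\<xi>. ?W \<xi> \<partial>lborel) = (\<integral>\<xi>. complex_of_real (?W \<xi>) \<partial>lborel)" by (rule integral_complex_of_real[symmetric])
  also have "\<dots> = (\<Sum>i<N. \<Sum>j<N. ?u i j * bform a (?b i j) f f)"
    unfolding W Tv[symmetric]
    by (subst Bochner_Integration.integral_sum, intro Bochner_Integration.integrable_sum Ti)
      (intro sum.cong refl Bochner_Integration.integral_sum Ti)
  finally have val: "(\<integral>\<xi>. ?W \<xi> \<partial>lborel) = (\<Sum>i<N. \<Sum>j<N. Re (?u i j * bform a (?b i j) f f))"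
    by (metis (no_types, lifting) Re_complex_of_real Re_sum sum.cong)
  \<comment> \<open>Replacing b by -b conjugates the form, so negative frequencies need no separate
    bound.\<close>
  have conj: "norm (bform a (- b) f f) = norm (bform a b f f)" for b
  proof -
    have "bform a (- b) f f = (\<integral>\<xi>. cnj (fourier f \<xi> * (cnj (fourier f \<xi>) * gauss a b \<xi>)) \<partial>lborel)"
      unfolding bform_def by (rule Bochner_Integration.integral_cong) (auto simp: gauss_def cis_cnj mult_ac)
    also have "\<dots> = cnj (bform a b f f)" unfolding bform_def by (rule Bochner_Integration.integral_cnj)
    finally show ?thesis by simp
  qed
  have off: "norm (bform a (?b i j) f f) \<le> E (nat \<bar>int i - int j\<bar>)" if "i \<noteq> j" for i j
  proof -
    let ?l = "nat \<bar>int i - int j\<bar>"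
    have "norm (bform a (?b i j) f f) = norm (bform a (real ?l / 4) f f)"
    proof (cases "i > j")
      case True
      then have "?b i j = real ?l / 4" by simp
      then show ?thesis by (simp only:)
    next
      case False
      then have "?b i j = - (real ?l / 4)" by (simp add: field_simps)
      then show ?thesis by (simp only: conj)
    qed
    then show ?thesis using E[of ?l] that by simp
  qed
  \<comment> \<open>Each positive l equals |i - j| for at most two values of j.\<close>
  have row: "(\<Sum>j\<in>{..<N} - {i}. E (nat \<bar>int i - int j\<bar>)) \<le> 2 * (\<Sum>l. E l)" for i
  proof -
    have "(\<Sum>j\<in>{..<N} - {i}. E (nat \<bar>int i - int j\<bar>)) = (\<Sum>j\<in>{..<N} \<inter> {..<i}. E (nat \<bar>int i - int j\<bar>)) + (\<Sum>j\<in>{..<N} \<inter> {i<..}. E (nat \<bar>int i - int j\<bar>))"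
      by (subst sum.union_disjoint[symmetric]) (auto intro!: sum.cong)
    also have "(\<Sum>j\<in>{..<N} \<inter> {..<i}. E (nat \<bar>int i - int j\<bar>)) = (\<Sum>l\<in>(\<lambda>j. i - j) ` ({..<N} \<inter> {..<i}). E l)"
      by (subst sum.reindex) (auto simp: inj_on_def nat_diff_distrib' intro!: sum.cong arg_cong[where f = E])
    also have "(\<Sum>j\<in>{..<N} \<inter> {i<..}. E (nat \<bar>int i - int j\<bar>)) = (\<Sum>l\<in>(\<lambda>j. j - i) ` ({..<N} \<inter> {i<..}). E l)"
      by (subst sum.reindex) (auto simp: inj_on_def intro!: sum.cong arg_cong[where f = E])
    also have "(\<Sum>l\<in>(\<lambda>j. i - j) ` ({..<N} \<inter> {..<i}). E l) + (\<Sum>l\<in>(\<lambda>j. j - i) ` ({..<N} \<inter> {i<..}). E l) \<le> (\<Sum>l. E l) + (\<Sum>l. E l)"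
      by (intro add_mono sum_le_suminf Es) (auto simp: Es)
    finally show ?thesis by simp
  qed
  have diag: "Re (?u i i * bform a (?b i i) f f) = energy a f / N" for i
    using bform_real(1)[OF a f] by (simp add: energy_def)
  have "(\<Sum>i<N. (energy a f - 2 * (\<Sum>l. E l)) / N) \<le> (\<Sum>i<N. \<Sum>j<N. Re (?u i j * bform a (?b i j) f f))"
  proof (rule sum_mono)
    fix i assume i: "i \<in> {..<N}"
    let ?R = "\<lambda>j. Re (?u i j * bform a (?b i j) f f)"
    have "- (\<Sum>j\<in>{..<N} - {i}. ?R j) \<le> (\<Sum>j\<in>{..<N} - {i}. E (nat \<bar>int i - int j\<bar>) / N)"
      unfolding sum_negf[symmetric]
    proof (rule sum_mono)
      fix j assume j: "j \<in> {..<N} - {i}"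
      have "- ?R j \<le> norm (?u i j * bform a (?b i j) f f)"
        using abs_Re_le_cmod[of "?u i j * bform a (?b i j) f f"] by linarith
      also have "\<dots> = norm (bform a (?b i j) f f) / N" by (simp add: norm_mult norm_divide)
      also have "\<dots> \<le> E (nat \<bar>int i - int j\<bar>) / N" using off[of i j] j by (intro divide_right_mono) auto
      finally show "- ?R j \<le> E (nat \<bar>int i - int j\<bar>) / N" .
    qed
    also have "\<dots> \<le> 2 * (\<Sum>l. E l) / N"
      unfolding sum_divide_distrib[symmetric] by (intro divide_right_mono row) simp
    finally have "- (\<Sum>j\<in>{..<N} - {i}. ?R j) \<le> 2 * (\<Sum>l. E l) / N" .
    moreover have "(\<Sum>j<N. ?R j) = ?R i + (\<Sum>j\<in>{..<N} - {i}. ?R j)" using i by (intro sum.remove) auto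
    moreover have "?R i = energy a f / N" by (rule diag)
    ultimately show "(energy a f - 2 * (\<Sum>l. E l)) / N \<le> (\<Sum>j<N. ?R j)" unfolding diff_divide_distrib by linarith
  qed
  then show "energy a f - 2 * (\<Sum>l. E l) \<le> (\<integral>\<xi>. ?W \<xi> \<partial>lborel)"
    unfolding val using N by simp
qed

lemma summable_powr_exp:
  fixes \<alpha> c :: real
  assumes c: "c > 0"
  shows "summable (\<lambda>j::nat. (8 * real j + 8) powr \<alpha> * exp (- (c * (8 * real j))))"
proof (rule summable_comparison_test_bigo)
  show "summable (\<lambda>j::nat. norm (1 / real j ^ 2))" using inverse_power_summable[of 2, where 'a = real] by (simp add: inverse_eq_divide)
  show "(\<lambda>j::nat. (8 * real j + 8) powr \<alpha> * exp (- (c * (8 * real j)))) \<in> O(\<lambda>j. 1 / real j ^ 2)"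
    using c by real_asymp
qed

context haar
begin

text \<open>By \<open>haar_radial\<close> the choice of the unit vector is immaterial.\<close>
definition sphere_mean :: "(real^'n \<Rightarrow> real) \<Rightarrow> real \<Rightarrow> real" where
  "sphere_mean F t = (\<integral>\<rho>. F (\<rho> *v (sqrt t *\<^sub>R axis undefined 1)) \<partial>\<mu>)"

lemma sphere_mean_facts:
  fixes F :: "real^'n \<Rightarrow> real"
  assumes F: "continuous_on UNIV F" "\<And>x. F x \<ge> 0" "\<And>x. F x \<le> B"
  shows "continuous_on UNIV (sphere_mean F)" "sphere_mean F t \<ge> 0" "sphere_mean F t \<le> B"
    and "(\<integral>\<^sup>+\<rho>. F (\<rho> *v (sqrt t *\<^sub>R axis undefined 1)) \<partial>\<mu>) = ennreal (sphere_mean F t)"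
proof -
  have [measurable]: "F \<in> borel_measurable borel" by (rule borel_measurable_continuous_onI[OF F(1)])
  let ?e = "axis undefined 1 :: real^'n"
  have int: "integrable \<mu> (\<lambda>\<rho>. F (\<rho> *v (sqrt t *\<^sub>R ?e)))" for t
    by (rule integrable_const_bound[where B = B]) (use F in auto)
  show "sphere_mean F t \<ge> 0" unfolding sphere_mean_def by (rule Bochner_Integration.integral_nonneg) (use F in auto)
  have "sphere_mean F t \<le> (\<integral>\<rho>. B \<partial>\<mu>)" unfolding sphere_mean_def by (rule integral_mono) (use int F in auto)
  then show "sphere_mean F t \<le> B" by (simp add: prob_space)
  show "(\<integral>\<^sup>+\<rho>. F (\<rho> *v (sqrt t *\<^sub>R ?e)) \<partial>\<mu>) = ennreal (sphere_mean F t)"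
    unfolding sphere_mean_def by (rule nn_integral_eq_integral[OF int]) (use F in auto)
  show "continuous_on UNIV (sphere_mean F)"
  proof (rule continuous_at_imp_continuous_on, intro ballI, unfold continuous_at_sequentially, intro allI impI)
    fix t and X :: "nat \<Rightarrow> real" assume X: "X \<longlonglongrightarrow> t"
    show "(sphere_mean F \<circ> X) \<longlonglongrightarrow> sphere_mean F t"
      unfolding sphere_mean_def comp_def
    proof (rule integral_dominated_convergence[where w = "\<lambda>_. B"])
      have "continuous_on UNIV (\<lambda>t. F (\<rho> *v (sqrt t *\<^sub>R ?e)))" for \<rho>
        by (rule continuous_on_compose2[OF F(1)]) (auto intro!: continuous_intros)
      then have "isCont (\<lambda>t. F (\<rho> *v (sqrt t *\<^sub>R ?e))) t" for \<rho> by (simp add: continuous_on_eq_continuous_at)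
      then show "AE \<rho> in \<mu>. (\<lambda>n. F (\<rho> *v (sqrt (X n) *\<^sub>R ?e))) \<longlonglongrightarrow> F (\<rho> *v (sqrt t *\<^sub>R ?e))"
        using isCont_tendsto_compose[OF _ X] by blast
    qed (use F in \<open>auto simp: abs_of_nonneg\<close>)
  qed
qed

text \<open>All points of one lattice sphere have the same Haar mean, so each sphere contributes its
  cardinality times that mean. The constant subtracted in Bessel's inequality may vary with
  \<rho>.\<close>

lemma lattice_energy_bound:
  fixes f :: "real^'n \<Rightarrow> complex" and c :: "real^'n^'n \<Rightarrow> complex"
  assumes d4: "CARD('n) \<ge> 4" and f: "integrable lborel f"
    and L2: "AE \<rho> in \<mu>. memL2_cube (periodization f \<rho>)"
    and A: "(\<integral>\<^sup>+\<rho>. ennreal (L2_cube_sq (\<lambda>x. periodization f \<rho> x - c \<rho>)) \<partial>\<mu>) \<le> ennreal A" and A0: "A \<ge> 0"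
  shows "(\<Sum>j<J. real (card (lattice_sphere (8 * j + 4) :: (real^'n) set)) * sphere_mean (\<lambda>\<xi>. (norm (fourier f \<xi>))\<^sup>2) (8 * real j + 4)) \<le> A"
proof -
  have [measurable]: "f \<in> borel_measurable borel" using f by auto
  let ?F = "\<lambda>\<xi>. (norm (fourier f \<xi>))\<^sup>2" and ?k = "\<lambda>j::nat. 8 * j + 4" and ?L = "\<lambda>k. lattice_sphere k :: (real^'n) set"
  define B where "B = (L1_norm f)"
  have F: "continuous_on UNIV ?F" "\<And>\<xi>. ?F \<xi> \<ge> 0" "\<And>\<xi>. ?F \<xi> \<le> B\<^sup>2"
    using continuous_fourier[OF f] norm_fourier_le[of f] by (auto simp: B_def intro!: continuous_intros power_mono)
  define S where "S = (\<Union>j<J. ?L (?k j))"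
  have S: "finite S" "S \<subseteq> int_lattice" "0 \<notin> S"
    unfolding S_def by (simp add: finite_lattice_sphere, auto simp: lattice_sphere_def)
  have mean: "(\<integral>\<^sup>+\<rho>. ennreal (?F (\<rho> *v m)) \<partial>\<mu>) = ennreal (sphere_mean ?F (8 * real j + 4))" if "m \<in> ?L (?k j)" for m j
  proof -
    have "(norm m)\<^sup>2 = 8 * real j + 4" using that by (simp add: lattice_sphere_def)
    then have "norm m = sqrt (8 * real j + 4)" by (metis norm_ge_zero real_sqrt_unique)
    then have "norm m = norm (sqrt (8 * real j + 4) *\<^sub>R (axis undefined 1 :: real^'n))" by simp
    then have "(\<integral>\<^sup>+\<rho>. ennreal (?F (\<rho> *v m)) \<partial>\<mu>) = (\<integral>\<^sup>+\<rho>. ennreal (?F (\<rho> *v (sqrt (8 * real j + 4) *\<^sub>R axis undefined 1))) \<partial>\<mu>)"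
      by (intro haar_radial) (use d4 in auto)
    also have "\<dots> = ennreal (sphere_mean ?F (8 * real j + 4))" by (rule sphere_mean_facts(4)[OF F])
    finally show ?thesis .
  qed
  have "ennreal (\<Sum>j<J. real (card (?L (?k j))) * sphere_mean ?F (8 * real j + 4)) = (\<Sum>j<J. \<Sum>m\<in>?L (?k j). ennreal (sphere_mean ?F (8 * real j + 4)))"
    by (simp add: sum_ennreal[symmetric] ennreal_mult sphere_mean_facts(2)[OF F] ennreal_of_nat_eq_real_of_nat)
  also have "\<dots> = (\<Sum>j<J. \<Sum>m\<in>?L (?k j). \<integral>\<^sup>+\<rho>. ennreal (?F (\<rho> *v m)) \<partial>\<mu>)"
    by (intro sum.cong refl mean[symmetric])
  also have "\<dots> = (\<Sum>m\<in>S. \<integral>\<^sup>+\<rho>. ennreal (?F (\<rho> *v m)) \<partial>\<mu>)"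
    unfolding S_def
  proof (rule sum.UNION_disjoint[symmetric])
    show "\<forall>i\<in>{..<J}. \<forall>j\<in>{..<J}. i \<noteq> j \<longrightarrow> ?L (?k i) \<inter> ?L (?k j) = {}"
      by (auto simp: lattice_sphere_def)
  qed (auto simp: finite_lattice_sphere)
  also have "\<dots> = (\<integral>\<^sup>+\<rho>. (\<Sum>m\<in>S. ennreal (?F (\<rho> *v m))) \<partial>\<mu>)"
    by (rule nn_integral_sum[symmetric]) measurable
  also have "\<dots> \<le> (\<integral>\<^sup>+\<rho>. ennreal (L2_cube_sq (\<lambda>x. periodization f \<rho> x - c \<rho>)) \<partial>\<mu>)"
  proof (rule nn_integral_mono_AE)
    show "AE \<rho> in \<mu>. (\<Sum>m\<in>S. ennreal (?F (\<rho> *v m))) \<le> ennreal (L2_cube_sq (\<lambda>x. periodization f \<rho> x - c \<rho>))"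
      using L2 AE_space
    proof eventually_elim
      case (elim \<rho>)
      then have \<rho>: "\<rho> \<in> SO" by (simp add: space_haar)
      have "(\<Sum>m\<in>S. ?F (\<rho> *v m)) \<le> L2_cube_sq (\<lambda>x. periodization f \<rho> x - c \<rho>)"
        by (rule periodization_bessel[OF \<rho> f elim(1) S])
      then show ?case by (simp add: sum_ennreal ennreal_leI)
    qed
  qed
  also have "\<dots> \<le> ennreal A" by (rule A)
  finally show ?thesis using A0 by (simp add: ennreal_le_iff)
qed

lemma energy_bound:
  fixes f :: "real^'n \<Rightarrow> complex" and c :: "real^'n^'n \<Rightarrow> complex"
  assumes d4: "CARD('n) \<ge> 4" and f: "integrable lborel f"
    and L2: "AE \<rho> in \<mu>. memL2_cube (periodization f \<rho>)"
    and A: "(\<integral>\<^sup>+\<rho>. ennreal (L2_cube_sq (\<lambda>x. periodization f \<rho> x - c \<rho>)) \<partial>\<mu>) \<le> ennreal A" and A0: "A \<ge> 0"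
    and a: "a > 0" and E: "\<And>l::nat. l > 0 \<Longrightarrow> norm (bform a (real l / 4) f f) \<le> E l" and Es: "summable E" "\<And>l. E l \<ge> 0"
  shows "energy a f \<le> 2 * (\<Sum>l. E l) + 4 * radial_const CARD('n) * (32 * CARD('n)) powr ((real CARD('n) - 4) / 2) * A"
proof -
  have [measurable]: "f \<in> borel_measurable borel" using f by auto
  let ?d = "CARD('n)" and ?F = "\<lambda>\<xi>. (norm (fourier f \<xi>))\<^sup>2" and ?e = "axis undefined 1 :: real^'n"
  let ?w = "\<lambda>N t. exp (- pi * a * t) * fejer N (pi * (t - 4) / 4)"
  define R where "R = radial_const ?d"
  define \<alpha> where "\<alpha> = real ?d / 2 - 1"
  define B where "B = (L1_norm f)"
  define c1 where "c1 = 2 * (1 / (32 * ?d)) powr ((real ?d - 4) / 2)"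
  have R0: "R \<ge> 0" by (simp add: R_def radial_const_def)
  have \<alpha>: "\<alpha> > 0" using d4 by (simp add: \<alpha>_def)
  have c1: "c1 > 0" using d4 by (simp add: c1_def)
  have F: "continuous_on UNIV ?F" "\<And>\<xi>. ?F \<xi> \<ge> 0" "\<And>\<xi>. ?F \<xi> \<le> B\<^sup>2"
    using continuous_fourier[OF f] norm_fourier_le[of f] by (auto simp: B_def intro!: continuous_intros power_mono)
  define m where "m = sphere_mean ?F"
  note sm = sphere_mean_facts[OF F, folded m_def]
  \<comment> \<open>The radial density of the damped energy, extended by 0 to t <= 0;
    \<open>max\<close> keeps it continuous, as \<alpha> > 0.\<close>
  define H where "H t = R * max t 0 powr \<alpha> * exp (- pi * a * t) * m t" for t
  have H0: "H t \<ge> 0" for t using R0 sm(2) by (simp add: H_def)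
  have Hneg: "H t = 0" if "t \<le> 0" for t using that by (simp add: H_def max_def)
  have Hcont: "continuous_on UNIV H" unfolding H_def
    by (intro continuous_intros continuous_on_powr' sm(1)) (use \<alpha> in auto)
  \<comment> \<open>On the block the increasing power is bounded at the right end and the decreasing
    exponential at the left end.\<close>
  define Bj where "Bj j = (R * B\<^sup>2) * ((8 * real j + 8) powr \<alpha> * exp (- (pi * a * (8 * real j))))" for j :: nat
  have HB: "H t \<le> Bj j" if t: "t \<in> {8 * real j..8 * real j + 8}" for j t
  proof -
    have "t \<ge> 0" using t by (auto intro: order.trans[of 0 "8 * real j"])
    have "H t \<le> R * (8 * real j + 8) powr \<alpha> * exp (- pi * a * (8 * real j)) * B\<^sup>2"
      unfolding H_def using t R0 sm(2,3) \<alpha> a \<open>t \<ge> 0\<close>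
      by (intro mult_mono powr_mono2) (auto intro!: mult_nonneg_nonneg)
    then show ?thesis by (simp add: Bj_def mult_ac)
  qed
  have "summable Bj" unfolding Bj_def by (intro summable_mult summable_powr_exp) (use a in auto)
  \<comment> \<open>If \<open>Q\<close> is negative, \<open>ennreal Q\<close> is 0 and the lower
    bound below is trivial.\<close>
  define Q where "Q = energy a f - 2 * (\<Sum>l. E l)"
  have Q: "ennreal Q \<le> (\<integral>\<^sup>+t. ennreal (H t * fejer (Suc N) (pi * (t - 4) / 4)) \<partial>lborel)" for N
  proof -
    note fg = fejer_gauss_integral[OF a f zero_less_Suc[of N] E Es]
    have "ennreal Q \<le> ennreal (\<integral>\<xi>. ?F \<xi> * ?w (Suc N) ((norm \<xi>)\<^sup>2) \<partial>lborel)"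
      unfolding Q_def by (rule ennreal_leI[OF fg(1)])
    also have "\<dots> = (\<integral>\<^sup>+\<xi>. ennreal (?F \<xi> * ?w (Suc N) ((norm \<xi>)\<^sup>2)) \<partial>lborel)"
      by (rule nn_integral_eq_integral[symmetric, OF fg(2)]) (assumption | intro AE_I2 mult_nonneg_nonneg | simp)+
    also have "\<dots> = (\<integral>\<^sup>+\<xi>. ennreal (?F \<xi>) * ennreal (?w (Suc N) ((norm \<xi>)\<^sup>2)) \<partial>lborel)"
      by (simp add: ennreal_mult)
    also have "\<dots> = (\<integral>\<^sup>+t. ennreal (R * (if t > 0 then t powr \<alpha> else 0)) * (ennreal (?w (Suc N) t) * (\<integral>\<^sup>+\<rho>. ?F (\<rho> *v (sqrt t *\<^sub>R ?e)) \<partial>\<mu>)) \<partial>lborel)"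
      unfolding R_def \<alpha>_def
      by (rule nn_integral_polar[where F = "\<lambda>\<xi>. ennreal (?F \<xi>)" and w = "\<lambda>t. ennreal (?w (Suc N) t)"]) (use d4 in auto)
    also have "\<dots> = (\<integral>\<^sup>+t. ennreal (H t * fejer (Suc N) (pi * (t - 4) / 4)) \<partial>lborel)"
    proof (rule nn_integral_cong)
      fix t :: real
      have "(if t > 0 then t powr \<alpha> else 0) = max t 0 powr \<alpha>" by (auto simp: max_def)
      then have "ennreal (R * (if t > 0 then t powr \<alpha> else 0)) * (ennreal (?w (Suc N) t) * ennreal (m t)) = ennreal ((R * max t 0 powr \<alpha>) * (?w (Suc N) t * m t))"
        using R0 sm(2)[of t] by (simp only: ennreal_mult mult_nonneg_nonneg fejer_nonneg exp_ge_zero powr_ge_zero)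
      also have "(R * max t 0 powr \<alpha>) * (?w (Suc N) t * m t) = H t * fejer (Suc N) (pi * (t - 4) / 4)"
        by (simp add: H_def mult_ac)
      finally show "ennreal (R * (if t > 0 then t powr \<alpha> else 0)) * (ennreal (?w (Suc N) t) * (\<integral>\<^sup>+\<rho>. ?F (\<rho> *v (sqrt t *\<^sub>R ?e)) \<partial>\<mu>)) = ennreal (H t * fejer (Suc N) (pi * (t - 4) / 4))"
        by (simp only: sm(4))
    qed
    finally show ?thesis .
  qed
  note samp = fejer_sampling_bound[OF Hcont H0 Hneg \<open>summable Bj\<close> HB Q]
  have "(\<Sum>j. H (8 * real j + 4)) \<le> R / c1 * A"
  proof (rule suminf_le_const[OF samp(1)])
    fix J
    have "(\<Sum>j<J. H (8 * real j + 4)) \<le> (\<Sum>j<J. R / c1 * (real (card (lattice_sphere (8 * j + 4) :: (real^'n) set)) * m (8 * real j + 4)))"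
    proof (rule sum_mono)
      fix j
      let ?t = "8 * real j + 4" and ?c = "real (card (lattice_sphere (8 * j + 4) :: (real^'n) set))"
      \<comment> \<open>The number of lattice points on the sphere dominates the radial weight at
        the sample point; the damping factor is then bounded by 1.\<close>
      have "c1 * real (8 * j + 4) powr \<alpha> \<le> ?c"
        unfolding c1_def \<alpha>_def by (rule card_lattice_sphere_ge[OF d4]) simp
      then have l: "?t powr \<alpha> \<le> ?c / c1" using c1 by (simp add: field_simps)
      have "H ?t = R * ?t powr \<alpha> * exp (- pi * a * ?t) * m ?t" by (simp add: H_def)
      also have "\<dots> \<le> R * (?c / c1) * 1 * m ?t"
        using l R0 sm(2)[of ?t] a c1 by (intro mult_mono) (auto intro!: mult_nonneg_nonneg)
      finally show "H ?t \<le> R / c1 * (?c * m ?t)" by (simp add: mult_ac)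
    qed
    also have "\<dots> \<le> R / c1 * A"
      unfolding sum_distrib_left[symmetric] m_def
      by (intro mult_left_mono lattice_energy_bound[OF d4 f L2 A A0]) (use R0 c1 in auto)
    finally show "(\<Sum>j<J. H (8 * real j + 4)) \<le> R / c1 * A" .
  qed
  then have "Q \<le> 8 * (R / c1 * A)" using samp(2) by linarith
  \<comment> \<open>The 8 is the kernel mass per sample; dividing by the factor 2 in
    \<open>c1\<close> leaves 4.\<close>
  also have "8 * (R / c1 * A) = 4 * R * (32 * ?d) powr ((real ?d - 4) / 2) * A"
    using d4 by (simp add: c1_def powr_divide)
  finally show ?thesis by (simp add: Q_def R_def)
qed

end

theorem theorem2:
  fixes p :: real
  assumes d4: "CARD('n) \<ge> 4"
    and p1: "1 \<le> p" and p2: "p < 2 * CARD('n) / (CARD('n) + 2)"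
  shows "\<exists>C>0. \<forall>\<mu> :: (real^'n^'n) measure. haar_SO \<mu> \<longrightarrow>
    (\<forall>f :: real^'n \<Rightarrow> complex.
       memLp 1 f \<and> memLp p f \<and>
       (AE \<rho> in \<mu>. memL2_cube (periodization f \<rho>)) \<and>
       (\<integral>\<^sup>+\<rho>. ennreal (L2_cube_sq (periodization f \<rho>)) \<partial>\<mu>) < \<infinity>
       \<longrightarrow> memLp 2 f \<and>
           Lp_norm 2 f \<le> C * (sqrt (enn2real (\<integral>\<^sup>+\<rho>. ennreal (L2_cube_sq (periodization f \<rho>)) \<partial>\<mu>))
                              + Lp_norm p f)) \<and>
    (\<forall>f :: real^'n \<Rightarrow> complex.
       memLp 1 f \<and> memLp p f \<and>
       (AE \<rho> in \<mu>. memL2_cube (periodization f \<rho>)) \<and>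
       (\<integral>\<^sup>+\<rho>. ennreal (L2_cube_sq (\<lambda>x. periodization f \<rho> x - fourier0 (periodization f \<rho>))) \<partial>\<mu>) < \<infinity>
       \<longrightarrow> memLp 2 f \<and>
           Lp_norm 2 f \<le> C * (sqrt (enn2real (\<integral>\<^sup>+\<rho>. ennreal (L2_cube_sq (\<lambda>x. periodization f \<rho> x - fourier0 (periodization f \<rho>))) \<partial>\<mu>))
                              + Lp_norm p f))"
proof -
  obtain C \<kappa> where C: "C > 0" "\<kappa> > 1"
    and decay: "\<And>(f :: real^'n \<Rightarrow> complex) a l. integrable lborel f \<Longrightarrow> integrable lborel (\<lambda>x. norm (f x) powr p) \<Longrightarrow> a > 0 \<Longrightarrow> l > 0 \<Longrightarrow>
      norm (bform a (real l / 4) f f) \<le> C * real l powr (- \<kappa>) * ((\<integral>x. norm (f x) powr p \<partial>lborel) powr (1 / p))\<^sup>2"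
    by (rule bform_decay[where 'a = "real^'n", of p]) (use p1 p2 in auto)
  \<comment> \<open>The term at l = 0 is 0, because 0 \<open>powr\<close> anything is 0.\<close>
  define Z where "Z = (\<Sum>l. real l powr (- \<kappa>))"
  have Zs: "summable (\<lambda>l. real l powr (- \<kappa>))" using C by (simp add: summable_real_powr_iff)
  \<comment> \<open>Depends on the dimension and p only; the 1 guarantees positivity.\<close>
  define K where "K = max 1 (max (2 * C * Z) (4 * radial_const CARD('n) * (32 * CARD('n)) powr ((real CARD('n) - 4) / 2)))"
  have K: "K > 0" "2 * C * Z \<le> K" "4 * radial_const CARD('n) * (32 * CARD('n)) powr ((real CARD('n) - 4) / 2) \<le> K"
    by (simp_all add: K_def)
  \<comment> \<open>Here \<open>c\<close> is an arbitrary function of \<rho>: the zero function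
    gives the first statement, the zeroth Fourier coefficient the second.\<close>
  have main: "memLp 2 f \<and> Lp_norm 2 f \<le> sqrt K *
      (sqrt (enn2real (\<integral>\<^sup>+\<rho>. ennreal (L2_cube_sq (\<lambda>x. periodization f \<rho> x - c \<rho>)) \<partial>\<mu>)) + Lp_norm p f)"
    if \<mu>: "haar_SO \<mu>" and f1: "memLp 1 f" and fp: "memLp p f" and L2: "AE \<rho> in \<mu>. memL2_cube (periodization f \<rho>)"
      and fin: "(\<integral>\<^sup>+\<rho>. ennreal (L2_cube_sq (\<lambda>x. periodization f \<rho> x - c \<rho>)) \<partial>\<mu>) < \<infinity>"
    for \<mu> :: "(real^'n^'n) measure" and f :: "real^'n \<Rightarrow> complex" and c
  proof -
    interpret haar \<mu> by (rule haar.intro[OF \<mu>])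
    define A where "A = enn2real (\<integral>\<^sup>+\<rho>. ennreal (L2_cube_sq (\<lambda>x. periodization f \<rho> x - c \<rho>)) \<partial>\<mu>)"
    define P where "P = Lp_norm p f"
    have A: "(\<integral>\<^sup>+\<rho>. ennreal (L2_cube_sq (\<lambda>x. periodization f \<rho> x - c \<rho>)) \<partial>\<mu>) \<le> ennreal A" "A \<ge> 0"
      using fin by (simp_all add: A_def)
    have P0: "P \<ge> 0" by (simp add: P_def Lp_norm_def)
    have fm: "f \<in> borel_measurable lborel" using f1 by (simp add: memLp_def)
    have f: "integrable lborel f"
      using f1 fm by (simp add: memLp_def integrable_norm_iff)
    have fp': "integrable lborel (\<lambda>x. norm (f x) powr p)" using fp by (simp add: memLp_def)
    have en: "energy a f \<le> K * (P\<^sup>2 + A)" if a: "a > 0" for a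
    proof -
      let ?E = "\<lambda>l. C * P\<^sup>2 * real l powr (- \<kappa>)"
      have "energy a f \<le> 2 * (\<Sum>l. ?E l) + 4 * radial_const CARD('n) * (32 * CARD('n)) powr ((real CARD('n) - 4) / 2) * A"
      proof (rule energy_bound[OF d4 f L2 A a])
        show "norm (bform a (real l / 4) f f) \<le> ?E l" if "l > 0" for l
          using decay[OF f fp' a that] by (simp add: P_def Lp_norm_def mult_ac)
        show "summable ?E" by (rule summable_mult[OF Zs])
        show "?E l \<ge> 0" for l using C by simp
      qed
      also have "(\<Sum>l. ?E l) = C * P\<^sup>2 * Z" unfolding Z_def by (rule suminf_mult[OF Zs])
      also have "2 * (C * P\<^sup>2 * Z) = (2 * C * Z) * P\<^sup>2" by simp
      also have "(2 * C * Z) * P\<^sup>2 + 4 * radial_const CARD('n) * (32 * CARD('n)) powr ((real CARD('n) - 4) / 2) * A \<le> K * P\<^sup>2 + K * A"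
        by (intro add_mono mult_right_mono K A) auto
      finally show ?thesis by (simp add: distrib_left)
    qed
    \<comment> \<open>Any null sequence of positive dampings will do, as the energy bound is uniform
      in \<open>a\<close>.\<close>
    have lim: "(\<lambda>n. 1 / real (Suc n)) \<longlonglongrightarrow> 0" by (rule LIMSEQ_Suc[OF lim_const_over_n])
    have "integrable lborel (\<lambda>x. (norm (f x))\<^sup>2)" "(\<integral>x. (norm (f x))\<^sup>2 \<partial>lborel) \<le> K * (P\<^sup>2 + A)"
      using L2_from_energy_bound[OF f en _ lim] by simp_all
    moreover have sq: "norm (f x) powr 2 = (norm (f x))\<^sup>2" for x by simp
    ultimately have mem: "memLp 2 f" and le: "(\<integral>x. norm (f x) powr 2 \<partial>lborel) \<le> K * (P\<^sup>2 + A)"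
      using fm by (simp_all add: memLp_def)
    have "Lp_norm 2 f = sqrt (\<integral>x. norm (f x) powr 2 \<partial>lborel)"
      unfolding Lp_norm_def by (rule powr_half_sqrt) (rule Bochner_Integration.integral_nonneg, simp)
    also have "\<dots> \<le> sqrt (K * (sqrt A + P)\<^sup>2)"
    proof (rule real_sqrt_le_mono)
      have "P\<^sup>2 + A \<le> (sqrt A + P)\<^sup>2" using A P0 by (simp add: power2_sum)
      then have "K * (P\<^sup>2 + A) \<le> K * (sqrt A + P)\<^sup>2" using K by (intro mult_left_mono) auto
      then show "(\<integral>x. norm (f x) powr 2 \<partial>lborel) \<le> K * (sqrt A + P)\<^sup>2" using le by linarith
    qed
    also have "\<dots> = sqrt K * (sqrt A + P)" using A P0 by (simp add: real_sqrt_mult)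
    finally show ?thesis using mem by (simp add: A_def P_def)
  qed
  show ?thesis
  proof (intro exI[of _ "sqrt K"] conjI allI impI)
    show "sqrt K > 0" using K by simp
  next
    fix \<mu> :: "(real^'n^'n) measure" and f :: "real^'n \<Rightarrow> complex"
    assume \<mu>: "haar_SO \<mu>" and h: "memLp 1 f \<and> memLp p f \<and>
       (AE \<rho> in \<mu>. memL2_cube (periodization f \<rho>)) \<and>
       (\<integral>\<^sup>+\<rho>. ennreal (L2_cube_sq (periodization f \<rho>)) \<partial>\<mu>) < \<infinity>"
    show "memLp 2 f" "Lp_norm 2 f \<le> sqrt K * (sqrt (enn2real (\<integral>\<^sup>+\<rho>. ennreal (L2_cube_sq (periodization f \<rho>)) \<partial>\<mu>)) + Lp_norm p f)"
      using main[OF \<mu>, of f "\<lambda>_. 0"] h by simp_all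
  next
    fix \<mu> :: "(real^'n^'n) measure" and f :: "real^'n \<Rightarrow> complex"
    assume \<mu>: "haar_SO \<mu>" and h: "memLp 1 f \<and> memLp p f \<and>
       (AE \<rho> in \<mu>. memL2_cube (periodization f \<rho>)) \<and>
       (\<integral>\<^sup>+\<rho>. ennreal (L2_cube_sq (\<lambda>x. periodization f \<rho> x - fourier0 (periodization f \<rho>))) \<partial>\<mu>) < \<infinity>"
    show "memLp 2 f" "Lp_norm 2 f \<le> sqrt K * (sqrt (enn2real (\<integral>\<^sup>+\<rho>. ennreal (L2_cube_sq (\<lambda>x. periodization f \<rho> x - fourier0 (periodization f \<rho>))) \<partial>\<mu>)) + Lp_norm p f)"
      using main[OF \<mu>, of f "\<lambda>\<rho>. fourier0 (periodization f \<rho>)"] h by simp_all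
  qed
qed

end
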